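(* Let $G$ be a finite group such that $\mathrm{tp}(G) > (1/2)^{40}$. Then $G$ is soluble or has a section isomorphic to the alternating group $A_5$. Moreover, this result is best possible: for no real number $c<(1/2)^{40}$ is it true that every finite group $G$ with $\mathrm{tp}(G)>c$ is soluble or has a section isomorphic to $A_5$.
   Context: For a subgroup $H$ of index $n$ in a finite group $G$, $P_G(H) := |\mathrm{DT}_G(H)|/|H|^n$, where $\mathrm{DT}_G(H)$ is the set of all subsets of $G$ that are simultaneously a left transversal (exactly one element of each left coset $gH$) and a right transversal (exactly one element of each right coset $Hg$) of $H$ in $G$. The common transversal probability of $G$ is $\mathrm{tp}(G) := \min_{H\leq G} P_G(H)$, the minimum over all subgroups $H$ of $G$. A section of $G$ is a quotient $U/N$ with $N\unlhd U\leq G$. *)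

theory Defs
  imports Complex_Main "HOL-Algebra.Algebra"
begin

definition common_transversals :: "('a, 'm) monoid_scheme \<Rightarrow> 'a set \<Rightarrow> 'a set set"
  where "common_transversals G H =
    {T. T \<subseteq> carrier G \<and>
        (\<forall>C \<in> lcosets\<^bsub>G\<^esub> H. \<exists>!x. x \<in> T \<inter> C) \<and>
        (\<forall>C \<in> rcosets\<^bsub>G\<^esub> H. \<exists>!x. x \<in> T \<inter> C)}"

text \<open>For a subgroup \<open>H\<close> of a finite group, the exponent is the index of \<open>H\<close>.\<close>

definition transversal_prob :: "('a, 'm) monoid_scheme \<Rightarrow> 'a set \<Rightarrow> real"
  where "transversal_prob G H =
    real (card (common_transversals G H)) / real (card H) ^ card (rcosets\<^bsub>G\<^esub> H)"

text \<open>Meaningful only for finite groups, where the minimum ranges over a finite nonempty set.\<close>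

definition tp :: "('a, 'm) monoid_scheme \<Rightarrow> real"
  where "tp G = Min (transversal_prob G ` {H. subgroup H G})"

definition has_section :: "('a, 'm) monoid_scheme \<Rightarrow> ('b, 'n) monoid_scheme \<Rightarrow> bool"
  where "has_section G K \<longleftrightarrow>
    (\<exists>U N. subgroup U G \<and> N \<lhd> (G\<lparr>carrier := U\<rparr>) \<and> (G\<lparr>carrier := U\<rparr>) Mod N \<cong> K)"

end

theory Submission
  imports Defs "HOL-Library.Countable"
begin

text \<open>A double coset of \<open>H\<close> that consists of \<open>k\<close> left cosets has \<open>k! (|H|/k)\<^sup>k\<close> common transversals, so
  \<open>P\<^sub>G(H)\<close> is the product of \<open>k!/k\<^sup>k\<close> over all double cosets,
  and \<open>tp\<close> does not decrease on passing to a
  section.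
  A nonsoluble group has a nonsoluble simple section, so let \<open>G\<close> be simple. If \<open>H\<close> has prime
  order \<open>p\<close>, then \<open>P\<^sub>G(H) = (p!/p\<^sup>p)\<^sup>m\<close> with \<open>m p\<^sup>2 = |G| - |N\<^sub>G(H)|\<close>. If this exceeds \<open>2\<^sup>-\<^sup>4\<^sup>0\<close> for
  every \<open>p\<close>, then \<open>|G|\<close> is small and Sylow arguments leave only the order 60,
  where \<open>G\<close> acts on five points.
  The group \<open>PSL(2,7)\<close> has order 168 and its involutions have centralisers of order 8, which gives
  exactly \<open>2\<^sup>-\<^sup>4\<^sup>0\<close>.\<close>

hide_const (open) Divisibility.prime

section \<open>Counting common transversals\<close>

text \<open>A subgroup of prime order p is always taken in the centre of a Sylow p-subgroup: its
  normaliser then contains that Sylow subgroup, and the number d of its conjugates divides the part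
  of |G| prime to p. A nonsolvable simple G acts faithfully by even permutations on these
  conjugates, so 2|G| divides d!. This forces d >= 5, hence |N_G(H)| <= |G|/5, and m p^2 = |G| -
  |N_G(H)| >= 4|G|/5 turns the bound on m into |G| <= (5/4) m p^2. The finite search that remains
  subjects every number of Sylow subgroups to the same factorial test. The exact constant matters
  again at the orders 168 and 180, where normalisers of order 8 and 20 of an involution give m = 40,
  one more than is allowed. For sharpness all subgroups of PSL(2,7) have to be bounded, not only
  those of order 2; for the others a crude geometric estimate is enough. A section A_5 is excluded
  because 60 does not divide 168.\<close>

definition transversals :: "('x \<Rightarrow> 'l) \<Rightarrow> ('x \<Rightarrow> 'r) \<Rightarrow> 'x set \<Rightarrow> 'x set set"
  where "transversals l r V =
    {T. T \<subseteq> V \<and> (\<forall>x\<in>V. \<exists>!t. t \<in> T \<and> l t = l x) \<and> (\<forall>x\<in>V. \<exists>!t. t \<in> T \<and> r t = r x)}"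

lemma transversals_empty [simp]: "transversals l r {} = {{}}"
  by (auto simp: transversals_def)

lemma finite_transversals: "finite V \<Longrightarrow> finite (transversals l r V)"
  by (rule finite_subset[of _ "Pow V"]) (auto simp: transversals_def)

lemma transversals_Un_iff:
  assumes "l ` V \<inter> l ` Y = {}" "r ` V \<inter> r ` Y = {}" "S \<subseteq> V" "T \<subseteq> Y"
  shows "S \<union> T \<in> transversals l r (V \<union> Y) \<longleftrightarrow> S \<in> transversals l r V \<and> T \<in> transversals l r Y"
proof -
  have *: "t \<in> S \<union> T \<and> l t = l x \<longleftrightarrow> t \<in> S \<and> l t = l x"
    "t \<in> S \<union> T \<and> r t = r x \<longleftrightarrow> t \<in> S \<and> r t = r x" if "x \<in> V" for x t
    using assms that by blast+
  have **: "t \<in> S \<union> T \<and> l t = l x \<longleftrightarrow> t \<in> T \<and> l t = l x"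
    "t \<in> S \<union> T \<and> r t = r x \<longleftrightarrow> t \<in> T \<and> r t = r x" if "x \<in> Y" for x t
    using assms that by blast+
  have "S \<union> T \<subseteq> V \<union> Y" using assms by blast
  then have "S \<union> T \<in> transversals l r (V \<union> Y) \<longleftrightarrow>
    (\<forall>x\<in>V. \<exists>!t. t \<in> S \<and> l t = l x) \<and> (\<forall>x\<in>Y. \<exists>!t. t \<in> T \<and> l t = l x) \<and>
    (\<forall>x\<in>V. \<exists>!t. t \<in> S \<and> r t = r x) \<and> (\<forall>x\<in>Y. \<exists>!t. t \<in> T \<and> r t = r x)"
    unfolding transversals_def mem_Collect_eq ball_Un
    by (simp only: * ** simp_thms cong: ball_cong) (simp only: conj_ac simp_thms)
  then show ?thesis unfolding transversals_def using assms(3,4) by auto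
qed

text \<open>If no label occurs in both pieces, a transversal of the union is the same as a pair of
  transversals, its traces on the two pieces.\<close>

lemma card_transversals_Un:
  assumes "l ` V \<inter> l ` Y = {}" "r ` V \<inter> r ` Y = {}"
  shows "card (transversals l r (V \<union> Y)) = card (transversals l r V) * card (transversals l r Y)"
proof -
  have dj: "V \<inter> Y = {}" using assms by blast
  have sub: "S \<subseteq> V" if "S \<in> transversals l r V" for S V using that by (auto simp: transversals_def)
  have "bij_betw (\<lambda>(S, T). S \<union> T) (transversals l r V \<times> transversals l r Y) (transversals l r (V \<union> Y))"
    unfolding bij_betw_def
  proof
    show "inj_on (\<lambda>(S, T). S \<union> T) (transversals l r V \<times> transversals l r Y)"
    proof (rule inj_onI, clarify)
      fix S T S' T'
      assume "S \<in> transversals l r V" "S' \<in> transversals l r V"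
        "T \<in> transversals l r Y" "T' \<in> transversals l r Y" and eq: "S \<union> T = S' \<union> T'"
      then have "S \<subseteq> V" "S' \<subseteq> V" "T \<subseteq> Y" "T' \<subseteq> Y" by (simp_all add: sub)
      then have "S = (S \<union> T) \<inter> V" "S' = (S' \<union> T') \<inter> V" "T = (S \<union> T) \<inter> Y" "T' = (S' \<union> T') \<inter> Y"
        using dj by blast+
      with eq show "S = S' \<and> T = T'" by metis
    qed
    show "(\<lambda>(S, T). S \<union> T) ` (transversals l r V \<times> transversals l r Y) = transversals l r (V \<union> Y)"
    proof (intro equalityI subsetI)
      fix Z assume "Z \<in> transversals l r (V \<union> Y)"
      moreover from this have Z: "Z = (Z \<inter> V) \<union> (Z \<inter> Y)" by (auto dest: sub)
      ultimately have "Z \<inter> V \<in> transversals l r V" "Z \<inter> Y \<in> transversals l r Y"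
        using transversals_Un_iff[OF assms, of "Z \<inter> V" "Z \<inter> Y"] by auto
      with Z show "Z \<in> (\<lambda>(S, T). S \<union> T) ` (transversals l r V \<times> transversals l r Y)"
        by (metis (no_types, lifting) SigmaI case_prod_conv rev_image_eqI)
    qed (use transversals_Un_iff[OF assms] sub in auto)
  qed
  then show ?thesis by (metis bij_betw_same_card card_cartesian_product)
qed

lemma card_transversals_UN:
  assumes "finite I"
    and "\<And>i j. i \<in> I \<Longrightarrow> j \<in> I \<Longrightarrow> i \<noteq> j \<Longrightarrow> l ` V i \<inter> l ` V j = {} \<and> r ` V i \<inter> r ` V j = {}"
  shows "card (transversals l r (\<Union>i\<in>I. V i)) = (\<Prod>i\<in>I. card (transversals l r (V i)))"
  using assms
proof (induction I rule: finite_induct)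
  case (insert i I)
  have "l ` V i \<inter> l ` V j = {} \<and> r ` V i \<inter> r ` V j = {}" if "j \<in> I" for j
    using insert.prems[of i j] insert.hyps that by auto
  then have "l ` V i \<inter> l ` (\<Union>j\<in>I. V j) = {}" "r ` V i \<inter> r ` (\<Union>j\<in>I. V j) = {}"
    unfolding image_UN Int_UN_distrib by simp_all
  then show ?case
    using insert card_transversals_Un[of l "V i" "\<Union>j\<in>I. V j" r] by simp
qed simp

text \<open>The labels arrange \<open>V\<close> as a k by k grid whose cells all contain c points. A
  transversal is a permutation matrix together with a point in each of its k cells. The induction
  fixes the row of one point, chooses the point x of the transversal in that row, and deletes this
  row and the column of x.\<close>

lemma card_transversals_uniform:
  assumes "finite V" "card (l ` V) = k" "card (r ` V) = k"
    and "\<And>x y. x \<in> V \<Longrightarrow> y \<in> V \<Longrightarrow> card {z \<in> V. l z = l x \<and> r z = r y} = c"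
  shows "card (transversals l r V) = fact k * c ^ k"
  using assms
proof (induction k arbitrary: V)
  case 0
  then show ?case by simp
next
  case (Suc k)
  then obtain x0 where x0: "x0 \<in> V" by (metis card.empty ex_in_conv image_empty nat.distinct(1))
  define A where "A = {x \<in> V. l x = l x0}"
  define Y where "Y x = {y \<in> V. l y \<noteq> l x0 \<and> r y \<noteq> r x}" for x
  have "card {z \<in> V. l z = l x0 \<and> r z = r x0} = c" using Suc.prems x0 by blast
  moreover have "x0 \<in> {z \<in> V. l z = l x0 \<and> r z = r x0}" using x0 by auto
  moreover have "finite {z \<in> V. l z = l x0 \<and> r z = r x0}" using Suc.prems(1) by simp
  ultimately have c: "c > 0" by (metis card_gt_0_iff empty_iff)
  \<comment> \<open>Every row meets every column, since all cells have the same positive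
    size.\<close>
  have meet: "\<exists>z\<in>V. l z = l x \<and> r z = r y" if "x \<in> V" "y \<in> V" for x y
    proof (rule ccontr)
    assume "\<not> ?thesis"
    then have "{z \<in> V. l z = l x \<and> r z = r y} = {}" by auto
    then show False using Suc.prems(4)[OF that] c by (simp only: card.empty)
  qed
  have lY: "l ` Y x = l ` V - {l x0}" if "x \<in> A" for x
  proof (intro equalityI subsetI)
    fix a assume "a \<in> l ` V - {l x0}"
    then obtain y where y: "y \<in> V" "a = l y" "l y \<noteq> l x0" by auto
    then have "card {l y, l x0} \<le> card (l ` V)" using x0 Suc.prems(1) by (intro card_mono) auto
    then have "card (r ` V) \<ge> 2" using y Suc.prems by simp
    then have "\<not> r ` V \<subseteq> {r x}" using card_mono[of "{r x}" "r ` V"] by auto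
    then obtain z where z: "z \<in> V" "r z \<noteq> r x" by auto
    \<comment> \<open>The point y may lie in the deleted column, so its row is represented by a
      point in the column of z, which survives.\<close>
    obtain w where "w \<in> V" "l w = l y" "r w = r z" using meet[OF y(1) z(1)] by blast
    then have "w \<in> Y x" "a = l w" using y z by (auto simp: Y_def)
    then show "a \<in> l ` Y x" by blast
  qed (auto simp: Y_def)
  have rY: "r ` Y x = r ` V - {r x}" if "x \<in> A" for x
  proof (intro equalityI subsetI)
    fix a assume "a \<in> r ` V - {r x}"
    then obtain y where y: "y \<in> V" "a = r y" "r y \<noteq> r x" by auto
    have x: "x \<in> V" using that by (auto simp: A_def)
    then have "card {r y, r x} \<le> card (r ` V)" using y Suc.prems(1) by (intro card_mono) auto
    then have "card (l ` V) \<ge> 2" using y Suc.prems by simp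
    then have "\<not> l ` V \<subseteq> {l x0}" using card_mono[of "{l x0}" "l ` V"] by auto
    then obtain z where z: "z \<in> V" "l z \<noteq> l x0" by auto
    obtain w where "w \<in> V" "l w = l z" "r w = r y" using meet[OF z(1) y(1)] by blast
    then have "w \<in> Y x" "a = r w" using y z by (auto simp: Y_def)
    then show "a \<in> r ` Y x" by blast
  qed (auto simp: Y_def)
  have IH: "card (transversals l r (Y x)) = fact k * c ^ k" if x: "x \<in> A" for x
  proof (rule Suc.IH)
    show "finite (Y x)" using Suc.prems by (simp add: Y_def)
    show "card (l ` Y x) = k" "card (r ` Y x) = k"
      using Suc.prems x0 x by (simp_all add: lY rY A_def)
    fix y z assume "y \<in> Y x" "z \<in> Y x"
    then have "{w \<in> Y x. l w = l y \<and> r w = r z} = {w \<in> V. l w = l y \<and> r w = r z}" "y \<in> V" "z \<in> V"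
      by (auto simp: Y_def)
    then show "card {w \<in> Y x. l w = l y \<and> r w = r z} = c" using Suc.prems(4) by simp
  qed
  have fA: "finite A" using Suc.prems by (simp add: A_def)
  have "card A = (\<Sum>b\<in>r ` V. card {z \<in> A. r z = b})"
    using sum.group[OF fA, of "r ` V" r "\<lambda>_. 1::nat"] Suc.prems(1)
    by (simp add: A_def image_mono)
  also have "\<dots> = (\<Sum>b\<in>r ` V. c)"
  proof (rule sum.cong)
    fix b assume "b \<in> r ` V"
    then obtain y where "y \<in> V" "b = r y" by auto
    then show "card {z \<in> A. r z = b} = c"
      using Suc.prems(4)[OF x0, of y] by (simp add: A_def conj_assoc)
  qed simp
  \<comment> \<open>The row \<open>A\<close> is cut by the \<open>Suc k\<close> columns into cells
    of size c.\<close>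
  finally have cA: "card A = Suc k * c" using Suc.prems by simp
  \<comment> \<open>Sort the transversals by their unique point x in the chosen row.\<close>
  have tV: "transversals l r V = (\<Union>x\<in>A. insert x ` transversals l r (Y x))"
  proof (intro equalityI subsetI)
    fix T assume T: "T \<in> transversals l r V"
    then obtain x where x: "x \<in> T" "l x = l x0" using x0 unfolding transversals_def by blast
    have xA: "x \<in> A" using x T by (auto simp: A_def transversals_def)
    have TX: "T \<subseteq> V" using T by (auto simp: transversals_def)
    have u: "t = t'" if "t \<in> T" "t' \<in> T" "l t = l t' \<or> r t = r t'" for t t'
      using that T TX unfolding transversals_def by blast
    have "T - {x} \<in> transversals l r (Y x)"
      unfolding transversals_def
    proof (intro CollectI conjI ballI)
      show "T - {x} \<subseteq> Y x" using TX u[OF _ x(1)] x by (auto simp: Y_def)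
      fix y assume y: "y \<in> Y x"
      then have "\<exists>!t. t \<in> T \<and> l t = l y" "\<exists>!t. t \<in> T \<and> r t = r y"
        using T unfolding transversals_def Y_def by blast+
      moreover have "l y \<noteq> l x" "r y \<noteq> r x" using y x by (auto simp: Y_def)
      ultimately show "\<exists>!t. t \<in> T - {x} \<and> l t = l y" "\<exists>!t. t \<in> T - {x} \<and> r t = r y"
        by (smt (verit) Diff_iff singletonD)+
    qed
    then have "insert x (T - {x}) \<in> insert x ` transversals l r (Y x)" by blast
    then show "T \<in> (\<Union>x\<in>A. insert x ` transversals l r (Y x))"
      using xA x(1) by (auto simp: insert_absorb)
  next
    fix T assume "T \<in> (\<Union>x\<in>A. insert x ` transversals l r (Y x))"
    then obtain x S where x: "x \<in> A" and S: "S \<in> transversals l r (Y x)" and T: "T = insert x S"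
      by blast
    have SY: "S \<subseteq> Y x" using S by (auto simp: transversals_def)
    have uS: "\<exists>!t. t \<in> S \<and> l t = l y" "\<exists>!t. t \<in> S \<and> r t = r y" if "y \<in> Y x" for y
      using S that by (auto simp: transversals_def)
    show "T \<in> transversals l r V"
      unfolding transversals_def
    proof (intro CollectI conjI ballI)
      show "T \<subseteq> V" using SY T x by (auto simp: A_def Y_def)
      fix y assume y: "y \<in> V"
      show "\<exists>!t. t \<in> T \<and> l t = l y"
      proof (cases "l y = l x0")
        case True
        then show ?thesis using x SY unfolding T A_def Y_def by (intro ex1I[of _ x]) auto
      next
        case False
        then have "l y \<in> l ` Y x" using y lY[OF x] by auto
        then obtain z where "z \<in> Y x" "l y = l z" by auto
        then show ?thesis using uS(1)[of z] x False unfolding T A_def by (auto)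
      qed
      show "\<exists>!t. t \<in> T \<and> r t = r y"
      proof (cases "r y = r x")
        case True
        then show ?thesis using SY unfolding T Y_def by (intro ex1I[of _ x]) auto
      next
        case False
        then have "r y \<in> r ` Y x" using y rY[OF x] by auto
        then obtain z where "z \<in> Y x" "r y = r z" by auto
        then show ?thesis using uS(2)[of z] False unfolding T by (auto)
      qed
    qed
  qed
  have inj: "inj_on (insert x) (transversals l r (Y x))" if "x \<in> A" for x
  proof -
    have "x \<notin> S" if "S \<in> transversals l r (Y x)" for S
      using that unfolding transversals_def Y_def by auto
    then show ?thesis by (intro inj_onI) (metis insert_ident)
  qed
  have "card (transversals l r V) = (\<Sum>x\<in>A. card (insert x ` transversals l r (Y x)))"
    unfolding tV
  proof (rule card_UN_disjoint)
    show "\<forall>x\<in>A. finite (insert x ` transversals l r (Y x))"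
      using Suc.prems(1) by (auto intro!: finite_transversals simp: Y_def)
    show "\<forall>x\<in>A. \<forall>y\<in>A. x \<noteq> y \<longrightarrow>
      insert x ` transversals l r (Y x) \<inter> insert y ` transversals l r (Y y) = {}"
      unfolding transversals_def A_def Y_def by auto
  qed (fact fA)
  also have "\<dots> = (\<Sum>x\<in>A. fact k * c ^ k)"
    by (intro sum.cong refl) (simp add: card_image inj IH)
  finally show ?case by (simp add: cA algebra_simps)
qed

section \<open>Double cosets and the product formula\<close>

definition dcoset :: "('a, 'm) monoid_scheme \<Rightarrow> 'a set \<Rightarrow> 'a \<Rightarrow> 'a set"
  where "dcoset G H x = {h \<otimes>\<^bsub>G\<^esub> x \<otimes>\<^bsub>G\<^esub> h' | h h'. h \<in> H \<and> h' \<in> H}"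

definition dcosets :: "('a, 'm) monoid_scheme \<Rightarrow> 'a set \<Rightarrow> 'a set set"
  where "dcosets G H = dcoset G H ` carrier G"

text \<open>The probability that a random self-map of a k-element set is a bijection; it is the
  factor contributed by a double coset made of k left cosets.\<close>

definition match_prob :: "nat \<Rightarrow> real"
  where "match_prob k = fact k / real k ^ k"

context group
begin

lemma mem_l_coset_iff:
  assumes "subgroup H G" "x \<in> carrier G" "a \<in> carrier G"
  shows "x \<in> a <# H \<longleftrightarrow> x <# H = a <# H"
  using l_repr_independence[OF _ assms(3,1)] lcos_self[OF assms(2,1)] by auto

lemma mem_r_coset_iff:
  assumes "subgroup H G" "x \<in> carrier G" "a \<in> carrier G"
  shows "x \<in> H #> a \<longleftrightarrow> H #> x = H #> a"
  using repr_independence[OF _ assms(3,1)] rcos_self[OF assms(2,1)] by auto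

lemma common_transversals_eq:
  assumes H: "subgroup H G"
  shows "common_transversals G H = transversals (\<lambda>x. x <# H) (\<lambda>x. H #> x) (carrier G)"
proof -
  have "x \<in> T \<inter> (a <# H) \<longleftrightarrow> x \<in> T \<and> x <# H = a <# H"
    "x \<in> T \<inter> (H #> a) \<longleftrightarrow> x \<in> T \<and> H #> x = H #> a"
    if "T \<subseteq> carrier G" "a \<in> carrier G" for x a T
    using mem_l_coset_iff[OF H _ that(2)] mem_r_coset_iff[OF H _ that(2)] that(1) by blast+
  then have "T \<subseteq> carrier G \<Longrightarrow>
      (\<forall>C\<in>lcosets H. \<exists>!x. x \<in> T \<inter> C) \<longleftrightarrow> (\<forall>a\<in>carrier G. \<exists>!x. x \<in> T \<and> x <# H = a <# H)"
    "T \<subseteq> carrier G \<Longrightarrow>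
      (\<forall>C\<in>rcosets H. \<exists>!x. x \<in> T \<inter> C) \<longleftrightarrow> (\<forall>a\<in>carrier G. \<exists>!x. x \<in> T \<and> H #> x = H #> a)" for T
    unfolding LCOSETS_def RCOSETS_def by simp_all
  then show ?thesis
    unfolding common_transversals_def transversals_def by (intro Collect_cong conj_cong refl)
qed

lemma mem_l_coset: "y \<in> x <# H \<longleftrightarrow> (\<exists>h\<in>H. y = x \<otimes> h)"
  by (auto simp: l_coset_def)

lemma mem_r_coset: "y \<in> H #> x \<longleftrightarrow> (\<exists>h\<in>H. y = h \<otimes> x)"
  by (auto simp: r_coset_def)

context
  fixes H assumes H: "subgroup H G"
begin

interpretation H: subgroup H G by (rule H)

lemma dcoset_self: "x \<in> carrier G \<Longrightarrow> x \<in> dcoset G H x"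
  unfolding dcoset_def by (intro CollectI exI[of _ \<one>]) simp

lemma dcoset_subset: "x \<in> carrier G \<Longrightarrow> dcoset G H x \<subseteq> carrier G"
  unfolding dcoset_def by auto

lemma dcoset_trans:
  assumes x: "x \<in> carrier G" and "y \<in> dcoset G H x" "z \<in> dcoset G H y"
  shows "z \<in> dcoset G H x"
proof -
  obtain a b c d where h: "a \<in> H" "b \<in> H" "c \<in> H" "d \<in> H" "y = a \<otimes> x \<otimes> b" "z = c \<otimes> y \<otimes> d"
    using assms unfolding dcoset_def by blast
  then have "z = (c \<otimes> a) \<otimes> x \<otimes> (b \<otimes> d)" using x by (simp add: m_assoc)
  then show ?thesis using h unfolding dcoset_def by blast
qed

lemma dcoset_sym:
  assumes x: "x \<in> carrier G" and "y \<in> dcoset G H x"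
  shows "x \<in> dcoset G H y"
proof -
  obtain a b where h: "a \<in> H" "b \<in> H" "y = a \<otimes> x \<otimes> b"
    using assms unfolding dcoset_def by blast
  then have "x = inv a \<otimes> y \<otimes> inv b" using x by (simp add: m_assoc inv_solve_left)
  then show ?thesis using h unfolding dcoset_def by blast
qed

lemma dcoset_eq: "x \<in> carrier G \<Longrightarrow> y \<in> dcoset G H x \<Longrightarrow> dcoset G H y = dcoset G H x"
  using dcoset_trans dcoset_sym dcoset_subset by (meson subsetD subsetI subset_antisym)

lemma l_coset_subset_dcoset:
  assumes "x \<in> carrier G" shows "x <# H \<subseteq> dcoset G H x"
proof
  fix y assume "y \<in> x <# H"
  then obtain h where "h \<in> H" "y = \<one> \<otimes> x \<otimes> h" using assms by (auto simp: mem_l_coset)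
  then show "y \<in> dcoset G H x" using H.one_closed unfolding dcoset_def by blast
qed

lemma r_coset_subset_dcoset:
  assumes "x \<in> carrier G" shows "H #> x \<subseteq> dcoset G H x"
proof
  fix y assume "y \<in> H #> x"
  then obtain h where "h \<in> H" "y = h \<otimes> x \<otimes> \<one>" using assms by (auto simp: mem_r_coset)
  then show "y \<in> dcoset G H x" using H.one_closed unfolding dcoset_def by blast
qed

lemma Union_dcosets: "\<Union>(dcosets G H) = carrier G"
  unfolding dcosets_def using dcoset_self dcoset_subset by blast

lemma dcosets_disjoint:
  assumes "D \<in> dcosets G H" "E \<in> dcosets G H" "z \<in> D" "z \<in> E" shows "D = E"
  using assms dcoset_eq unfolding dcosets_def by (metis (no_types, lifting) imageE)

lemma one_dcoset: "dcoset G H \<one> = H"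
proof
  show "dcoset G H \<one> \<subseteq> H" unfolding dcoset_def by auto
  show "H \<subseteq> dcoset G H \<one>" using l_coset_subset_dcoset[OF one_closed]
    by (simp add: lcos_mult_one H.subset)
qed

end

context
  fixes H assumes H: "subgroup H G" and fin: "finite (carrier G)"
begin

interpretation H: subgroup H G by (rule H)

lemma finite_dcoset: "x \<in> carrier G \<Longrightarrow> finite (dcoset G H x)"
  using dcoset_subset[OF H] fin finite_subset by blast

lemma finite_dcosets: "finite (dcosets G H)"
  using fin by (simp add: dcosets_def)

lemma card_l_coset: "x \<in> carrier G \<Longrightarrow> card (x <# H) = card H"
  by (rule l_card_cosets_equal[symmetric]) (auto simp: LCOSETS_def H.subset fin)

lemma card_r_coset: "x \<in> carrier G \<Longrightarrow> card (H #> x) = card H"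
  by (rule card_rcosets_equal[symmetric]) (auto simp: RCOSETS_def H.subset)

text \<open>Multiplication by a on the left and b on the right maps one intersection injectively
  into the other. This makes all cells of the grid inside a double coset equally large.\<close>

lemma card_coset_Int_mult:
  assumes "y \<in> carrier G" "w \<in> carrier G" "a \<in> H" "b \<in> H"
  shows "card (((a \<otimes> y) <# H) \<inter> (H #> (w \<otimes> b))) = card ((y <# H) \<inter> (H #> w))"
proof -
  have *: "card ((y <# H) \<inter> (H #> w)) \<le> card (((a \<otimes> y) <# H) \<inter> (H #> (w \<otimes> b)))"
    if "y \<in> carrier G" "w \<in> carrier G" "a \<in> H" "b \<in> H" for y w a b
  proof (rule card_inj_on_le)
    have sub: "y <# H \<subseteq> carrier G" using that(1) by (simp add: H.subset l_coset_subset_G)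
    show "inj_on (\<lambda>z. a \<otimes> z \<otimes> b) ((y <# H) \<inter> (H #> w))"
    proof (rule inj_onI)
      fix u v assume "u \<in> (y <# H) \<inter> (H #> w)" "v \<in> (y <# H) \<inter> (H #> w)"
      then have "u \<in> carrier G" "v \<in> carrier G" using sub by blast+
      moreover assume "a \<otimes> u \<otimes> b = a \<otimes> v \<otimes> b"
      ultimately show "u = v" using that(3,4) by simp
    qed
    show "(\<lambda>z. a \<otimes> z \<otimes> b) ` ((y <# H) \<inter> (H #> w)) \<subseteq> ((a \<otimes> y) <# H) \<inter> (H #> (w \<otimes> b))"
    proof (intro image_subsetI)
      fix z assume "z \<in> (y <# H) \<inter> (H #> w)"
      then obtain h k where hk: "h \<in> H" "k \<in> H" "z = y \<otimes> h" "z = k \<otimes> w"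
        by (auto simp: mem_l_coset mem_r_coset)
      then have "a \<otimes> z \<otimes> b = (a \<otimes> y) \<otimes> (h \<otimes> b)" using that by (simp add: m_assoc)
      moreover have "a \<otimes> z \<otimes> b = (a \<otimes> k) \<otimes> (w \<otimes> b)" using hk(2,4) that by (simp add: m_assoc)
      moreover have "h \<otimes> b \<in> H" "a \<otimes> k \<in> H" using hk that by simp_all
      ultimately show "a \<otimes> z \<otimes> b \<in> ((a \<otimes> y) <# H) \<inter> (H #> (w \<otimes> b))"
        unfolding mem_l_coset mem_r_coset Int_iff by blast
    qed
    have "(a \<otimes> y) <# H \<subseteq> carrier G" using that by (simp add: H.subset l_coset_subset_G)
    then show "finite (((a \<otimes> y) <# H) \<inter> (H #> (w \<otimes> b)))" using fin finite_subset by blast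
  qed
  \<comment> \<open>The reverse inequality is the same one, applied to the translated cosets and to
    the inverses of a and b.\<close>
  have "inv a \<otimes> (a \<otimes> y) = y" "(w \<otimes> b) \<otimes> inv b = w"
    using assms by (simp_all add: m_assoc[symmetric]) (simp add: m_assoc)
  then show ?thesis
    using *[OF assms] *[of "a \<otimes> y" "w \<otimes> b" "inv a" "inv b"] assms by simp
qed

text \<open>A double coset is a grid with its left cosets as rows and its right cosets as columns.
  Rows and columns all have |H| points, so there are equally many of each, and a row is cut by the k
  columns into k equal cells, whence k c = |H|.\<close>

lemma card_dcoset:
  assumes x: "x \<in> carrier G"
  defines "D \<equiv> dcoset G H x"
  shows "card D = card ((\<lambda>y. y <# H) ` D) * card H" "card D = card ((\<lambda>y. H #> y) ` D) * card H"
    and "y \<in> D \<Longrightarrow> w \<in> D \<Longrightarrow>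
      card {z \<in> D. z <# H = y <# H \<and> H #> z = H #> w} = card ((x <# H) \<inter> (H #> x))"
    and "card ((\<lambda>y. H #> y) ` D) * card ((x <# H) \<inter> (H #> x)) = card H"
proof -
  have DG: "D \<subseteq> carrier G" using dcoset_subset[OF H x] by (simp add: D_def)
  have fD: "finite D" using DG fin finite_subset by blast
  have D_eq: "dcoset G H y = D" if "y \<in> D" for y using dcoset_eq[OF H x] that by (simp add: D_def)
  have lD: "{z \<in> D. z <# H = y <# H} = y <# H" if "y \<in> D" for y
    using that DG l_coset_subset_dcoset[OF H, of y] D_eq[OF that] mem_l_coset_iff[OF H, of _ y]
      l_coset_subset_G[OF H.subset] by blast
  have rD: "{z \<in> D. H #> z = H #> y} = H #> y" if "y \<in> D" for y
    using that DG r_coset_subset_dcoset[OF H, of y] D_eq[OF that] mem_r_coset_iff[OF H, of _ y]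
      r_coset_subset_G[OF H.subset] by blast
  have "card D = (\<Sum>b\<in>(\<lambda>y. y <# H) ` D. card {z \<in> D. z <# H = b})"
    using sum.group[OF fD, of "(\<lambda>y. y <# H) ` D" "\<lambda>y. y <# H" "\<lambda>_. 1::nat"] fD by simp
  also have "\<dots> = (\<Sum>b\<in>(\<lambda>y. y <# H) ` D. card H)"
    by (intro sum.cong refl) (use DG in \<open>auto simp: lD card_l_coset\<close>)
  finally show "card D = card ((\<lambda>y. y <# H) ` D) * card H" by simp
  have "card D = (\<Sum>b\<in>(\<lambda>y. H #> y) ` D. card {z \<in> D. H #> z = b})"
    using sum.group[OF fD, of "(\<lambda>y. H #> y) ` D" "\<lambda>y. H #> y" "\<lambda>_. 1::nat"] fD by simp
  also have "\<dots> = (\<Sum>b\<in>(\<lambda>y. H #> y) ` D. card H)"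
    by (intro sum.cong refl) (use DG in \<open>auto simp: rD card_r_coset\<close>)
  finally show "card D = card ((\<lambda>y. H #> y) ` D) * card H" by simp
  show c: "card {z \<in> D. z <# H = y <# H \<and> H #> z = H #> w} = card ((x <# H) \<inter> (H #> x))"
    if y: "y \<in> D" and w: "w \<in> D" for y w
  proof -
    obtain a b where ab: "a \<in> H" "b \<in> H" "y = a \<otimes> x \<otimes> b" using y by (auto simp: D_def dcoset_def)
    obtain c d where cd: "c \<in> H" "d \<in> H" "w = c \<otimes> x \<otimes> d" using w by (auto simp: D_def dcoset_def)
    have "y <# H = (a \<otimes> x) <# H"
      using mem_l_coset_iff[OF H, of y "a \<otimes> x"] ab x by (auto simp: mem_l_coset)
    moreover have "H #> w = H #> (x \<otimes> d)"
      using mem_r_coset_iff[OF H, of w "x \<otimes> d"] cd x by (auto simp: mem_r_coset m_assoc)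
    moreover have "{z \<in> D. z <# H = y <# H \<and> H #> z = H #> w} = (y <# H) \<inter> (H #> w)"
      using lD[OF y] rD[OF w] by blast
    ultimately show ?thesis using card_coset_Int_mult[of x x a d] x ab cd by simp
  qed
  have xD: "x \<in> D" using dcoset_self[OF H x] by (simp add: D_def)
  have "card H = card {z \<in> D. z <# H = x <# H}" using lD[OF xD] card_l_coset[OF x] by simp
  also have "\<dots> = (\<Sum>b\<in>(\<lambda>y. H #> y) ` D. card {z \<in> {z \<in> D. z <# H = x <# H}. H #> z = b})"
    using sum.group[of "{z \<in> D. z <# H = x <# H}" "(\<lambda>y. H #> y) ` D" "\<lambda>y. H #> y" "\<lambda>_. 1::nat"] fD
    by (simp add: image_mono)
  also have "\<dots> = (\<Sum>b\<in>(\<lambda>y. H #> y) ` D. card ((x <# H) \<inter> (H #> x)))"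
    by (intro sum.cong refl) (use c[OF xD] in \<open>auto simp: conj_assoc\<close>)
  finally show "card ((\<lambda>y. H #> y) ` D) * card ((x <# H) \<inter> (H #> x)) = card H" by simp
qed

lemma card_H_pos: "card H > 0"
  using H.one_closed fin H.subset by (metis card_gt_0_iff empty_iff finite_subset)

lemma card_dcoset_div:
  assumes D: "D \<in> dcosets G H"
  shows "card D = card D div card H * card H" "card D div card H > 0"
proof -
  obtain x where x: "x \<in> carrier G" "D = dcoset G H x" using D by (auto simp: dcosets_def)
  show *: "card D = card D div card H * card H"
    using card_dcoset(1)[OF x(1)] card_H_pos x(2)
    by (metis nonzero_mult_div_cancel_right not_gr_zero)
  have "card D > 0"
    using dcoset_self[OF H x(1)] finite_dcoset[OF x(1)] x(2) by (metis card_gt_0_iff empty_iff)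
  then show "card D div card H > 0" using * by (metis mult_is_0 not_gr_zero)
qed

text \<open>The count k! c^k becomes \<open>match_prob k\<close> times |H|^k because k c =
  |H|.\<close>

lemma card_transversals_dcoset:
  assumes D: "D \<in> dcosets G H"
  shows "real (card (transversals (\<lambda>x. x <# H) (\<lambda>x. H #> x) D)) =
    match_prob (card D div card H) * real (card H) ^ (card D div card H)"
proof -
  obtain x where x: "x \<in> carrier G" "D = dcoset G H x" using D by (auto simp: dcosets_def)
  let ?k = "card D div card H" and ?c = "card ((x <# H) \<inter> (H #> x))"
  have k: "card ((\<lambda>y. y <# H) ` D) = ?k" "card ((\<lambda>y. H #> y) ` D) = ?k"
    using card_dcoset(1,2)[OF x(1)] card_H_pos x(2) by simp_all
  have "card (transversals (\<lambda>x. x <# H) (\<lambda>x. H #> x) D) = fact ?k * ?c ^ ?k"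
    by (rule card_transversals_uniform)
      (use x k finite_dcoset[OF x(1)] card_dcoset(3)[OF x(1)] in simp_all)
  moreover have "card H = ?k * ?c" using card_dcoset(4)[OF x(1)] k x(2) by simp
  moreover from this have "real (card H) ^ ?k = real ?k ^ ?k * real ?c ^ ?k"
    by (metis of_nat_mult power_mult_distrib)
  ultimately show ?thesis using card_dcoset_div(2)[OF D] by (simp add: match_prob_def)
qed

lemma card_rcosets_eq_sum: "card (rcosets H) = (\<Sum>D\<in>dcosets G H. card D div card H)"
proof -
  have "card (carrier G) = (\<Sum>D\<in>dcosets G H. card D)"
  proof -
    have "disjoint (dcosets G H)"
      unfolding pairwise_def disjnt_def using dcosets_disjoint[OF H] by blast
    moreover have "finite D" if "D \<in> dcosets G H" for D
      using that finite_dcoset by (auto simp: dcosets_def)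
    ultimately show ?thesis
      using card_Union_disjoint[of "dcosets G H"] Union_dcosets[OF H] by simp
  qed
  also have "\<dots> = (\<Sum>D\<in>dcosets G H. card D div card H) * card H"
    unfolding sum_distrib_right by (intro sum.cong refl card_dcoset_div(1))
  finally have "card (rcosets H) * card H = (\<Sum>D\<in>dcosets G H. card D div card H) * card H"
    using lagrange[OF H] by (simp add: order_def)
  then show ?thesis using card_H_pos by simp
qed

text \<open>Different double cosets share no left or right coset, so the counts multiply; the
  exponents of |H| add up to the index and cancel against the denominator.\<close>

theorem transversal_prob_eq_prod:
  "transversal_prob G H = (\<Prod>D\<in>dcosets G H. match_prob (card D div card H))"
proof -
  let ?l = "\<lambda>x. x <# H" and ?r = "\<lambda>x. H #> x"
  have dis: "?l ` D \<inter> ?l ` E = {} \<and> ?r ` D \<inter> ?r ` E = {}"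
    if DE: "D \<in> dcosets G H" "E \<in> dcosets G H" "D \<noteq> E" for D E
  proof -
    have sub: "y <# H \<subseteq> D" "H #> y \<subseteq> D" "y \<in> carrier G" if "D \<in> dcosets G H" "y \<in> D" for y D
    proof -
      obtain x where x: "x \<in> carrier G" "D = dcoset G H x" using \<open>D \<in> _\<close> by (auto simp: dcosets_def)
      have "dcoset G H y = D" using dcoset_eq[OF H x(1)] x(2) \<open>y \<in> D\<close> by simp
      moreover show "y \<in> carrier G" using dcoset_subset[OF H x(1)] x(2) \<open>y \<in> D\<close> by blast
      ultimately show "y <# H \<subseteq> D" "H #> y \<subseteq> D"
        using l_coset_subset_dcoset[OF H] r_coset_subset_dcoset[OF H] by blast+
    qed
    have False if "y \<in> D" "z \<in> E" "y <# H = z <# H \<or> H #> y = H #> z" for y z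
    proof -
      have "y \<in> E" using that(3) sub[OF DE(1) that(1)] sub[OF DE(2) that(2)]
          lcos_self[OF _ H, of y] rcos_self[OF _ H, of y] by auto
      then show False using dcosets_disjoint[OF H DE(1,2) that(1)] DE(3) by blast
    qed
    then show ?thesis by blast
  qed
  have "card (common_transversals G H) = (\<Prod>D\<in>dcosets G H. card (transversals ?l ?r D))"
    using card_transversals_UN[OF finite_dcosets, of ?l "\<lambda>D. D" ?r] dis
    by (simp add: common_transversals_eq[OF H] Union_dcosets[OF H])
  then have "real (card (common_transversals G H)) =
    (\<Prod>D\<in>dcosets G H. match_prob (card D div card H)) * real (card H) ^ card (rcosets H)"
    by (simp add: card_transversals_dcoset card_rcosets_eq_sum prod.distrib power_sum)
  then show ?thesis using card_H_pos by (simp add: transversal_prob_def)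
qed

end

end

lemma match_prob_1 [simp]: "match_prob (Suc 0) = 1"
  by (simp add: match_prob_def)

lemma match_prob_nonneg: "0 \<le> match_prob k"
  by (simp add: match_prob_def)

lemma match_prob_Suc: "match_prob (Suc k) = match_prob k * (real k / real (Suc k)) ^ k"
proof -
  have "real (Suc k) * real (Suc k) ^ k * (real k / real (Suc k)) ^ k = real (Suc k) * real k ^ k"
    by (simp add: power_divide)
  then show ?thesis by (cases "k = 0") (simp_all add: match_prob_def power_divide)
qed

lemma match_prob_le_1: "match_prob k \<le> 1"
  using fact_le_power[of k, where 'a = real]
  by (cases "k = 0") (simp_all add: match_prob_def divide_le_eq)

section \<open>Monotonicity of tp under subgroups and quotients\<close>

context group
begin

lemma finite_subgroups: "finite (carrier G) \<Longrightarrow> finite {H. subgroup H G}"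
  by (rule finite_subset[of _ "Pow (carrier G)"]) (auto dest: subgroup.subset)

lemma tp_le: "finite (carrier G) \<Longrightarrow> subgroup H G \<Longrightarrow> tp G \<le> transversal_prob G H"
  unfolding tp_def by (rule Min_le) (auto simp: finite_subgroups)

lemma tp_geI:
  assumes "finite (carrier G)" "\<And>H. subgroup H G \<Longrightarrow> c \<le> transversal_prob G H"
  shows "c \<le> tp G"
  unfolding tp_def using assms subgroup_self by (subst Min_ge_iff) (auto simp: finite_subgroups)

lemma tp_attained:
  assumes "finite (carrier G)"
  obtains H where "subgroup H G" "tp G = transversal_prob G H"
proof -
  have "tp G \<in> transversal_prob G ` {H. subgroup H G}"
    unfolding tp_def using assms subgroup_self by (intro Min_in) (auto simp: finite_subgroups)
  then show ?thesis using that by auto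
qed

text \<open>The double cosets of H inside U are among those inside G, as the same sets; the
  additional factors for G are at most 1.\<close>

lemma transversal_prob_subgroup:
  assumes fin: "finite (carrier G)" and U: "subgroup U G" and H: "subgroup H (G\<lparr>carrier := U\<rparr>)"
  shows "transversal_prob G H \<le> transversal_prob (G\<lparr>carrier := U\<rparr>) H"
proof -
  interpret U: group "G\<lparr>carrier := U\<rparr>" by (rule subgroup_imp_group[OF U])
  have HG: "subgroup H G" using H U incl_subgroup by blast
  have UG: "U \<subseteq> carrier G" using U subgroup.subset by blast
  have sub: "dcosets (G\<lparr>carrier := U\<rparr>) H \<subseteq> dcosets G H"
    using UG by (auto simp: dcosets_def dcoset_def)
  have "transversal_prob G H = (\<Prod>D\<in>dcosets G H. match_prob (card D div card H))"
    by (rule transversal_prob_eq_prod[OF HG fin])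
  also have "\<dots> \<le> (\<Prod>D\<in>dcosets (G\<lparr>carrier := U\<rparr>) H. match_prob (card D div card H))"
    using prod.subset_diff[OF sub finite_dcosets[OF HG fin], of
    "\<lambda>D. match_prob (card D div card H)"]
    by (simp add: mult_left_le_one_le prod_nonneg prod_le_1 match_prob_nonneg match_prob_le_1)
  also have "\<dots> = transversal_prob (G\<lparr>carrier := U\<rparr>) H"
    using U.transversal_prob_eq_prod[OF H] fin UG finite_subset by fastforce
  finally show ?thesis .
qed

lemma tp_subgroup:
  assumes fin: "finite (carrier G)" and U: "subgroup U G"
  shows "tp G \<le> tp (G\<lparr>carrier := U\<rparr>)"
proof -
  interpret U: group "G\<lparr>carrier := U\<rparr>" by (rule subgroup_imp_group[OF U])
  have "finite U" using fin U subgroup.subset finite_subset by metis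
  then obtain H where H: "subgroup H (G\<lparr>carrier := U\<rparr>)"
    "tp (G\<lparr>carrier := U\<rparr>) = transversal_prob (G\<lparr>carrier := U\<rparr>) H"
    using U.tp_attained by auto
  have "tp G \<le> transversal_prob G H" using tp_le[OF fin incl_subgroup[OF U H(1)]] .
  then show ?thesis using transversal_prob_subgroup[OF fin U H(1)] H(2) by simp
qed

end

lemma (in group_hom) subgroup_preimage:
  assumes "subgroup K H" shows "subgroup {x \<in> carrier G. h x \<in> K} G"
proof -
  interpret K: subgroup K H by fact
  have "\<one> \<in> {x \<in> carrier G. h x \<in> K}" by simp
  then show ?thesis by (intro G.subgroupI) auto
qed

lemma (in group_hom) card_preimage:
  assumes fin: "finite (carrier G)" and surj: "h ` carrier G = carrier H" and S: "S \<subseteq> carrier H"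
  shows "card {x \<in> carrier G. h x \<in> S} = card S * card (kernel G H h)"
proof -
  have fib: "card {x \<in> carrier G. h x = s} = card (kernel G H h)" if s: "s \<in> carrier H" for s
  proof -
    obtain g where g: "g \<in> carrier G" "h g = s" using surj s by (metis imageE)
    have "bij_betw (\<lambda>x. g \<otimes>\<^bsub>G\<^esub> x) (kernel G H h) {x \<in> carrier G. h x = s}"
    proof (rule bij_betw_byWitness[where f' = "\<lambda>y. inv\<^bsub>G\<^esub> g \<otimes>\<^bsub>G\<^esub> y"])
    qed (use g in \<open>auto simp: kernel_def G.m_assoc[symmetric]\<close>)
    then show ?thesis by (simp add: bij_betw_same_card)
  qed
  have fS: "finite S" using surj fin S by (metis finite_imageI finite_subset)
  have "card {x \<in> carrier G. h x \<in> S} = (\<Sum>s\<in>S. card {x \<in> {x \<in> carrier G. h x \<in> S}. h x = s})"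
    using sum.group[of "{x \<in> carrier G. h x \<in> S}" S h "\<lambda>_. 1::nat"] fin fS
    by (simp add: image_subset_iff)
  also have "\<dots> = (\<Sum>s\<in>S. card (kernel G H h))"
  proof (rule sum.cong)
    fix s assume s: "s \<in> S"
    then have "{x \<in> {x \<in> carrier G. h x \<in> S}. h x = s} = {x \<in> carrier G. h x = s}" by auto
    then show "card {x \<in> {x \<in> carrier G. h x \<in> S}. h x = s} = card (kernel G H h)"
      using fib s S by auto
  qed simp
  finally show ?thesis by simp
qed

text \<open>The double cosets of the preimage of K are the preimages of the double cosets of K. All
  sizes are multiplied by the order of the kernel, so every quotient |D|/|K| is preserved.\<close>

lemma (in group_hom) transversal_prob_preimage:
  assumes fin: "finite (carrier G)" and surj: "h ` carrier G = carrier H" and K: "subgroup K H"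
  shows "transversal_prob G {x \<in> carrier G. h x \<in> K} = transversal_prob H K"
proof -
  define P where "P S = {x \<in> carrier G. h x \<in> S}" for S
  have cP: "card (P S) = card S * card (kernel G H h)" if "S \<subseteq> carrier H" for S
    using card_preimage[OF fin surj that] by (simp add: P_def)
  have kpos: "card (kernel G H h) > 0"
    using G.subgroup_self fin subgroup.finite_imp_card_positive[OF subgroup_kernel] by simp
  have KH: "K \<subseteq> carrier H" using K by (rule subgroup.subset)
  have dc: "dcoset G (P K) x = P (dcoset H K (h x))" if x: "x \<in> carrier G" for x
  proof (intro equalityI subsetI)
    fix y assume "y \<in> dcoset G (P K) x"
    then obtain a b where "y = a \<otimes>\<^bsub>G\<^esub> x \<otimes>\<^bsub>G\<^esub> b" "a \<in> carrier G" "b \<in> carrier G" "h a \<in> K" "h b \<in> K"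
      unfolding dcoset_def P_def by blast
    then have "y \<in> carrier G" "h y = h a \<otimes>\<^bsub>H\<^esub> h x \<otimes>\<^bsub>H\<^esub> h b" using x by simp_all
    then show "y \<in> P (dcoset H K (h x))"
      using \<open>h a \<in> K\<close> \<open>h b \<in> K\<close> unfolding dcoset_def P_def by blast
  next
    fix y assume "y \<in> P (dcoset H K (h x))"
    then obtain a b where y: "y \<in> carrier G" "a \<in> K" "b \<in> K" "h y = a \<otimes>\<^bsub>H\<^esub> h x \<otimes>\<^bsub>H\<^esub> b"
      unfolding dcoset_def P_def by blast
    then obtain u where u: "u \<in> carrier G" "h u = a" using surj KH by (metis imageE subsetD)
    \<comment> \<open>The solution of y = u x v; the point is that it maps to b and so lies in the
      preimage of K.\<close>
    let ?v = "inv\<^bsub>G\<^esub> x \<otimes>\<^bsub>G\<^esub> (inv\<^bsub>G\<^esub> u \<otimes>\<^bsub>G\<^esub> y)"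
    have b: "b \<in> carrier H" using y KH by blast
    have "h ?v = inv\<^bsub>H\<^esub> (h x) \<otimes>\<^bsub>H\<^esub> (inv\<^bsub>H\<^esub> a \<otimes>\<^bsub>H\<^esub> (a \<otimes>\<^bsub>H\<^esub> h x \<otimes>\<^bsub>H\<^esub> b))"
      using u x y by simp
    also have "\<dots> = b"
      using u(1) u(2)[symmetric] x b by (simp add: H.m_assoc[symmetric])
    finally have "?v \<in> P K" using u x y by (simp add: P_def)
    moreover have "x \<otimes>\<^bsub>G\<^esub> ?v = inv\<^bsub>G\<^esub> u \<otimes>\<^bsub>G\<^esub> y"
      using u x y(1) by (simp add: G.m_assoc[symmetric])
    then have "u \<otimes>\<^bsub>G\<^esub> x \<otimes>\<^bsub>G\<^esub> ?v = u \<otimes>\<^bsub>G\<^esub> (inv\<^bsub>G\<^esub> u \<otimes>\<^bsub>G\<^esub> y)"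
      using u x y(1) by (simp add: G.m_assoc)
    then have "y = u \<otimes>\<^bsub>G\<^esub> x \<otimes>\<^bsub>G\<^esub> ?v" using u y(1) by (simp add: G.m_assoc[symmetric])
    ultimately show "y \<in> dcoset G (P K) x" using u y unfolding dcoset_def P_def by blast
  qed
  have sub: "D \<subseteq> carrier H" if "D \<in> dcosets H K" for D
    using that H.dcoset_subset[OF K] by (auto simp: dcosets_def)
  have "P ` dcosets H K = (\<lambda>x. P (dcoset H K (h x))) ` carrier G"
    unfolding dcosets_def surj[symmetric] by (simp add: image_image)
  also have "\<dots> = dcosets G (P K)" unfolding dcosets_def by (intro image_cong refl) (simp add: dc)
  finally have im: "dcosets G (P K) = P ` dcosets H K" ..
  have inj: "inj_on P (dcosets H K)"
  proof (rule inj_onI)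
    fix D E assume DE: "D \<in> dcosets H K" "E \<in> dcosets H K" "P D = P E"
    have "h ` P D = D" if D: "D \<in> dcosets H K" for D
    proof
      show "D \<subseteq> h ` P D"
      proof
        fix d assume "d \<in> D"
        moreover from this obtain g where "g \<in> carrier G" "d = h g"
          using sub[OF D] surj by (metis imageE subsetD)
        ultimately show "d \<in> h ` P D" by (auto simp: P_def)
      qed
    qed (auto simp: P_def)
    then show "D = E" using DE by metis
  qed
  have "transversal_prob G (P K) = (\<Prod>D\<in>P ` dcosets H K. match_prob (card D div card (P K)))"
    using G.transversal_prob_eq_prod[OF subgroup_preimage[OF K] fin] im by (simp add: P_def)
  also have "\<dots> = (\<Prod>D\<in>dcosets H K. match_prob (card D div card K))"
    using kpos by (subst prod.reindex[OF inj]) (intro prod.cong, auto simp: cP sub KH)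
  also have "\<dots> = transversal_prob H K"
    using H.transversal_prob_eq_prod[OF K] fin surj by (metis finite_imageI)
  finally show ?thesis by (simp add: P_def)
qed

lemma (in group_hom) tp_surj:
  assumes fin: "finite (carrier G)" and surj: "h ` carrier G = carrier H"
  shows "tp G \<le> tp H"
proof -
  have "finite (carrier H)" using fin surj by (metis finite_imageI)
  then obtain K where K: "subgroup K H" "tp H = transversal_prob H K" using H.tp_attained by blast
  have "tp G \<le> transversal_prob G {x \<in> carrier G. h x \<in> K}"
    by (rule G.tp_le[OF fin subgroup_preimage[OF K(1)]])
  then show ?thesis using transversal_prob_preimage[OF fin surj K(1)] K(2) by simp
qed

lemma (in normal) group_hom_Mod: "group_hom G (G Mod H) (\<lambda>a. H #> a)"
  unfolding group_hom_def group_hom_axioms_def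
  by (simp add: r_coset_hom_Mod is_group factorgroup_is_group)

lemma (in normal) surj_Mod: "(\<lambda>a. H #> a) ` carrier G = carrier (G Mod H)"
  by (auto simp: FactGroup_def RCOSETS_def)

lemma (in group) tp_section:
  assumes "finite (carrier G)" "subgroup U G" "N \<lhd> (G\<lparr>carrier := U\<rparr>)"
  shows "tp G \<le> tp ((G\<lparr>carrier := U\<rparr>) Mod N)"
proof -
  interpret N: normal N "G\<lparr>carrier := U\<rparr>" by fact
  have "finite U" using assms subgroup.subset finite_subset by metis
  then have "tp (G\<lparr>carrier := U\<rparr>) \<le> tp ((G\<lparr>carrier := U\<rparr>) Mod N)"
    using group_hom.tp_surj[OF N.group_hom_Mod _ N.surj_Mod] by simp
  then show ?thesis using tp_subgroup[OF assms(1,2)] by simp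
qed

section \<open>Subgroups of prime order\<close>

context group
begin

lemma mem_normalizer_iff:
  assumes "subgroup H G"
  shows "x \<in> normalizer G H \<longleftrightarrow> x \<in> carrier G \<and> x <# H = H #> x"
proof -
  have HG: "H \<subseteq> carrier G" using assms by (rule subgroup.subset)
  have "(x <# H) #> inv x = H \<longleftrightarrow> x <# H = H #> x" if x: "x \<in> carrier G"
  proof
    assume "(x <# H) #> inv x = H"
    then have "((x <# H) #> inv x) #> x = H #> x" by simp
    then show "x <# H = H #> x"
      using x HG l_coset_subset_G[OF HG x] by (simp add: coset_mult_assoc coset_mult_one)
  next
    assume "x <# H = H #> x"
    then show "(x <# H) #> inv x = H" using x HG by (simp add: coset_mult_assoc coset_mult_one)
  qed
  then show ?thesis unfolding normalizer_def stabilizer_def using HG by auto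
qed

lemma dcoset_normalizer:
  assumes H: "subgroup H G" and x: "x \<in> normalizer G H"
  shows "dcoset G H x = x <# H"
proof
  interpret H: subgroup H G by (rule H)
  have x': "x \<in> carrier G" "x <# H = H #> x" using x mem_normalizer_iff[OF H] by auto
  show "dcoset G H x \<subseteq> x <# H"
  proof
    fix y assume "y \<in> dcoset G H x"
    then obtain a b where y: "a \<in> H" "b \<in> H" "y = a \<otimes> x \<otimes> b" by (auto simp: dcoset_def)
    have "a \<otimes> x \<in> x <# H" using x' y by (auto simp: mem_r_coset)
    then obtain c where "c \<in> H" "a \<otimes> x = x \<otimes> c" by (auto simp: mem_l_coset)
    then have "y = x \<otimes> (c \<otimes> b)" "c \<otimes> b \<in> H" using y x' by (auto simp: m_assoc)
    then show "y \<in> x <# H" by (auto simp: mem_l_coset)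
  qed
  show "x <# H \<subseteq> dcoset G H x" by (rule l_coset_subset_dcoset[OF H x'(1)])
qed

text \<open>The number k of right cosets in the double coset divides the prime |H|, and k = 1 holds
  exactly if xH = HxH = Hx.\<close>

lemma card_dcoset_prime:
  assumes H: "subgroup H G" and fin: "finite (carrier G)" and p: "prime (card H)"
    and x: "x \<in> carrier G"
  shows "card (dcoset G H x) div card H = (if x \<in> normalizer G H then 1 else card H)"
proof (cases "x \<in> normalizer G H")
  case True
  then show ?thesis
    using dcoset_normalizer[OF H True] card_l_coset[OF H fin x] card_H_pos[OF H fin] by simp
next
  case False
  interpret H: subgroup H G by (rule H)
  let ?D = "dcoset G H x"
  let ?k = "card ?D div card H"
  have k: "?k = card ((\<lambda>y. H #> y) ` ?D)"
    using card_dcoset(2)[OF H fin x] card_H_pos[OF H fin] by simp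
  then have "?k dvd card H" using card_dcoset(4)[OF H fin x] by (metis dvd_triv_left)
  then have "?k = 1 \<or> ?k = card H" using p prime_nat_iff by auto
  moreover have "?k \<noteq> 1"
  proof
    assume "?k = 1"
    then have "card ?D = card H" using card_dcoset(2)[OF H fin x] k by simp
    then have "?D = x <# H" "?D = H #> x"
      using card_subset_eq[OF finite_dcoset[OF H fin x] l_coset_subset_dcoset[OF H x]]
        card_subset_eq[OF finite_dcoset[OF H fin x] r_coset_subset_dcoset[OF H x]]
        card_l_coset[OF H fin x] card_r_coset[OF H fin x] by auto
    then show False using False mem_normalizer_iff[OF H] x by auto
  qed
  ultimately show ?thesis using False by simp
qed

text \<open>Double cosets inside the normaliser contribute the factor 1. The others have p^2
  elements each, contribute \<open>match_prob p\<close> and partition the complement of the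
  normaliser, so m is their number.\<close>

theorem transversal_prob_prime:
  assumes H: "subgroup H G" and fin: "finite (carrier G)" and p: "prime (card H)"
  obtains m where "transversal_prob G H = match_prob (card H) ^ m"
    "m * (card H)\<^sup>2 + card (normalizer G H) = order G"
proof -
  let ?N = "normalizer G H" and ?p = "card H"
  define \<D> where "\<D> = dcoset G H ` (carrier G - ?N)"
  have sub: "\<D> \<subseteq> dcosets G H" by (auto simp: \<D>_def dcosets_def)
  have fD: "finite \<D>" using finite_subset[OF sub finite_dcosets[OF H fin]] .
  have p2: "?p \<ge> 2" using p prime_ge_2_nat by blast
  have k\<D>: "card D div ?p = ?p" if "D \<in> \<D>" for D
    using that card_dcoset_prime[OF H fin p] by (auto simp: \<D>_def)
  have kN: "card D div ?p = 1" if "D \<in> dcosets G H - \<D>" for D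
    using that card_dcoset_prime[OF H fin p] by (auto simp: \<D>_def dcosets_def)
  have "transversal_prob G H = (\<Prod>D\<in>\<D>. match_prob (card D div ?p))"
    unfolding transversal_prob_eq_prod[OF H fin]
    by (rule prod.mono_neutral_right[OF finite_dcosets[OF H fin] sub]) (use kN in auto)
  also have "\<dots> = match_prob ?p ^ card \<D>" by (simp add: k\<D>)
  finally have 1: "transversal_prob G H = match_prob ?p ^ card \<D>" .
  have un: "\<Union>\<D> = carrier G - ?N"
  proof
    show "carrier G - ?N \<subseteq> \<Union>\<D>" using dcoset_self[OF H] by (auto simp: \<D>_def)
    show "\<Union>\<D> \<subseteq> carrier G - ?N"
    proof
      fix y assume "y \<in> \<Union>\<D>"
      then obtain D where "D \<in> \<D>" and y: "y \<in> D" by blast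
      then obtain x where x: "x \<in> carrier G" "x \<notin> ?N" "D = dcoset G H x" by (auto simp: \<D>_def)
      then have "y \<in> carrier G" "dcoset G H y = dcoset G H x"
        using dcoset_subset[OF H] dcoset_eq[OF H] y by blast+
      \<comment> \<open>Lying in the normaliser is visible from the size of the double coset, as 1
        and p differ; hence it is the same for x and y.\<close>
      then show "y \<in> carrier G - ?N"
        using card_dcoset_prime[OF H fin p, of x] card_dcoset_prime[OF H fin p, of y] x p2
        by (auto split: if_splits)
    qed
  qed
  have NG: "?N \<subseteq> carrier G" using mem_normalizer_iff[OF H] by auto
  have "disjoint \<D>" "\<And>D. D \<in> \<D> \<Longrightarrow> finite D"
    using sub dcosets_disjoint[OF H] finite_dcoset[OF H fin]
    by (fastforce simp: pairwise_def disjnt_def, auto simp: \<D>_def)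
  then have "card (\<Union>\<D>) = (\<Sum>D\<in>\<D>. card D)" by (rule card_Union_disjoint)
  also have "\<dots> = (\<Sum>D\<in>\<D>. ?p\<^sup>2)"
  proof (rule sum.cong)
    fix D assume D: "D \<in> \<D>"
    then show "card D = ?p\<^sup>2"
      using card_dcoset_div(1)[OF H fin, of D] k\<D>[OF D] sub by (auto simp: power2_eq_square)
  qed simp
  finally have "card (carrier G - ?N) = card \<D> * ?p\<^sup>2" by (simp add: un)
  moreover have "card (carrier G - ?N) + card ?N = card (carrier G)"
    using NG fin by (simp add: card_Diff_subset finite_subset card_mono)
  ultimately have "card \<D> * ?p\<^sup>2 + card ?N = order G" by (simp add: order_def)
  then show ?thesis using that 1 by blast
qed

end

section \<open>Conjugation and Sylow subgroups\<close>

text \<open>The restriction is there because the elements of \<open>Bij E\<close> are extensional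
  functions; the inverse of \<open>f g\<close> on \<open>E\<close> is given by the inverse of
  g.\<close>

lemma group_actionI:
  assumes "group G"
    and cl: "\<And>g x. g \<in> carrier G \<Longrightarrow> x \<in> E \<Longrightarrow> f g x \<in> E"
    and one: "\<And>x. x \<in> E \<Longrightarrow> f \<one>\<^bsub>G\<^esub> x = x"
    and mult: "\<And>g h x. g \<in> carrier G \<Longrightarrow> h \<in> carrier G \<Longrightarrow> x \<in> E \<Longrightarrow> f (g \<otimes>\<^bsub>G\<^esub> h) x = f g (f h x)"
  shows "group_action G E (\<lambda>g. restrict (f g) E)"
proof -
  interpret group G by fact
  have "restrict (f g) E \<in> Bij E" if g: "g \<in> carrier G" for g
  proof -
    have "bij_betw (f g) E E"
      using g by (intro bij_betw_byWitness[where f' = "f (inv\<^bsub>G\<^esub> g)"])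
        (auto simp: cl mult[symmetric] one)
    then show ?thesis by (simp add: Bij_def bij_betw_def inj_on_def)
  qed
  moreover have "restrict (f (g \<otimes>\<^bsub>G\<^esub> h)) E = compose E (restrict (f g) E) (restrict (f h) E)"
    if "g \<in> carrier G" "h \<in> carrier G" for g h
    using that by (auto simp: compose_def fun_eq_iff mult cl)
  ultimately have "(\<lambda>g. restrict (f g) E) \<in> hom G (BijGroup E)"
    by (auto simp: hom_def BijGroup_def)
  then show ?thesis
    by (simp add: group_action_def group_hom_def group_hom_axioms_def is_group group_BijGroup)
qed

text \<open>Orbit sizes divide a power of p, so every orbit that is not a fixed point has size
  divisible by p.\<close>

lemma (in group_action) card_fixed_points:
  assumes p: "prime p" and ord: "order G = p ^ k" and E: "finite E"
  shows "card E mod p = card {x \<in> E. \<forall>g\<in>carrier G. \<phi> g x = x} mod p"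
proof -
  interpret group G using group_hom group_hom.axioms(1) by auto
  let ?F = "{x \<in> E. \<forall>g\<in>carrier G. \<phi> g x = x}"
  let ?s = "(\<lambda>x. {x}) ` ?F"
  have sub: "?s \<subseteq> orbits G E \<phi>"
    unfolding orbits_def orbit_def using one_closed by force
  have subE: "b \<subseteq> E" if "b \<in> orbits G E \<phi>" for b
    using that orbits_coverture by blast
  have fin: "finite (orbits G E \<phi>)" using subE E
    by (meson PowI finite_Pow_iff finite_subset subsetI)
  have "card E = (\<Sum>b\<in>orbits G E \<phi>. card b)" using disjoint_sum[OF E, of "\<lambda>_. 1::nat"] by simp
  also have "\<dots> = (\<Sum>b\<in>?s. card b) + (\<Sum>b\<in>orbits G E \<phi> - ?s. card b)"
    using sum.subset_diff[OF sub fin] by (simp add: add.commute)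
  also have "(\<Sum>b\<in>?s. card b) = card ?F" by (subst sum.reindex) (auto simp: inj_on_def)
  finally have eq: "card E = card ?F + (\<Sum>b\<in>orbits G E \<phi> - ?s. card b)" .
  have "p dvd card b" if b: "b \<in> orbits G E \<phi> - ?s" for b
  proof -
    obtain x where x: "x \<in> E" "b = orbit G \<phi> x" using b by (auto simp: orbits_def)
    have "card b dvd p ^ k" using orbit_stabilizer_theorem[OF x(1)] ord x(2)
      by (metis dvd_triv_left)
    then obtain j where j: "card b = p ^ j" using p by (metis divides_primepow_nat)
    have "card b \<noteq> 1"
    proof
      assume "card b = 1"
      then obtain y where "b = {y}" by (metis card_1_singletonE)
      then have bx: "b = {x}" using orbit_refl[OF x(1)] x(2) by auto
      have "\<phi> g x \<in> b" if "g \<in> carrier G" for g using that x(2) by (auto simp: orbit_def)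
      then have "x \<in> ?F" using bx x(1) by auto
      then show False using b bx by blast
    qed
    then show ?thesis using j by (cases j) auto
  qed
  then have "p dvd (\<Sum>b\<in>orbits G E \<phi> - ?s. card b)" by (intro dvd_sum) auto
  then obtain c where "(\<Sum>b\<in>orbits G E \<phi> - ?s. card b) = p * c" by (rule dvdE)
  then show ?thesis unfolding eq by simp
qed

context group
begin

lemma conj_closed: "subgroup H G \<Longrightarrow> g \<in> carrier G \<Longrightarrow> subgroup (g <# H #> inv g) G"
  using subgroup_conjugation_is_surj1[of "inv g" H] by simp

lemma conj_one: "H \<subseteq> carrier G \<Longrightarrow> \<one> <# H #> \<one> = H"
  by (simp add: coset_mult_one lcos_mult_one)

lemma conj_mult:
  assumes "H \<subseteq> carrier G" "g \<in> carrier G" "h \<in> carrier G"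
  shows "(g \<otimes> h) <# H #> inv (g \<otimes> h) = g <# (h <# H #> inv h) #> inv g"
  using assms by (simp add: inv_mult_group lcos_m_assoc[symmetric] coset_mult_assoc[symmetric]
      coset_assoc l_coset_subset_G r_coset_subset_G)

lemma conj_action:
  assumes "subgroup R G" "\<And>K. K \<in> E \<Longrightarrow> K \<subseteq> carrier G"
    and "\<And>g K. g \<in> R \<Longrightarrow> K \<in> E \<Longrightarrow> g <# K #> inv g \<in> E"
  shows "group_action (G\<lparr>carrier := R\<rparr>) E (\<lambda>g. \<lambda>K\<in>E. g <# K #> inv g)"
  by (rule group_actionI)
    (use assms subgroup_imp_group in \<open>auto simp: conj_one conj_mult subgroup.mem_carrier\<close>)

lemma mem_normalizer_conj:
  "H \<subseteq> carrier G \<Longrightarrow> g \<in> normalizer G H \<longleftrightarrow> g \<in> carrier G \<and> g <# H #> inv g = H"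
  by (auto simp: normalizer_def stabilizer_def)

text \<open>If y and z conjugate K to the same set, the quotient of z and y normalises K and lies in
  P, hence is trivial.\<close>

lemma inj_on_conj:
  assumes P: "subgroup P G" and K: "K \<subseteq> carrier G" and PK: "P \<inter> normalizer G K = {\<one>}"
  shows "inj_on (\<lambda>y. y <# K #> inv y) P"
proof (rule inj_onI)
  interpret P: subgroup P G by fact
  fix y z assume yz: "y \<in> P" "z \<in> P" "y <# K #> inv y = z <# K #> inv z"
  let ?x = "inv z \<otimes> y"
  have "?x <# K #> inv ?x = inv z <# (z <# K #> inv z) #> inv (inv z)"
    using conj_mult[OF K, of "inv z" y] yz by simp
  also have "\<dots> = (inv z \<otimes> z) <# K #> inv (inv z \<otimes> z)"
    using conj_mult[OF K, of "inv z" z] yz by simp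
  also have "\<dots> = K" using yz K by (simp add: conj_one)
  finally have "?x \<in> P \<inter> normalizer G K" using yz by (simp add: mem_normalizer_conj[OF K])
  then have "?x = \<one>" using PK by blast
  then show "y = z" using yz by (metis P.mem_carrier inv_closed inv_equality inv_inv)
qed

definition conjugates :: "'a set \<Rightarrow> 'a set set"
  where "conjugates H = (\<lambda>g. g <# H #> inv g) ` carrier G"

lemma conjugates_self: "H \<subseteq> carrier G \<Longrightarrow> H \<in> conjugates H"
  unfolding conjugates_def by (rule image_eqI[of _ _ \<one>]) (simp_all add: conj_one)

lemma subgroup_conjugates: "subgroup H G \<Longrightarrow> K \<in> conjugates H \<Longrightarrow> subgroup K G"
  by (auto simp: conjugates_def conj_closed)

lemma conj_conjugates:
  "H \<subseteq> carrier G \<Longrightarrow> g \<in> carrier G \<Longrightarrow> K \<in> conjugates H \<Longrightarrow> g <# K #> inv g \<in> conjugates H"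
  by (auto simp: conjugates_def conj_mult[symmetric])

lemma card_conj:
  assumes "H \<subseteq> carrier G" "g \<in> carrier G"
  shows "card (g <# H #> inv g) = card H"
proof -
  have "g <# H #> inv g = (\<lambda>h. g \<otimes> h \<otimes> inv g) ` H" by (auto simp: l_coset_def r_coset_def)
  moreover have "inj_on (\<lambda>h. g \<otimes> h \<otimes> inv g) H" using assms by (intro inj_onI) (simp add: subset_iff)
  ultimately show ?thesis by (simp add: card_image)
qed

lemma card_conjugates:
  assumes H: "subgroup H G"
  shows "card (conjugates H) * card (normalizer G H) = order G"
proof -
  interpret group_action G "{H. subgroup H G}" "\<lambda>g. \<lambda>H\<in>{H. subgroup H G}. g <# H #> inv g"
    by (rule action_by_conjugation_on_subgroups_set)
  have "orbit G (\<lambda>g. \<lambda>H\<in>{H. subgroup H G}. g <# H #> inv g) H = conjugates H"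
    using H by (auto simp: orbit_def conjugates_def)
  moreover have "stabilizer G (\<lambda>g. \<lambda>H\<in>{H. subgroup H G}. g <# H #> inv g) H = normalizer G H"
    using H subgroup.subset[OF H] by (auto simp: stabilizer_def mem_normalizer_conj)
  ultimately show ?thesis using orbit_stabilizer_theorem H by fastforce
qed

lemma subset_normalizer:
  assumes "subgroup H G" shows "H \<subseteq> normalizer G H"
proof
  fix x assume "x \<in> H"
  then show "x \<in> normalizer G H"
    using assms by (simp add: mem_normalizer_iff subgroup.mem_carrier coset_join2 coset_join3)
qed

lemma card_subgroup_dvd: "subgroup H G \<Longrightarrow> subgroup K G \<Longrightarrow> H \<subseteq> K \<Longrightarrow> card H dvd card K"
  using group.lagrange[OF subgroup_imp_group, of K H] subgroup_incl[of H K]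
  by (auto simp: order_def) (metis dvd_triv_right)

text \<open>The fibre of multiplication over h k consists of the pairs (h x, x^-1 k) with x in the
  intersection.\<close>

lemma card_set_mult:
  assumes H: "subgroup H G" and K: "subgroup K G" and fin: "finite H" "finite K"
  shows "card (H <#> K) * card (H \<inter> K) = card H * card K"
proof -
  interpret H: subgroup H G by fact
  interpret K: subgroup K G by fact
  let ?f = "\<lambda>(h, k). h \<otimes> k"
  have im: "?f ` (H \<times> K) = H <#> K" by (auto simp: set_mult_def)
  have fib: "card {z \<in> H \<times> K. ?f z = s} = card (H \<inter> K)" if "s \<in> H <#> K" for s
  proof -
    obtain h k where hk: "h \<in> H" "k \<in> K" "s = h \<otimes> k" using \<open>s \<in> _\<close> by (auto simp: set_mult_def)
    have "bij_betw (\<lambda>x. (h \<otimes> x, inv x \<otimes> k)) (H \<inter> K) {z \<in> H \<times> K. ?f z = s}"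
    proof (rule bij_betw_byWitness[where f' = "\<lambda>z. inv h \<otimes> fst z"])
      show "\<forall>x\<in>H \<inter> K. inv h \<otimes> fst (h \<otimes> x, inv x \<otimes> k) = x"
        using hk by (auto simp: m_assoc[symmetric])
      show "(\<lambda>x. (h \<otimes> x, inv x \<otimes> k)) ` (H \<inter> K) \<subseteq> {z \<in> H \<times> K. ?f z = s}"
      proof
        fix z assume "z \<in> (\<lambda>x. (h \<otimes> x, inv x \<otimes> k)) ` (H \<inter> K)"
        then obtain x where x: "x \<in> H" "x \<in> K" "z = (h \<otimes> x, inv x \<otimes> k)" by auto
        have "h \<otimes> x \<otimes> (inv x \<otimes> k) = h \<otimes> (x \<otimes> inv x) \<otimes> k" using hk x
          by (simp add: m_assoc del: r_inv Units_r_inv)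
        then show "z \<in> {z \<in> H \<times> K. ?f z = s}" using hk x by simp
      qed
      have *: "inv h \<otimes> a \<in> H \<inter> K \<and> a = h \<otimes> (inv h \<otimes> a) \<and> b = inv (inv h \<otimes> a) \<otimes> k"
        if ab: "a \<in> H" "b \<in> K" "a \<otimes> b = s" for a b
      proof -
        have "inv h \<otimes> a \<otimes> b = k" using ab hk by (simp add: m_assoc) (simp add: m_assoc[symmetric])
        then have "inv h \<otimes> a = k \<otimes> inv b" "b = inv (inv h \<otimes> a) \<otimes> k" using ab hk
          by (metis
          H.mem_carrier H.m_inv_closed H.m_closed K.mem_carrier inv_solve_right inv_solve_left)+
        moreover have "inv h \<otimes> a \<in> H" "k \<otimes> inv b \<in> K" "h \<otimes> (inv h \<otimes> a) = a"
          using ab hk by (simp_all add: m_assoc[symmetric])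
        ultimately show ?thesis by auto
      qed
      show "(\<lambda>z. inv h \<otimes> fst z) ` {z \<in> H \<times> K. ?f z = s} \<subseteq> H \<inter> K" using * by fastforce
      show "\<forall>z\<in>{z \<in> H \<times> K. ?f z = s}. (h \<otimes> (inv h \<otimes> fst z), inv (inv h \<otimes> fst z) \<otimes> k) = z"
        using * by fastforce
    qed
    then show ?thesis by (simp add: bij_betw_same_card)
  qed
  have "card (H \<times> K) = (\<Sum>s\<in>H <#> K. card {z \<in> H \<times> K. ?f z = s})"
    using sum.group[of "H \<times> K" "H <#> K" ?f "\<lambda>_. 1::nat"] fin im
      finite_imageI[of "H \<times> K" ?f] by simp
  also have "\<dots> = card (H <#> K) * card (H \<inter> K)" by (simp add: fib)
  finally show ?thesis by (simp add: card_cartesian_product)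
qed

end

lemma (in group) pow_card_subgroup:
  assumes "subgroup H G" "x \<in> H"
  shows "x [^] card H = \<one>"
proof -
  interpret H: group "G\<lparr>carrier := H\<rparr>" by (rule subgroup_imp_group[OF assms(1)])
  have "x [^]\<^bsub>G\<lparr>carrier := H\<rparr>\<^esub> order (G\<lparr>carrier := H\<rparr>) = \<one>\<^bsub>G\<lparr>carrier := H\<rparr>\<^esub>"
    using H.pow_order_eq_1[of x] assms(2) by simp
  then show ?thesis by (simp add: order_def nat_pow_consistent[symmetric])
qed

section \<open>Conjugacy and number of Sylow subgroups\<close>

locale sylow_subgroup = group +
  fixes p a m :: nat and P :: "'a set"
  assumes fin: "finite (carrier G)" and p: "prime p" and ord: "order G = p ^ a * m"
    and ndvd: "\<not> p dvd m" and P: "subgroup P G" and cardP: "card P = p ^ a"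
begin

lemma PG: "P \<subseteq> carrier G"
  using P by (rule subgroup.subset)

text \<open>As R normalises P, the product PR is a subgroup, of p-power order by the product
  formula. Its order divides |G|, so it cannot exceed |P|, and PR = P.\<close>

lemma p_subgroup_normalizer:
  assumes R: "subgroup R G" and cR: "card R = p ^ b" and RN: "R \<subseteq> normalizer G P"
  shows "R \<subseteq> P"
proof -
  let ?N = "G\<lparr>carrier := normalizer G P\<rparr>"
  have N: "subgroup (normalizer G P) G" by (rule normalizer_imp_subgroup[OF PG])
  interpret N: group ?N by (rule subgroup_imp_group[OF N])
  have "P \<lhd> ?N" by (rule subgroup_in_normalizer[OF P])
  moreover have "subgroup R ?N" by (rule subgroup_incl[OF R N RN])
  ultimately have "subgroup (P <#> R) ?N" using N.mult_norm_subgroup by simp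
  then have PR: "subgroup (P <#> R) G" by (rule incl_subgroup[OF N])
  have "finite P" "finite R" using fin PG subgroup.subset[OF R] finite_subset by blast+
  then have "card (P <#> R) * card (P \<inter> R) = p ^ (a + b)"
    using card_set_mult[OF P R] cardP cR by (simp add: power_add)
  then obtain c where c: "card (P <#> R) = p ^ c" using p
    by (metis divides_primepow_nat dvd_triv_left)
  have "p ^ c dvd p ^ a * m" using c ord lagrange[OF PR] by (metis dvd_triv_right)
  moreover have "coprime (p ^ c) m" using p ndvd by (simp add: prime_imp_coprime)
  ultimately have "p ^ c dvd p ^ a" using coprime_dvd_mult_left_iff by blast
  moreover have "p ^ a > 0" using p prime_gt_0_nat by simp
  ultimately have "card (P <#> R) \<le> card P" using c cardP dvd_imp_le by metis
  moreover have sub: "P \<subseteq> P <#> R"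
  proof
    fix x assume "x \<in> P"
    then have "x = x \<otimes> \<one>" "\<one> \<in> R" using PG R subgroup.one_closed by auto
    then show "x \<in> P <#> R" using \<open>x \<in> P\<close> unfolding set_mult_def by blast
  qed
  moreover have "finite (P <#> R)" using subgroup.subset[OF PR] fin finite_subset by blast
  ultimately have eq: "P <#> R = P" using card_seteq by metis
  show "R \<subseteq> P"
  proof
    fix x assume x: "x \<in> R"
    then have "x = \<one> \<otimes> x" "\<one> \<in> P" using subgroup.subset[OF R] P subgroup.one_closed by auto
    then have "x \<in> P <#> R" using x unfolding set_mult_def by blast
    then show "x \<in> P" using eq by simp
  qed
qed

lemma conj_sylow:
  assumes "K \<in> conjugates P" shows "sylow_subgroup G p a m K"
  using subgroup_conjugates[OF P assms] card_conj[OF PG] fin p ord ndvd cardP assms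
  unfolding sylow_subgroup_def sylow_subgroup_axioms_def
  by (auto simp: is_group conjugates_def)

lemma card_conjugates_dvd: "card (conjugates P) dvd m"
proof -
  have "p ^ a dvd card (normalizer G P)"
    using card_subgroup_dvd[OF P normalizer_imp_subgroup[OF PG] subset_normalizer[OF P]] cardP
    by simp
  then obtain c where "card (normalizer G P) = p ^ a * c" ..
  then have "p ^ a * (card (conjugates P) * c) = p ^ a * m"
    using card_conjugates[OF P] ord by (simp add: ac_simps)
  then have "card (conjugates P) * c = m" using p prime_gt_0_nat by auto
  then show ?thesis by (metis dvd_triv_left)
qed

lemma finite_conjugates: "finite (conjugates P)"
  using fin by (simp add: conjugates_def)

text \<open>Let R act on the conjugates of P by conjugation. A conjugate is fixed if R normalises
  it, which by \<open>p_subgroup_normalizer\<close> means that it contains R. Existence of a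
  conjugate above R and the congruence modulo p both come from this count.\<close>

lemma card_conjugates_fixed:
  assumes R: "subgroup R G" and cR: "card R = p ^ b"
  shows "card (conjugates P) mod p = card {K \<in> conjugates P. R \<subseteq> K} mod p"
proof -
  interpret A: group_action "G\<lparr>carrier := R\<rparr>" "conjugates P" "\<lambda>g. \<lambda>K\<in>conjugates P. g <# K #> inv g"
    using conj_action[OF R, of "conjugates P"] conj_conjugates[OF PG] subgroup.subset[OF R]
      subgroup_conjugates[OF P] subgroup.subset by blast
  have "(\<forall>g\<in>R. g <# K #> inv g = K) \<longleftrightarrow> R \<subseteq> K" if K: "K \<in> conjugates P" for K
  proof -
    interpret K: sylow_subgroup G p a m K by (rule conj_sylow[OF K])
    have "(\<forall>g\<in>R. g <# K #> inv g = K) \<longleftrightarrow> R \<subseteq> normalizer G K"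
      using subgroup.subset[OF R] by (auto simp: mem_normalizer_conj[OF K.PG])
    also have "\<dots> \<longleftrightarrow> R \<subseteq> K"
      using K.p_subgroup_normalizer[OF R cR] subset_normalizer[OF K.P] by blast
    finally show ?thesis .
  qed
  then have "{K \<in> conjugates P. \<forall>g\<in>R. (\<lambda>K\<in>conjugates P. g <# K #> inv g) K = K} =
    {K \<in> conjugates P. R \<subseteq> K}" by auto
  then show ?thesis using A.card_fixed_points[OF p, of b] finite_conjugates cR
    by (simp add: order_def)
qed

lemma p_subgroup_in_conjugate:
  assumes "subgroup R G" "card R = p ^ b"
  obtains K where "K \<in> conjugates P" "R \<subseteq> K"
proof -
  have "\<not> p dvd card (conjugates P)" using card_conjugates_dvd ndvd dvd_trans by blast
  then have "card {K \<in> conjugates P. R \<subseteq> K} \<noteq> 0"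
    using card_conjugates_fixed[OF assms] by (metis dvd_eq_mod_eq_0 mod_0)
  then have "{K \<in> conjugates P. R \<subseteq> K} \<noteq> {}" by (metis card.empty)
  then show ?thesis using that by blast
qed

lemma sylow_conjugate:
  assumes R: "subgroup R G" "card R = p ^ a"
  shows "R \<in> conjugates P"
proof -
  obtain K where K: "K \<in> conjugates P" "R \<subseteq> K" using p_subgroup_in_conjugate[OF R] .
  interpret K: sylow_subgroup G p a m K by (rule conj_sylow[OF K(1)])
  have "R = K" using K(2) K.cardP R(2) K.PG fin finite_subset by (metis card_subset_eq)
  then show ?thesis using K(1) by simp
qed

lemma card_conjugates_mod: "card (conjugates P) mod p = 1"
proof -
  have "K = P" if "K \<in> conjugates P" "P \<subseteq> K" for K
  proof -
    interpret K: sylow_subgroup G p a m K by (rule conj_sylow[OF that(1)])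
    show ?thesis using that(2) K.cardP cardP K.PG fin finite_subset by (metis card_subset_eq)
  qed
  then have "{K \<in> conjugates P. P \<subseteq> K} = {P}" using conjugates_self[OF PG] by auto
  then show ?thesis using card_conjugates_fixed[OF P cardP] prime_gt_1_nat[OF p] by simp
qed

end

section \<open>Nonsolvable simple groups\<close>

lemma (in comm_group) solvable: "solvable G"
proof -
  have "(derived G ^^ 1) (carrier G) = {\<one>}" using derived_eq_singleton by simp
  then show ?thesis unfolding solvable_iff_trivial_derived_seq by blast
qed

lemma solvable_sign_img: "solvable sign_img"
proof -
  have "comm_group sign_img"
    by (rule group.group_comm_groupI[OF sign_img_is_group]) (auto simp: sign_img_def)
  then show ?thesis by (rule comm_group.solvable)
qed

text \<open>\<open>sym_group n\<close> acts on the numbers from 1 to n, so the points of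
  \<open>E\<close> are numbered by \<open>e\<close>.\<close>

lemma (in group) permutation_rep:
  assumes E: "finite E" and act: "group_action G E (\<lambda>g. restrict (f g) E)"
  obtains e \<psi> where "bij_betw e {1..card E} E" "\<psi> \<in> hom G (sym_group (card E))"
    "\<And>g i. g \<in> carrier G \<Longrightarrow> i \<in> {1..card E} \<Longrightarrow> e (\<psi> g i) = f g (e i)"
proof -
  interpret group_action G E "\<lambda>g. restrict (f g) E" by (rule act)
  let ?d = "card E"
  obtain e where e: "bij_betw e {1..?d} E" using ex_bij_betw_nat_finite_1[OF E] by blast
  define b where "b = the_inv_into {1..?d} e"
  have b: "bij_betw b E {1..?d}" unfolding b_def by (rule bij_betw_the_inv_into[OF e])
  have eb: "e (b x) = x" if "x \<in> E" for x
    unfolding b_def using e that by (metis bij_betw_def f_the_inv_into_f)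
  have be: "b (e i) = i" if "i \<in> {1..?d}" for i
    unfolding b_def using e that by (metis bij_betw_def the_inv_into_f_f)
  have eE: "e i \<in> E" if "i \<in> {1..?d}" for i using e that bij_betwE by blast
  have fE: "f g x \<in> E" if "g \<in> carrier G" "x \<in> E" for g x using element_image[OF that] that by simp
  define \<psi> where "\<psi> g i = (if i \<in> {1..?d} then b (f g (e i)) else i)" for g i
  have fb: "bij_betw (f g) E E" if "g \<in> carrier G" for g
  proof -
    have "bij_betw (restrict (f g) E) E E" using bij_prop0[OF that] by (simp add: Bij_def)
    then show ?thesis by simp
  qed
  have perm: "\<psi> g permutes {1..?d}" if g: "g \<in> carrier G" for g
  proof (rule bij_imp_permutes)
    have "bij_betw (b \<circ> f g \<circ> e) {1..?d} {1..?d}"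
      using bij_betw_trans[OF bij_betw_trans[OF e fb[OF g]] b] by (simp add: comp_assoc)
    then show "bij_betw (\<psi> g) {1..?d} {1..?d}"
      by (rule bij_betw_cong[THEN iffD1, rotated]) (simp add: \<psi>_def)
  qed (auto simp: \<psi>_def)
  have e\<psi>: "e (\<psi> g i) = f g (e i)" if "g \<in> carrier G" "i \<in> {1..?d}" for g i
    using that by (simp add: \<psi>_def eb fE eE)
  have "\<psi> (g \<otimes> h) = \<psi> g \<circ> \<psi> h" if gh: "g \<in> carrier G" "h \<in> carrier G" for g h
  proof
    fix i
    show "\<psi> (g \<otimes> h) i = (\<psi> g \<circ> \<psi> h) i"
    proof (cases "i \<in> {1..?d}")
      case True
      have "f (g \<otimes> h) (e i) = f g (f h (e i))"
        using composition_rule[OF eE[OF True] gh] eE[OF True] fE[OF gh(2)] by simp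
      moreover have "b (f h (e i)) \<in> {1..?d}" using b fE[OF gh(2) eE[OF True]] bij_betwE by blast
      ultimately show ?thesis using True fE[OF gh(2) eE[OF True]] by (simp add: \<psi>_def eb)
    qed (auto simp: \<psi>_def)
  qed
  then have "\<psi> \<in> hom G (sym_group ?d)"
    using perm by (auto simp: hom_def sym_group_carrier sym_group_mult)
  then show ?thesis using that e e\<psi> by blast
qed

locale nonsolvable_simple_group = simple_group +
  assumes fin: "finite (carrier G)" and nonsolvable: "\<not> solvable G"
begin

lemma inj_or_trivial:
  assumes "group_hom G H f"
  shows "inj_on f (carrier G) \<or> (\<forall>g\<in>carrier G. f g = \<one>\<^bsub>H\<^esub>)"
proof -
  interpret f: group_hom G H f by fact
  have "kernel G H f = carrier G \<or> kernel G H f = {\<one>}"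
    by (rule no_real_normal_subgroup[OF f.normal_kernel])
  then show ?thesis using f.trivial_ker_imp_inj by (auto simp: kernel_def)
qed

text \<open>G acts on the conjugates of H. If this were not faithful it would be trivial by
  simplicity, and H would be normal. The sign of the action is a homomorphism into an abelian group;
  if it were injective G would be solvable, so it is trivial.\<close>

lemma alternating_rep:
  assumes H: "subgroup H G" "H \<noteq> {\<one>}" "H \<noteq> carrier G"
  obtains e \<psi> where "bij_betw e {1..card (conjugates H)} (conjugates H)"
    "\<psi> \<in> hom G (alt_group (card (conjugates H)))" "inj_on \<psi> (carrier G)"
    "\<And>g i. g \<in> carrier G \<Longrightarrow> i \<in> {1..card (conjugates H)} \<Longrightarrow> e (\<psi> g i) = g <# e i #> inv g"
proof -
  let ?E = "conjugates H" and ?d = "card (conjugates H)"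
  have HG: "H \<subseteq> carrier G" using H(1) by (rule subgroup.subset)
  have E: "finite ?E" using fin by (simp add: conjugates_def)
  have "group_action (G\<lparr>carrier := carrier G\<rparr>) ?E (\<lambda>g. \<lambda>K\<in>?E. g <# K #> inv g)"
    using conj_action[OF subgroup_self, of ?E] conj_conjugates[OF HG]
      subgroup_conjugates[OF H(1)] subgroup.subset by blast
  then have "group_action G ?E (\<lambda>g. \<lambda>K\<in>?E. g <# K #> inv g)" by simp
  then obtain e \<psi> where e: "bij_betw e {1..?d} ?E" and \<psi>: "\<psi> \<in> hom G (sym_group ?d)"
    and e\<psi>: "\<And>g i. g \<in> carrier G \<Longrightarrow> i \<in> {1..?d} \<Longrightarrow> e (\<psi> g i) = g <# e i #> inv g"
    using permutation_rep[OF E, of "\<lambda>g K. g <# K #> inv g"] by blast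
  interpret \<psi>: group_hom G "sym_group ?d" \<psi>
    using \<psi> by (simp add: group_hom_def group_hom_axioms_def sym_group_is_group)
  have inj: "inj_on \<psi> (carrier G)"
  proof (rule ccontr)
    assume "\<not> inj_on \<psi> (carrier G)"
    then have tr: "\<psi> g = id" if "g \<in> carrier G" for g
      using inj_or_trivial[OF \<psi>.group_hom_axioms] that by (simp add: sym_group_one)
    obtain i where i: "i \<in> {1..?d}" "e i = H"
      using e conjugates_self[OF HG] by (metis bij_betw_def imageE)
    have "g <# H #> inv g = H" if "g \<in> carrier G" for g using e\<psi>[OF that i(1)] i(2) tr[OF that]
      by simp
    then have "g \<in> normalizer G H" if "g \<in> carrier G" for g
      using that mem_normalizer_conj[OF HG] by simp
    then have "H \<lhd> G" using normalI[OF H(1)] mem_normalizer_iff[OF H(1)] by simp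
    then show False using no_real_normal_subgroup H(2,3) by blast
  qed
  have sg: "group_hom G sign_img (sign \<circ> \<psi>)"
    using \<psi> sign_is_hom[of ?d]
    by (auto simp: group_hom_def group_hom_axioms_def sign_img_is_group hom_def Pi_def)
  have "sign (\<psi> g) = (1::int)" if "g \<in> carrier G" for g
  proof -
    have "\<not> inj_on (sign \<circ> \<psi>) (carrier G)"
      using group_hom.inj_hom_imp_solvable[OF sg _ solvable_sign_img] nonsolvable by blast
    then show ?thesis using inj_or_trivial[OF sg] that by (auto simp: sign_img_def)
  qed
  then have "evenperm (\<psi> g)" if "g \<in> carrier G" for g
    using that by (metis sign_def one_neq_neg_one)
  then have "\<psi> \<in> hom G (alt_group ?d)"
    using \<psi>
    by (auto simp: hom_def alt_group_carrier sym_group_carrier alt_group_mult sym_group_mult Pi_def)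
  then show ?thesis using that e inj e\<psi> by blast
qed

lemma conjugates_gt_1:
  assumes H: "subgroup H G" "H \<noteq> {\<one>}" "H \<noteq> carrier G"
  shows "card (conjugates H) > 1"
proof -
  have HG: "H \<subseteq> carrier G" using H(1) by (rule subgroup.subset)
  have "finite (conjugates H)" using fin by (simp add: conjugates_def)
  moreover have "conjugates H \<noteq> {H}"
  proof
    assume "conjugates H = {H}"
    then have "g \<in> normalizer G H" if "g \<in> carrier G" for g
      using that mem_normalizer_conj[OF HG] unfolding conjugates_def by auto
    then have "H \<lhd> G" using normalI[OF H(1)] mem_normalizer_iff[OF H(1)] by simp
    then show False using no_real_normal_subgroup H(2,3) by blast
  qed
  moreover have "H \<in> conjugates H" by (rule conjugates_self[OF HG])
  ultimately have "\<not> card (conjugates H) \<le> 1" by (auto simp: card_le_Suc0_iff_eq)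
  then show ?thesis by simp
qed

text \<open>G embeds into the alternating group on the d conjugates, and for d > 1 that group has
  order d!/2.\<close>

lemma order_dvd_fact_conjugates:
  assumes H: "subgroup H G" "H \<noteq> {\<one>}" "H \<noteq> carrier G"
  shows "2 * order G dvd fact (card (conjugates H))"
proof -
  let ?d = "card (conjugates H)"
  obtain \<psi> where \<psi>: "\<psi> \<in> hom G (alt_group ?d)" "inj_on \<psi> (carrier G)" using alternating_rep[OF H]
  by metis
  interpret \<psi>: group_hom G "alt_group ?d" \<psi>
    using \<psi> by (simp add: group_hom_def group_hom_axioms_def alt_group_is_group)
  have "card (\<psi> ` carrier G) dvd card (carrier (alt_group ?d))"
    using group.lagrange[OF alt_group_is_group \<psi>.img_is_subgroup]
    by (metis dvd_triv_right order_def)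
  then have "2 * order G dvd 2 * card (carrier (alt_group ?d))"
    using card_image[OF \<psi>(2)] by (simp add: order_def)
  then show ?thesis using alt_group_card_carrier[of ?d] conjugates_gt_1[OF H] by simp
qed

text \<open>Faithfulness of the action on conjugates, in the form in which the orders 120 and 168
  use it.\<close>

lemma normal_core_trivial:
  assumes H: "subgroup H G" "H \<noteq> {\<one>}" "H \<noteq> carrier G"
    and g: "g \<in> carrier G" "\<And>K. K \<in> conjugates H \<Longrightarrow> g <# K #> inv g = K"
  shows "g = \<one>"
proof -
  let ?d = "card (conjugates H)"
  obtain e \<psi> where e: "bij_betw e {1..?d} (conjugates H)"
  and \<psi>: "\<psi> \<in> hom G (alt_group ?d)" "inj_on \<psi> (carrier G)"
    and e\<psi>: "\<And>g i. g \<in> carrier G \<Longrightarrow> i \<in> {1..?d} \<Longrightarrow> e (\<psi> g i) = g <# e i #> inv g"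
    using alternating_rep[OF H] by metis
  interpret \<psi>: group_hom G "alt_group ?d" \<psi>
    using \<psi> by (simp add: group_hom_def group_hom_axioms_def alt_group_is_group)
  have perm: "\<psi> g permutes {1..?d}" using \<psi>(1) g(1) by (auto simp: hom_def Pi_def alt_group_carrier)
  have "\<psi> g i = i" for i
  proof (cases "i \<in> {1..?d}")
    case True
    have "e i \<in> conjugates H" using e True bij_betwE by blast
    then have "e (\<psi> g i) = e i" using e\<psi>[OF g(1) True] g(2) by simp
    moreover have "\<psi> g i \<in> {1..?d}" using permutes_in_image[OF perm] True by blast
    ultimately show ?thesis using True e by (meson bij_betw_def inj_onD)
  next
    case False
    then show ?thesis using perm by (simp add: permutes_not_in)
  qed
  then have "\<psi> g = \<psi> \<one>" using \<psi>.hom_one by (simp add: alt_group_one fun_eq_iff)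
  then show ?thesis using \<psi>(2) g(1) by (meson inj_onD one_closed)
qed

end

text \<open>The fixed points of a p-group acting on itself by conjugation are its centre, so p
  divides the order of the centre.\<close>

lemma (in group) central_subgroup_prime:
  assumes fin: "finite (carrier G)" and p: "prime p" and ord: "order G = p ^ k"
  and k: "k \<noteq> 0"
  obtains H where "subgroup H G" "card H = p" "\<And>h g. h \<in> H \<Longrightarrow> g \<in> carrier G \<Longrightarrow> h \<otimes> g = g \<otimes> h"
proof -
  define Z where "Z = {z \<in> carrier G. \<forall>g\<in>carrier G. z \<otimes> g = g \<otimes> z}"
  have Z: "subgroup Z G"
  proof (rule subgroupI)
    fix a assume a: "a \<in> Z"
    have "inv a \<otimes> g = g \<otimes> inv a" if g: "g \<in> carrier G" for g
    proof -
      have "a \<otimes> g = g \<otimes> a" "a \<in> carrier G" using a g by (auto simp: Z_def)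
      then show ?thesis using g
        by (metis inv_closed inv_solve_left' inv_solve_right' m_assoc m_closed)
    qed
    then show "inv a \<in> Z" using a by (auto simp: Z_def)
  next
    fix a b assume ab: "a \<in> Z" "b \<in> Z"
    have "\<forall>g\<in>carrier G. a \<otimes> b \<otimes> g = g \<otimes> (a \<otimes> b)"
    proof
      fix g assume g: "g \<in> carrier G"
      have c: "a \<otimes> g = g \<otimes> a" "b \<otimes> g = g \<otimes> b" "a \<in> carrier G" "b \<in> carrier G"
        using ab g unfolding Z_def by blast+
      then show "a \<otimes> b \<otimes> g = g \<otimes> (a \<otimes> b)" using g by (metis m_assoc)
    qed
    moreover have "a \<in> carrier G" "b \<in> carrier G" using ab unfolding Z_def by blast+
    then have "a \<otimes> b \<in> carrier G" by simp
    ultimately show "a \<otimes> b \<in> Z" unfolding Z_def by blast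
  qed (auto simp: Z_def)
  have "g \<otimes> x \<otimes> inv g = x \<longleftrightarrow> x \<otimes> g = g \<otimes> x" if "g \<in> carrier G" "x \<in> carrier G" for g x
    using that by (metis inv_solve_right' m_closed)
  then have Z_fix: "Z = {x \<in> carrier G. \<forall>g\<in>carrier G. g \<otimes> x \<otimes> inv g = x}"
    unfolding Z_def by auto
  interpret A: group_action G "carrier G" "\<lambda>g. \<lambda>x\<in>carrier G. g \<otimes> x \<otimes> inv g"
    by (rule group_actionI[OF is_group]) (auto simp: inv_mult_group m_assoc)
  have "card (carrier G) mod p = card Z mod p"
    using A.card_fixed_points[OF p ord fin] unfolding Z_fix by (simp cong: conj_cong)
  then have "p dvd card Z" using ord k dvd_power[of k p] by (simp add: order_def dvd_eq_mod_eq_0)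
  then obtain c where c: "card Z = p ^ 1 * c" by (auto elim: dvdE)
  have "finite Z" using fin by (simp add: Z_def)
  \<comment> \<open>\<open>sylow_thm\<close> yields a subgroup of order p^1 even when p still
    divides c, so it serves as Cauchy's theorem.\<close>
  then obtain H where H: "subgroup H (G\<lparr>carrier := Z\<rparr>)" "card H = p"
    using sylow_thm[OF p subgroup_imp_group[OF Z], of 1 c] c by (auto simp: order_def)
  have "H \<subseteq> Z" using subgroup.subset[OF H(1)] by simp
  then show ?thesis using that[OF incl_subgroup[OF Z H(1)] H(2)] by (auto simp: Z_def)
qed

text \<open>H lies in the centre of P. Then the index of its normaliser divides |G : P|, which makes
  the number of conjugates prime to p.\<close>

lemma (in sylow_subgroup) normal_subgroup_prime:
  assumes "a \<noteq> 0"
  obtains H where "subgroup H G" "H \<subseteq> P" "card H = p" "P \<subseteq> normalizer G H"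
    "\<And>h g. h \<in> H \<Longrightarrow> g \<in> P \<Longrightarrow> h \<otimes> g = g \<otimes> h"
proof -
  interpret P: group "G\<lparr>carrier := P\<rparr>" by (rule subgroup_imp_group[OF P])
  have "finite P" using fin PG finite_subset by blast
  then obtain H where H: "subgroup H (G\<lparr>carrier := P\<rparr>)" "card H = p"
    and comm: "\<And>h g. h \<in> H \<Longrightarrow> g \<in> P \<Longrightarrow> h \<otimes> g = g \<otimes> h"
    using P.central_subgroup_prime[OF _ p, of a] assms cardP by (auto simp: order_def)
  have HG: "subgroup H G" by (rule incl_subgroup[OF P H(1)])
  have "P \<subseteq> normalizer G H"
    using comm PG unfolding mem_normalizer_iff[OF HG] subset_iff l_coset_def r_coset_def by auto
  then show ?thesis using that[OF HG _ H(2) _ comm] subgroup.subset[OF H(1)] by auto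
qed

context group
begin

lemma card_conjugates_dvd_index:
  assumes fin: "finite (carrier G)" and H: "subgroup H G" and P: "subgroup P G" "P \<subseteq> normalizer G H"
    and ord: "order G = card P * m"
  shows "card (conjugates H) dvd m"
proof -
  have "card P dvd card (normalizer G H)"
    using card_subgroup_dvd[OF P(1) normalizer_imp_subgroup[OF subgroup.subset[OF H]] P(2)] .
  then obtain c where "card (normalizer G H) = card P * c" ..
  then have "card P * (card (conjugates H) * c) = card P * m"
    using card_conjugates[OF H] ord by (simp add: ac_simps)
  moreover have "card P > 0" using subgroup.finite_imp_card_positive[OF P(1) fin] .
  ultimately have "card (conjugates H) * c = m" by simp
  then show ?thesis by (metis dvd_triv_left)
qed

lemma card_Union_trivial_Int:
  assumes fin: "finite (carrier G)" and S: "\<And>H. H \<in> S \<Longrightarrow> subgroup H G \<and> card H = k"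
    and triv: "\<And>H K. H \<in> S \<Longrightarrow> K \<in> S \<Longrightarrow> H \<noteq> K \<Longrightarrow> H \<inter> K = {\<one>}"
  shows "card (\<Union>S - {\<one>}) = card S * (k - 1)"
proof -
  have sub: "H \<subseteq> carrier G" "finite H" if "H \<in> S" for H
    using S[OF that] subgroup.subset fin finite_subset by blast+
  have "\<Union>S - {\<one>} = (\<Union>H\<in>S. H - {\<one>})" by auto
  also have "card \<dots> = (\<Sum>H\<in>S. card (H - {\<one>}))"
  proof (rule card_UN_disjoint)
    show "finite S" by (rule finite_subset[of S "Pow (carrier G)"]) (use fin sub in auto)
    show "\<forall>H\<in>S. finite (H - {\<one>})" using sub by auto
    show "\<forall>H\<in>S. \<forall>K\<in>S. H \<noteq> K \<longrightarrow> (H - {\<one>}) \<inter> (K - {\<one>}) = {}" using triv by blast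
  qed
  also have "\<dots> = (\<Sum>H\<in>S. k - 1)"
    using S by (intro sum.cong refl) (simp add: card_Diff_singleton subgroup.one_closed)
  finally show ?thesis by simp
qed

lemma Int_eq_one:
  assumes "subgroup H G" "subgroup K G" "coprime (card H) (card K)"
  shows "H \<inter> K = {\<one>}"
proof -
  have HK: "subgroup (H \<inter> K) G" using subgroups_Inter_pair assms by blast
  have "card (H \<inter> K) = 1"
    using card_subgroup_dvd[OF HK assms(1)] card_subgroup_dvd[OF HK assms(2)] assms(3)
    by (metis Int_lower1 Int_lower2 coprime_common_divisor_nat)
  then obtain y where "H \<inter> K = {y}" by (metis card_1_singletonE)
  then show ?thesis using subgroup.one_closed[OF HK] by auto
qed

lemma Int_eq_one_prime:
  assumes "subgroup H G" "subgroup K G" "prime (card H)" "\<not> H \<subseteq> K"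
  shows "H \<inter> K = {\<one>}"
proof -
  have HK: "subgroup (H \<inter> K) G" using subgroups_Inter_pair assms by blast
  have "finite H" using assms(3) by (metis card.infinite not_prime_0)
  have "card (H \<inter> K) dvd card H" using card_subgroup_dvd[OF HK assms(1)] by simp
  moreover have "card (H \<inter> K) \<noteq> card H"
    using assms(4) \<open>finite H\<close> by (metis Int_lower1 card_subset_eq inf.orderI)
  ultimately have "card (H \<inter> K) = 1" using assms(3) prime_nat_iff by auto
  then obtain y where "H \<inter> K = {y}" by (metis card_1_singletonE)
  then show ?thesis using subgroup.one_closed[OF HK] by auto
qed

end

section \<open>Numerical tests for the order of the group\<close>

lemma match_prob_antimono: "k \<le> l \<Longrightarrow> match_prob l \<le> match_prob k"
proof (induction l rule: dec_induct)
  case (step l)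
  have "match_prob (Suc l) \<le> match_prob l"
    unfolding match_prob_Suc by (intro mult_left_le power_le_one) (auto simp: match_prob_nonneg)
  then show ?case using step.IH by simp
qed simp

text \<open>For prime \<open>q\<close>, \<open>level q\<close> is the largest \<open>k\<close> with \<open>(q!/q\<^sup>q)\<^sup>k > 2\<^sup>-\<^sup>4\<^sup>0\<close>.\<close>

definition level :: "nat \<Rightarrow> nat"
  where "level q =
  (if q \<ge> 31 then 0 else if q \<ge> 17 then 1 else if q \<ge> 13 then 2 else if q \<ge> 11 then 3
    else if q \<ge> 7 then 5 else if q \<ge> 5 then 8 else if q \<ge> 3 then 18 else 39)"

lemma match_prob_level:
  assumes q: "q \<ge> 2" and k: "match_prob q ^ k > (1/2) ^ 40"
  shows "k \<le> level q"
proof (rule ccontr)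
  assume "\<not> k \<le> level q"
  then have "match_prob q ^ k \<le> match_prob q ^ Suc (level q)"
    by (intro power_decreasing) (auto simp: match_prob_nonneg match_prob_le_1)
  also have "\<dots> \<le> (1/2) ^ 40"
  proof -
    have *: "match_prob q ^ c \<le> (1/2) ^ 40" if "match_prob b ^ c \<le> (1/2)^40" "b \<le> q" for b c
      using power_mono[OF match_prob_antimono[OF that(2)] match_prob_nonneg, of c] that(1) by simp
    \<comment> \<open>One check for the left end of each interval in \<open>level\<close>, with the
      first forbidden exponent; monotonicity covers the rest. For 2 the check is an equality, so the
      strict hypothesis is what gives 39 there.\<close>
    have b: "match_prob 31 ^ 1 \<le> (1/2)^40" "match_prob 17 ^ 2 \<le> (1/2)^40"
      "match_prob 13 ^ 3 \<le> (1/2)^40"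
      "match_prob 11 ^ 4 \<le> (1/2)^40" "match_prob 7 ^ 6 \<le> (1/2)^40" "match_prob 5 ^ 9 \<le> (1/2)^40"
      "match_prob 3 ^ 19 \<le> (1/2)^40" "match_prob 2 ^ 40 \<le> (1/2)^40"
      by (simp_all add: match_prob_def fact_numeral power_divide field_simps)
    show ?thesis
      unfolding level_def using b[THEN *] q by (auto simp: eval_nat_numeral(3) numeral_eq_Suc)
  qed
  finally show False using k by simp
qed

text \<open>A number \<open>d\<close> of Sylow \<open>q\<close>-subgroups satisfies \<open>2n dvd d!\<close>; this is tested for \<open>d < 8\<close> only, where
  \<open>d < 6\<close> is relaxed to \<open>2n dvd 5!\<close>. The bounds below are \<open>5/4 \<sqdot> level q \<sqdot> q\<^sup>2\<close>. Everything is stated on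
  integers because the code equations for natural numbers compute in unary.\<close>

definition admissible :: "int \<Rightarrow> int \<Rightarrow> bool"
  where "admissible n q \<longleftrightarrow> list_ex (\<lambda>k. let d = k * q + 1 in
    if n mod d = 0 then
      (if d < 6 then 120 else if d = 6 then 720 else if d = 7 then 5040 else 0) mod (2 * n) = 0
    else False) [1..n div q]"

definition order_bounds :: "(int \<times> int) list"
  where "order_bounds =
  [(2, 195), (3, 202), (5, 250), (7, 306), (11, 453), (13, 422), (17, 361), (19, 451), (23, 661), (29, 1051)]"

text \<open>Nested conditionals stop the evaluation at the first failed test. The size bounds come
  first; the primes 2 and 3, with the longest lists of candidate Sylow numbers, come last.\<close>

definition order_check :: "int \<Rightarrow> bool"
  where "order_check n \<longleftrightarrow>
    (if list_all (\<lambda>(q, b). if n mod q = 0 then n \<le> b else True) order_bounds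
     then (if list_all (\<lambda>q.
       if n mod q = 0 then admissible n q else True) [5, 7, 11, 13, 17, 19, 23, 29]
     then list_all (\<lambda>q.
       if n mod q = 0 then admissible n q else True) [2, 3] else False) else False)"

text \<open>A candidate order with an odd prime divisor q has the form q (k q + 1) t, where k q + 1
  > 1 is the number of Sylow q-subgroups. The order is at most b, which bounds k by b/q^2 and then
  t. Values repeat because they arise from several primes or several k. Some of them, such as 93,
  have a prime factor above 29, which \<open>order_check\<close> does not test.\<close>

lemma order_enum: "filter order_check
   (concat (map (\<lambda>(q, b). concat (map (\<lambda>k. map (\<lambda>t. q * (k * q + 1) * t)
     [1..b div (q * (k * q + 1))]) [1..b div (q * q)])) (tl order_bounds))) =
   [12, 60, 120, 132, 144, 168, 180, 105, 168, 30, 60, 90, 120, 180, 144, 132, 168, 93, 186, 111,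
    120, 129, 183, 201, 30, 60, 90, 120, 180, 105, 155, 180, 205, 56, 168, 105, 301, 132]"
  by code_simp

text \<open>If c is the number of Sylow q-subgroups, the witness k is (c - 1)/q, which is
  \<open>c div q\<close>.\<close>

lemma admissibleI:
  fixes n q c :: nat
  assumes "c dvd n" "c mod q = 1" "c > 1" "2 * n dvd fact c" "n > 0" "q > 0"
  shows "admissible (int n) (int q)"
proof -
  let ?k = "int (c div q)"
  have c: "c = c div q * q + 1" using assms(2) by (metis div_mult_mod_eq)
  have ci: "int c = ?k * int q + 1" using arg_cong[OF c, of int] by simp
  have "c div q \<ge> 1" using c assms(3)
    by (metis One_nat_def add.commute add_0_right leI less_one mult_0 nat_neq_iff)
  moreover have "c div q \<le> n div q" using assms by (intro div_le_mono dvd_imp_le) auto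
  ultimately have k: "?k \<in> set [1..int n div int q]" by (simp flip: zdiv_int)
  have m: "int n mod int c = 0" using assms(1) by (simp add: mod_eq_0_iff_dvd)
  have d: "(if int c < 6 then 120 else if int c = 6 then 720 else if int c = 7 then 5040 else 0)
      mod (2 * int n) = 0"
  proof -
    have "2 * n dvd 120" if "c < 6"
    proof -
      have "(fact c :: nat) dvd fact 5" using that by (intro fact_dvd) simp
      moreover have "fact 5 = (120::nat)" by (simp add: fact_numeral)
      ultimately show ?thesis using assms(4) dvd_trans by metis
    qed
    moreover have "2 * n dvd 720" if "c = 6" using assms(4) that by (simp add: fact_numeral)
    moreover have "2 * n dvd 5040" if "c = 7" using assms(4) that by (simp add: fact_numeral)
    moreover have "(x mod (2 * int n) = 0) \<longleftrightarrow> 2 * n dvd nat x" if "x \<ge> 0" for x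
      using that by (metis dvd_eq_mod_eq_0 int_dvd_int_iff nat_0_le of_nat_mult of_nat_numeral)
    ultimately show ?thesis by simp
  qed
  show ?thesis
    unfolding admissible_def list_ex_iff Let_def using m d unfolding ci by (intro bexI[OF _ k]) simp
qed

section \<open>Bounds on Sylow numbers and on the order\<close>

context nonsolvable_simple_group
begin

text \<open>A central subgroup of order p is normal, hence all of G by simplicity, and G would be
  abelian.\<close>

lemma order_not_prime_power:
  assumes p: "prime p" shows "order G \<noteq> p ^ k"
proof
  assume ord: "order G = p ^ k"
  then have "k \<noteq> 0" using order_gt_one by (metis less_irrefl power_0)
  then obtain H where H: "subgroup H G" "card H = p"
    and comm: "\<And>h g. h \<in> H \<Longrightarrow> g \<in> carrier G \<Longrightarrow> h \<otimes> g = g \<otimes> h"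
    using central_subgroup_prime[OF fin p ord] by blast
  have "H \<lhd> G"
    using comm by (intro normalI[OF H(1)]) (auto simp: l_coset_def r_coset_def)
  then have "H = carrier G \<or> H = {\<one>}" by (rule no_real_normal_subgroup)
  moreover have "H \<noteq> {\<one>}" using H(2) p by auto
  ultimately have "comm_group G" using comm group_comm_groupI by blast
  then show False using comm_group.solvable nonsolvable by blast
qed

lemma sylow_number:
  assumes p: "prime p" and ord: "order G = p ^ a * m" "\<not> p dvd m" "a \<noteq> 0"
  obtains P where "sylow_subgroup G p a m P" "P \<noteq> {\<one>}" "P \<noteq> carrier G"
    "card (conjugates P) dvd m" "card (conjugates P) mod p = 1" "card (conjugates P) > 1"
    "2 * order G dvd fact (card (conjugates P))"
proof -
  obtain P where P: "subgroup P G" "card P = p ^ a" using sylow_thm[OF p is_group ord(1) fin]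
  by blast
  interpret S: sylow_subgroup G p a m P
    using fin p ord P by (simp add: sylow_subgroup_def sylow_subgroup_axioms_def is_group)
  have "p ^ a > 1" using one_less_power[OF prime_gt_1_nat[OF p]] ord(3) by blast
  then have 1: "P \<noteq> {\<one>}" using P(2) by auto
  have 2: "P \<noteq> carrier G" using order_not_prime_power[OF p, of a] P(2) by (auto simp: order_def)
  show ?thesis
    using that[OF S.sylow_subgroup_axioms 1 2 S.card_conjugates_dvd S.card_conjugates_mod
        conjugates_gt_1[OF P(1) 1 2] order_dvd_fact_conjugates[OF P(1) 1 2]] .
qed

lemma prime_decomp:
  assumes p: "prime p" "p dvd order G"
  obtains a m where "order G = p ^ a * m" "\<not> p dvd m" "a \<noteq> 0"
proof -
  have "order G \<noteq> 0" using order_gt_one by simp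
  then obtain m where "order G = p ^ multiplicity p (order G) * m" "\<not> p dvd m"
    using p(1) by (metis multiplicity_decompose' not_prime_unit)
  moreover have "multiplicity p (order G) \<noteq> 0"
    using p \<open>order G \<noteq> 0\<close> by (metis multiplicity_eq_zero_iff not_prime_unit)
  ultimately show ?thesis by (rule that)
qed

lemma order_admissible:
  assumes p: "prime p" "p dvd order G"
  shows "admissible (int (order G)) (int p)"
proof -
  obtain a m where am: "order G = p ^ a * m" "\<not> p dvd m" "a \<noteq> 0" using prime_decomp[OF p] .
  obtain P
  where "card (conjugates P) dvd m" "card (conjugates P) mod p = 1" "card (conjugates P) > 1"
    "2 * order G dvd fact (card (conjugates P))" using sylow_number[OF p(1) am] by metis
  moreover have "card (conjugates P) dvd order G"
    using \<open>card (conjugates P) dvd m\<close> am(1) by simp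
  ultimately show ?thesis using order_gt_one prime_gt_0_nat[OF p(1)] by (intro admissibleI) auto
qed

text \<open>With at most four conjugates, 2|G| divides 24. Among the divisors of 12 only 6 and 12
  are not prime powers. Both force exactly three Sylow 2-subgroups, and then 2|G| divides 6.\<close>

lemma conjugates_ge_5:
  assumes H: "subgroup H G" "H \<noteq> {\<one>}" "H \<noteq> carrier G"
  shows "card (conjugates H) \<ge> 5"
proof (rule ccontr)
  let ?n = "order G"
  assume "\<not> card (conjugates H) \<ge> 5"
  then have "(fact (card (conjugates H)) :: nat) dvd fact 4" by (intro fact_dvd) simp
  then have "2 * ?n dvd fact 4" using order_dvd_fact_conjugates[OF H] dvd_trans by blast
  then have dvd: "?n dvd 12" by (simp add: fact_numeral)
  then have "?n \<le> 12" by (rule dvd_imp_le) simp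
  then have "?n = 2 \<or> ?n = 3 \<or> ?n = 4 \<or> ?n = 5 \<or> ?n = 6 \<or> ?n = 7 \<or> ?n = 8 \<or> ?n = 9 \<or> ?n = 10 \<or>
    ?n = 11 \<or> ?n = 12"
    using order_gt_one by arith
  then have "?n = 6 \<or> ?n = 12"
    using
    dvd order_not_prime_power[of 2 1] order_not_prime_power[of 2 2] order_not_prime_power[of 3 1]
    by auto
  then obtain a where a: "?n = 2 ^ a * 3" "a \<noteq> 0"
  proof
    assume "?n = 6" then show ?thesis using that[of 1] by simp
  next
    assume "?n = 12" then show ?thesis using that[of 2] by simp
  qed
  obtain P where P: "card (conjugates P) dvd 3" "card (conjugates P) > 1"
    "2 * ?n dvd fact (card (conjugates P))"
    using sylow_number[OF two_is_prime_nat a(1) _ a(2)] by auto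
  moreover have "prime (3::nat)" by simp
  ultimately have "card (conjugates P) = 3" by (metis less_irrefl prime_nat_iff)
  then have "2 * ?n dvd 6" using P(3) by (simp add: fact_numeral)
  then have "2 * ?n \<le> 6" by (rule dvd_imp_le) simp
  then show False using \<open>?n = 6 \<or> ?n = 12\<close> by auto
qed

end

locale exceptional_simple_group = nonsolvable_simple_group +
  assumes prob: "subgroup H G \<Longrightarrow> transversal_prob G H > (1/2) ^ 40"
begin

text \<open>The subgroup H is central in a Sylow p-subgroup, and \<open>M\<close> is the exponent of
  \<open>match_prob p\<close> in its transversal probability.\<close>

lemma prime_subgroup:
  assumes p: "prime p" and ord: "order G = p ^ a * m" "\<not> p dvd m" "a \<noteq> 0"
  obtains H M
  where "subgroup H G" "card H = p" "card (conjugates H) dvd m" "card (conjugates H) \<ge> 5"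
    "2 * order G dvd fact (card (conjugates H))" "M \<le> level p"
    "M * p\<^sup>2 + card (normalizer G H) = order G"
proof -
  obtain P where S: "sylow_subgroup G p a m P" using sylow_number[OF p ord] by metis
  interpret S: sylow_subgroup G p a m P by (rule S)
  obtain H where H: "subgroup H G" "H \<subseteq> P" "card H = p" "P \<subseteq> normalizer G H"
    using S.normal_subgroup_prime[OF ord(3)] by metis
  obtain M where M: "transversal_prob G H = match_prob (card H) ^ M"
    "M * (card H)\<^sup>2 + card (normalizer G H) = order G"
    using transversal_prob_prime[OF H(1) fin] p H(3) by metis
  have "M \<le> level p" using match_prob_level[of p M] prime_ge_2_nat[OF p] prob[OF H(1)] M(1) H(3)
    by simp
  moreover have "H \<noteq> {\<one>}" using H(3) p by auto
  moreover have "H \<noteq> carrier G"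
    using order_not_prime_power[OF p, of 1] H(3) by (auto simp: order_def)
  moreover have "card (conjugates H) dvd m"
    using card_conjugates_dvd_index[OF fin H(1) S.P H(4)] ord(1) S.cardP by simp
  ultimately show ?thesis
    using that[OF H(1,3)] conjugates_ge_5[OF H(1)] order_dvd_fact_conjugates[OF H(1)] M(2) H(3)
    by simp
qed

text \<open>The normaliser has index at least 5, so M p^2, being the number of elements outside it,
  is at least four fifths of |G|.\<close>

lemma order_le:
  assumes p: "prime p" "p dvd order G"
  shows "4 * order G \<le> 5 * (level p * p\<^sup>2)" "level p > 0"
proof -
  obtain a m where am: "order G = p ^ a * m" "\<not> p dvd m" "a \<noteq> 0" using prime_decomp[OF p] .
  obtain H M where H: "subgroup H G" "card (conjugates H) \<ge> 5" and M: "M \<le> level p"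
    "M * p\<^sup>2 + card (normalizer G H) = order G"
    using prime_subgroup[OF p(1) am] by metis
  have "5 * card (normalizer G H) \<le> order G"
    using card_conjugates[OF H(1)] H(2) by (metis mult_le_mono1)
  then have *: "4 * order G \<le> 5 * (M * p\<^sup>2)" using M(2) by linarith
  also have "\<dots> \<le> 5 * (level p * p\<^sup>2)" using M(1) by simp
  finally show "4 * order G \<le> 5 * (level p * p\<^sup>2)" .
  show "level p > 0" using * M(1) order_gt_one by (cases "M = 0") auto
qed

lemma prime_divisor:
  assumes p: "prime p" "p dvd order G"
  shows "p \<in> {2, 3, 5, 7, 11, 13, 17, 19, 23, 29}"
proof -
  have "p < 31" using order_le(2)[OF p] by (auto simp: level_def split: if_splits)
  then have "p = 0 \<or> p = 1 \<or> p = 2 \<or> p = 3 \<or> p = 4 \<or> p = 5 \<or> p = 6 \<or> p = 7 \<or> p = 8 \<or> p = 9 \<or>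
    p = 10 \<or> p = 11 \<or> p = 12 \<or> p = 13 \<or> p = 14 \<or> p = 15 \<or> p = 16 \<or> p = 17 \<or> p = 18 \<or> p = 19 \<or> p = 20 \<or>
    p = 21 \<or> p = 22 \<or> p = 23 \<or> p = 24 \<or> p = 25 \<or> p = 26 \<or> p = 27 \<or> p = 28 \<or> p = 29 \<or> p = 30"
    by arith
  then show ?thesis using p(1) by (elim disjE) simp_all
qed

text \<open>Not being a 2-group, G has an odd prime divisor p; with its number of Sylow p-subgroups
  this puts |G| into the enumerated form. What survives the enumeration is thinned out by
  hand.\<close>

lemma order_cases: "order G \<in> {30, 56, 60, 90, 105, 120, 132, 144, 168, 180}"
proof -
  define n where "n = int (order G)"
  have bound: "n \<le> b" if "(q, b) \<in> set order_bounds" "n mod q = 0" for q b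
  proof -
    have pr: "prime (nat q)" and q: "q = int (nat q)" using that(1)
      by (auto simp: order_bounds_def)
    then have "nat q dvd order G" using that(2) by (metis n_def dvd_eq_mod_eq_0 int_dvd_int_iff)
    from order_le(1)[OF pr this] show ?thesis
      using that(1) by (auto simp: order_bounds_def level_def n_def)
  qed
  have adm: "admissible n q" if "q \<in> {2, 3, 5, 7, 11, 13, 17, 19, 23, 29}" "n mod q = 0" for q
  proof -
    have pr: "prime (nat q)" and q: "q = int (nat q)" using that(1) by auto
    then have "nat q dvd order G" using that(2) by (metis n_def dvd_eq_mod_eq_0 int_dvd_int_iff)
    from order_admissible[OF pr this] show ?thesis using q by (simp add: n_def)
  qed
  have check: "order_check n"
    unfolding order_check_def list_all_iff using bound adm by (auto split: if_splits)
  obtain p where p: "prime p" "p dvd order G" "p \<noteq> 2"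
  proof -
    have "order G \<noteq> 2 ^ multiplicity 2 (order G)" by (rule order_not_prime_power) simp
    moreover have "order G \<noteq> 0" using order_gt_one by simp
    ultimately obtain m where m: "order G = 2 ^ multiplicity 2 (order G) * m" "\<not> 2 dvd m" "m \<noteq> 1"
      by (metis mult.right_neutral multiplicity_decompose' odd_one)
    then obtain p where "prime p" "p dvd m" by (metis prime_factor_nat)
    then show ?thesis using that[of p] m by (metis dvd_mult)
  qed
  obtain a m where am: "order G = p ^ a * m" "\<not> p dvd m" "a \<noteq> 0" using prime_decomp[OF p(1,2)] .
  obtain P
  where P: "card (conjugates P) dvd m" "card (conjugates P) mod p = 1" "card (conjugates P) > 1"
    using sylow_number[OF p(1) am] by metis
  let ?c = "card (conjugates P)"
  define k where "k = ?c div p"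
  have ck: "?c = k * p + 1" using P(2) unfolding k_def by (metis div_mult_mod_eq)
  then have k: "k \<ge> 1" using P(3) by (cases k) auto
  obtain m' where m': "m = ?c * m'" using P(1) by (elim dvdE)
  define t where "t = p ^ (a - 1) * m'"
  \<comment> \<open>The Sylow number k p + 1 divides the part m of the order prime to p, so p times
    it divides the order.\<close>
  have nt: "order G = p * (k * p + 1) * t"
    unfolding t_def using am(1,3) m' ck by (cases a) (simp_all add: algebra_simps)
  then have t: "t \<ge> 1" using order_gt_one by (cases t) auto
  obtain b where b: "(int p, b) \<in> set (tl order_bounds)" "n \<le> b"
    using bound[of "int p"] prime_divisor[OF p(1,2)] p(2,3)
    by (auto simp: order_bounds_def n_def zmod_int[symmetric] dvd_eq_mod_eq_0)
  let ?L = "concat (map (\<lambda>(q, b). concat (map (\<lambda>k. map (\<lambda>t. q * (k * q + 1) * t)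
     [1..b div (q * (k * q + 1))]) [1..b div (q * q)])) (tl order_bounds))"
  have n: "n = int p * (int k * int p + 1) * int t" by (simp add: n_def nt algebra_simps)
  have pp: "int p > 0" using prime_gt_0_nat[OF p(1)] by simp
  have le_div: "x \<le> y div z" if "x * z \<le> y" "z > 0" for x y z :: int
    using zdiv_mono1[OF that] that(2) by simp
  have tb: "int t \<in> set [1..b div (int p * (int k * int p + 1))]"
  proof -
    have "int t * (int p * (int k * int p + 1)) \<le> b" using b(2) n by (simp add: ac_simps)
    then show ?thesis using t pp by (auto intro!: le_div)
  qed
  have kb: "int k \<in> set [1..b div (int p * int p)]"
  proof -
    have "int k * (int p * int p) \<le> int p * (int k * int p + 1)" by (simp add: algebra_simps)
    also have "\<dots> \<le> int p * (int k * int p + 1) * int t"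
      using t pp mult_left_mono[of 1 "int t" "int p * (int k * int p + 1)"] by simp
    finally have "int k * (int p * int p) \<le> b" using b(2) n by simp
    then show ?thesis using k pp by (auto intro!: le_div)
  qed
  have "n \<in> (\<lambda>t. int p * (int k * int p + 1) * t) ` set [1..b div (int p * (int k * int p + 1))]"
    using tb n by blast
  then have "n \<in> (\<Union>k\<in>set [1..b div (int p * int p)].
      (\<lambda>t. int p * (k * int p + 1) * t) ` set [1..b div (int p * (k * int p + 1))])"
    using kb by blast
  then have "n \<in> (\<Union>(q, b)\<in>set (tl order_bounds). \<Union>k\<in>set [1..b div (q * q)].
      (\<lambda>t. q * (k * q + 1) * t) ` set [1..b div (q * (k * q + 1))])"
    by (intro UN_I[OF b(1)]) (simp only: prod.case)
  also have "\<dots> = set ?L"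
    by (simp only: set_concat set_map image_image case_prod_unfold)
  finally have "n \<in> set (filter order_check ?L)"
    using check by simp
  then have
    "n \<in> {12, 60, 120, 132, 144, 168, 180, 105, 30, 90, 93, 186, 111, 129, 183, 201, 155, 205, 56, 301}"
    unfolding order_enum by auto
  \<comment> \<open>These primes remove the listed values with a prime divisor above 29.\<close>
  moreover have "\<not> n mod 31 = 0" "\<not> n mod 37 = 0" "\<not> n mod 41 = 0" "\<not> n mod 43 = 0"
    "\<not> n mod 61 = 0" "\<not> n mod 67 = 0"
  proof -
    have *: "\<not> n mod int p = 0" if "prime p" "p > 29" for p
    proof
      assume "n mod int p = 0"
      then have "p dvd order G" unfolding n_def by (metis dvd_eq_mod_eq_0 int_dvd_int_iff)
      then show False using prime_divisor[OF that(1)] that(2) by auto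
    qed
    show "\<not> n mod 31 = 0" using *[of 31] by simp
    show "\<not> n mod 37 = 0" using *[of 37] by simp
    show "\<not> n mod 41 = 0" using *[of 41] by simp
    show "\<not> n mod 43 = 0" using *[of 43] by simp
    show "\<not> n mod 61 = 0" using *[of 61] by simp
    show "\<not> n mod 67 = 0" using *[of 67] by simp
  qed
  \<comment> \<open>The value 12 passes only because the factorial test was relaxed to 5! for small
    d; its Sylow 2-subgroups number at most 3.\<close>
  moreover have "n \<noteq> 12"
  proof
    assume "n = 12"
    then have o: "order G = 2 ^ 2 * 3" "\<not> 2 dvd (3::nat)" "(2::nat) \<noteq> 0" by (simp_all add: n_def)
    obtain P where S: "sylow_subgroup G 2 2 3 P"
    and P: "P \<noteq> {\<one>}" "P \<noteq> carrier G" "card (conjugates P) dvd 3"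
      using sylow_number[OF two_is_prime_nat o] by metis
    then have "card (conjugates P) \<le> 3" by (intro dvd_imp_le) auto
    then show False using conjugates_ge_5[OF sylow_subgroup.P[OF S] P(1,2)] by simp
  qed
  ultimately have "n \<in> {30, 56, 60, 90, 105, 120, 132, 144, 168, 180}"
    by (elim insertE emptyE) simp_all
  then show ?thesis by (auto simp: n_def)
qed

end

section \<open>Counting elements of prime power order\<close>

context sylow_subgroup
begin

text \<open>By Sylow's theorem these are the nontrivial elements of p-power order.\<close>

definition p_elements :: "'a set"
  where "p_elements = \<Union>(conjugates P) - {\<one>}"

lemma p_elements_subset: "p_elements \<subseteq> carrier G - {\<one>}"
proof
  fix x assume "x \<in> p_elements"
  then obtain K where "K \<in> conjugates P" "x \<in> K" "x \<noteq> \<one>" by (auto simp: p_elements_def)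
  then show "x \<in> carrier G - {\<one>}" using subgroup.mem_carrier[OF subgroup_conjugates[OF P]] by blast
qed

lemma finite_p_elements: "finite p_elements"
  using p_elements_subset fin by (meson finite_Diff finite_subset)

lemma card_p_elements_trivial_Int:
  assumes "\<And>H K. H \<in> conjugates P \<Longrightarrow> K \<in> conjugates P \<Longrightarrow> H \<noteq> K \<Longrightarrow> H \<inter> K = {\<one>}"
  shows "card p_elements = card (conjugates P) * (p ^ a - 1)"
  unfolding p_elements_def
  by (rule card_Union_trivial_Int[OF fin])
    (use assms subgroup_conjugates[OF P] sylow_subgroup.cardP[OF conj_sylow] in auto)

lemma card_p_elements_prime:
  assumes "a = 1" shows "card p_elements = card (conjugates P) * (p - 1)"
proof -
  have "H \<inter> K = {\<one>}" if HK: "H \<in> conjugates P" "K \<in> conjugates P" "H \<noteq> K" for H K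
  proof (rule Int_eq_one_prime)
    interpret H: sylow_subgroup G p a m H by (rule conj_sylow[OF HK(1)])
    interpret K: sylow_subgroup G p a m K by (rule conj_sylow[OF HK(2)])
    show "subgroup H G" "subgroup K G" by (rule H.P K.P)+
    show "prime (card H)" using H.cardP assms p by simp
    show "\<not> H \<subseteq> K" using HK(3) H.cardP K.cardP K.PG fin finite_subset card_subset_eq by metis
  qed
  then show ?thesis using card_p_elements_trivial_Int assms by simp
qed

text \<open>P contributes p^a - 1 elements, and a second Sylow subgroup at least one more. This is
  used where the intersections of Sylow subgroups are unknown.\<close>

lemma card_p_elements_ge:
  assumes "card (conjugates P) > 1" shows "card p_elements \<ge> p ^ a"
proof -
  have "conjugates P \<noteq> {P}" using assms by auto
  then obtain Q where Q: "Q \<in> conjugates P" "Q \<noteq> P" using conjugates_self[OF PG] by blast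
  interpret Q: sylow_subgroup G p a m Q by (rule conj_sylow[OF Q(1)])
  have fP: "finite P" using PG fin finite_subset by blast
  then have "\<not> Q \<subseteq> P" using Q(2) cardP Q.cardP card_subset_eq by metis
  then obtain x where x: "x \<in> Q" "x \<notin> P" by blast
  have "insert x P - {\<one>} \<subseteq> p_elements"
    unfolding p_elements_def using Q(1) x conjugates_self[OF PG] by blast
  then have "card (insert x P - {\<one>}) \<le> card p_elements" using finite_p_elements card_mono by blast
  moreover have "card (insert x P - {\<one>}) = p ^ a"
    using x fP cardP subgroup.one_closed[OF P] by simp
  ultimately show ?thesis by simp
qed

lemma p_elements_disjoint:
  assumes "sylow_subgroup G q b l Q" "p \<noteq> q"
  shows "p_elements \<inter> sylow_subgroup.p_elements G Q = {}"
proof -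
  interpret Q: sylow_subgroup G q b l Q by fact
  have "H \<inter> K = {\<one>}" if "H \<in> conjugates P" "K \<in> conjugates Q" for H K
  proof -
    interpret H: sylow_subgroup G p a m H by (rule conj_sylow[OF that(1)])
    interpret K: sylow_subgroup G q b l K by (rule Q.conj_sylow[OF that(2)])
    have "coprime (p ^ a) (q ^ b)"
      using primes_coprime[OF p Q.p assms(2)] by simp
    then show ?thesis using Int_eq_one[OF H.P K.P] H.cardP K.cardP by simp
  qed
  then show ?thesis unfolding p_elements_def Q.p_elements_def by blast
qed

text \<open>The inequality is strict because of the identity; the orders 56 and 144 are excluded by
  just this one element.\<close>

lemma card_p_elements_add:
  assumes "sylow_subgroup G q b l Q" "p \<noteq> q"
  shows "card p_elements + card (sylow_subgroup.p_elements G Q) < order G"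
proof -
  interpret Q: sylow_subgroup G q b l Q by fact
  have "card p_elements + card Q.p_elements = card (p_elements \<union> Q.p_elements)"
    using finite_p_elements Q.finite_p_elements p_elements_disjoint[OF assms]
    by (simp add: card_Un_disjoint)
  also have "\<dots> < card (carrier G)"
    using p_elements_subset Q.p_elements_subset fin by (intro psubset_card_mono) blast+
  finally show ?thesis by (simp add: order_def)
qed

text \<open>Two Sylow subgroups of order \<open>p\<^sup>2\<close> are abelian, so both normalise their intersection.\<close>

lemma Int_normalizer_prime_square:
  assumes a: "a = 2" and Q: "Q \<in> conjugates P" "Q \<noteq> P" "P \<inter> Q \<noteq> {\<one>}"
  shows "card (P \<inter> Q) = p" "subgroup (P \<inter> Q) G" "P \<subseteq> normalizer G (P \<inter> Q)"
    "p ^ 3 \<le> card (normalizer G (P \<inter> Q))"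
proof -
  let ?D = "P \<inter> Q"
  interpret Q: sylow_subgroup G p a m Q by (rule conj_sylow[OF Q(1)])
  show D: "subgroup ?D G" using subgroups_Inter_pair P Q.P by blast
  have fP: "finite P" "finite Q" using PG Q.PG fin finite_subset by blast+
  have p1: "p > 1" using p prime_gt_1_nat by blast
  have "card ?D dvd p ^ 2" using card_subgroup_dvd[OF D P] cardP a by simp
  then obtain k where k: "k \<le> 2" "card ?D = p ^ k" using p by (metis divides_primepow_nat)
  have "k \<noteq> 2"
  proof
    assume "k = 2"
    then have "card ?D = card P" "card ?D = card Q" using k cardP Q.cardP a by simp_all
    then have "?D = P" "?D = Q" using card_subset_eq fP by (metis Int_lower1, metis Int_lower2)
    then show False using Q(2) by simp
  qed
  moreover have "k \<noteq> 0"
  proof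
    assume "k = 0"
    then obtain y where "?D = {y}" using k by (metis card_1_singletonE power_0)
    then show False using Q(3) subgroup.one_closed[OF D] by auto
  qed
  ultimately have "k = 1" using k(1) by simp
  then show cD: "card ?D = p" using k(2) by simp
  have sub: "R \<subseteq> normalizer G ?D" if R: "sylow_subgroup G p a m R" and DR: "?D \<subseteq> R" for R
  proof -
    interpret R: sylow_subgroup G p a m R by (rule R)
    \<comment> \<open>A central subgroup H of order p stands in for commutativity of R. Either H is
      the intersection D itself, or R = HD, where H centralises D and D normalises itself.\<close>
    obtain H where H: "subgroup H G" "H \<subseteq> R" "card H = p" "\<And>h g. h \<in> H \<Longrightarrow> g \<in> R \<Longrightarrow> h \<otimes> g = g \<otimes> h"
      using R.normal_subgroup_prime a by (metis zero_neq_numeral)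
    have N: "subgroup (normalizer G ?D) G"
      by (rule normalizer_imp_subgroup[OF subgroup.subset[OF D]])
    have HN: "H \<subseteq> normalizer G ?D"
    proof
      fix h assume h: "h \<in> H"
      then have "h <# ?D = ?D #> h"
        unfolding l_coset_def r_coset_def by (intro SUP_cong refl) (use H(4) DR in auto)
      then show "h \<in> normalizer G ?D"
        using mem_normalizer_iff[OF D] h subgroup.mem_carrier[OF H(1)] by blast
    qed
    have DN: "?D \<subseteq> normalizer G ?D" by (rule subset_normalizer[OF D])
    have fR: "finite R" using R.PG fin finite_subset by blast
    show ?thesis
    proof (cases "H = ?D")
      case True
      have "R \<subseteq> normalizer G H"
        using H(4) R.PG unfolding mem_normalizer_iff[OF H(1)] subset_iff l_coset_def r_coset_def
        by auto
      then show ?thesis using True by simp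
    next
      case False
      have "finite ?D" using fP by simp
      then have "\<not> H \<subseteq> ?D" using False H(3) cD by (metis card_subset_eq)
      then have "H \<inter> ?D = {\<one>}" using Int_eq_one_prime[OF H(1) D] H(3) p by simp
      then have "card (H <#> ?D) = p ^ 2"
        using card_set_mult[OF H(1) D] finite_subset[OF H(2) fR] fP H(3) cD
        by (simp add: power2_eq_square)
      moreover have "H <#> ?D \<subseteq> R"
        using H(2) DR R.P by (auto simp: set_mult_def subgroup.m_closed subset_iff)
      ultimately have "H <#> ?D = R" using R.cardP a fR by (metis card_subset_eq)
      moreover have "H <#> ?D \<subseteq> normalizer G ?D"
        using HN DN N by (auto simp: set_mult_def subgroup.m_closed subset_iff)
      ultimately show ?thesis by simp
    qed
  qed
  show PN: "P \<subseteq> normalizer G ?D" by (rule sub[OF sylow_subgroup_axioms]) simp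
  have QN: "Q \<subseteq> normalizer G ?D" by (rule sub[OF Q.sylow_subgroup_axioms]) simp
  have N: "subgroup (normalizer G ?D) G" by (rule normalizer_imp_subgroup[OF subgroup.subset[OF D]])
  \<comment> \<open>The normaliser contains the product set PQ, which has p^2 p^2 / p
    elements.\<close>
  have "card (P <#> Q) * p = p ^ 2 * p ^ 2"
    using card_set_mult[OF P Q.P fP] cD cardP Q.cardP a by simp
  also have "\<dots> = p ^ 3 * p" by (simp add: eval_nat_numeral)
  finally have "card (P <#> Q) * p = p ^ 3 * p" .
  then have "card (P <#> Q) = p ^ 3" using p1 by simp
  moreover have "P <#> Q \<subseteq> normalizer G ?D"
    using PN QN N by (auto simp: set_mult_def subgroup.m_closed subset_iff)
  moreover have "finite (normalizer G ?D)" using subgroup.subset[OF N] fin finite_subset by blast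
  ultimately show "p ^ 3 \<le> card (normalizer G ?D)" by (metis card_mono)
qed

end

text \<open>The list \<open>ds\<close> is given as a literal, so that for concrete m the second
  premise is discharged by evaluation in the simplifier.\<close>

lemma divisor_cases:
  fixes c m :: nat
  assumes "c dvd m" "filter (\<lambda>d. d dvd m) [2..<Suc m] = ds" "m > 0" "c > 1"
  shows "c \<in> set ds"
  using assms dvd_imp_le[OF assms(1)] by auto

section \<open>Excluding single orders, and order 60\<close>

context nonsolvable_simple_group
begin

text \<open>The candidates are the divisors of m that are 1 modulo p and, by
  \<open>conjugates_ge_5\<close>, at least 5.\<close>

lemma sylow_number_cases:
  assumes p: "prime p" and ord: "order G = p ^ a * m" "\<not> p dvd m" "a \<noteq> 0"
    and cs: "filter (\<lambda>d. d dvd m) [2..<Suc m] = ds" "filter (\<lambda>d. d mod p = 1 \<and> 5 \<le> d) ds = cs"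
  shows "\<exists>P. sylow_subgroup G p a m P \<and> P \<noteq> {\<one>} \<and> P \<noteq> carrier G \<and> card (conjugates P) \<in> set cs"
proof -
  obtain P where P: "sylow_subgroup G p a m P" "P \<noteq> {\<one>}" "P \<noteq> carrier G"
    "card (conjugates P) dvd m" "card (conjugates P) mod p = 1"
    using sylow_number[OF p ord] by metis
  have "card (conjugates P) \<ge> 5" using conjugates_ge_5[OF sylow_subgroup.P[OF P(1)] P(2,3)] .
  moreover have "m > 0" using ord(1) order_gt_one by (cases m) auto
  ultimately have "card (conjugates P) \<in> set cs"
    using divisor_cases[OF P(4) cs(1)] P(5) by (simp flip: cs(2))
  then show ?thesis using P(1-3) by blast
qed

text \<open>Six Sylow 5-subgroups and ten Sylow 3-subgroups would have 24 + 20 nontrivial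
  elements.\<close>

lemma order_not_30: "order G \<noteq> 30"
proof
  assume n: "order G = 30"
  have "\<exists>P. sylow_subgroup G 5 1 6 P \<and> P \<noteq> {\<one>} \<and> P \<noteq> carrier G \<and> card (conjugates P) \<in> set [6]"
    by (rule sylow_number_cases[where ds = "[2, 3, 6]"]) (simp_all add: n upt_rec_numeral)
  then obtain P where P: "sylow_subgroup G 5 1 6 P" "card (conjugates P) = 6" by auto
  have "\<exists>Q. sylow_subgroup G 3 1 10 Q \<and> Q \<noteq> {\<one>} \<and> Q \<noteq> carrier G \<and> card (conjugates Q) \<in> set [10]"
    by (rule sylow_number_cases[where ds = "[2, 5, 10]"]) (simp_all add: n upt_rec_numeral)
  then obtain Q where Q: "sylow_subgroup G 3 1 10 Q" "card (conjugates Q) = 10" by auto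
  interpret P: sylow_subgroup G 5 1 6 P by (rule P)
  interpret Q: sylow_subgroup G 3 1 10 Q by (rule Q)
  show False
    using
    P.card_p_elements_add[OF Q(1)] P.card_p_elements_prime Q.card_p_elements_prime P(2) Q(2) n
    by simp
qed

text \<open>Eight Sylow 7-subgroups have 48 nontrivial elements, and there are at least eight
  nontrivial 2-elements.\<close>

lemma order_not_56: "order G \<noteq> 56"
proof
  assume n: "order G = 56"
  have "\<exists>P. sylow_subgroup G 7 1 8 P \<and> P \<noteq> {\<one>} \<and> P \<noteq> carrier G \<and> card (conjugates P) \<in> set [8]"
    by (rule sylow_number_cases[where ds = "[2, 4, 8]"]) (simp_all add: n upt_rec_numeral)
  then obtain P where P: "sylow_subgroup G 7 1 8 P" "card (conjugates P) = 8" by auto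
  have "\<exists>Q. sylow_subgroup G 2 3 7 Q \<and> Q \<noteq> {\<one>} \<and> Q \<noteq> carrier G \<and> card (conjugates Q) \<in> set [7]"
    by (rule sylow_number_cases[where ds = "[7]"]) (simp_all add: n upt_rec_numeral)
  then obtain Q where Q: "sylow_subgroup G 2 3 7 Q" "card (conjugates Q) = 7" by auto
  interpret P: sylow_subgroup G 7 1 8 P by (rule P)
  interpret Q: sylow_subgroup G 2 3 7 Q by (rule Q)
  show False
    using P.card_p_elements_add[OF Q(1)] P.card_p_elements_prime Q.card_p_elements_ge P(2) Q(2) n
    by simp
qed

text \<open>The nontrivial elements of the Sylow 7-subgroups and Sylow 5-subgroups would number 90 +
  84.\<close>

lemma order_not_105: "order G \<noteq> 105"
proof
  assume n: "order G = 105"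
  have "\<exists>P. sylow_subgroup G 7 1 15 P \<and> P \<noteq> {\<one>} \<and> P \<noteq> carrier G \<and> card (conjugates P) \<in> set [15]"
    by (rule sylow_number_cases[where ds = "[3, 5, 15]"]) (simp_all add: n upt_rec_numeral)
  then obtain P where P: "sylow_subgroup G 7 1 15 P" "card (conjugates P) = 15" by auto
  have "\<exists>Q. sylow_subgroup G 5 1 21 Q \<and> Q \<noteq> {\<one>} \<and> Q \<noteq> carrier G \<and> card (conjugates Q) \<in> set [21]"
    by (rule sylow_number_cases[where ds = "[3, 7, 21]"]) (simp_all add: n upt_rec_numeral)
  then obtain Q where Q: "sylow_subgroup G 5 1 21 Q" "card (conjugates Q) = 21" by auto
  interpret P: sylow_subgroup G 7 1 15 P by (rule P)
  interpret Q: sylow_subgroup G 5 1 21 Q by (rule Q)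
  show False
    using
    P.card_p_elements_add[OF Q(1)] P.card_p_elements_prime Q.card_p_elements_prime P(2) Q(2) n
    by simp
qed

text \<open>The nontrivial elements of the Sylow 11-subgroups and Sylow 3-subgroups would number 120
  + 44.\<close>

lemma order_not_132: "order G \<noteq> 132"
proof
  assume n: "order G = 132"
  have "\<exists>P. sylow_subgroup G 11 1 12 P \<and> P \<noteq> {\<one>} \<and> P \<noteq> carrier G \<and> card (conjugates P) \<in> set [12]"
    by (rule sylow_number_cases[where ds = "[2, 3, 4, 6, 12]"]) (simp_all add: n upt_rec_numeral)
  then obtain P where P: "sylow_subgroup G 11 1 12 P" "card (conjugates P) = 12" by auto
  have "\<exists>Q. sylow_subgroup G 3 1 44 Q \<and> Q \<noteq> {\<one>} \<and> Q \<noteq> carrier G \<and> card (conjugates Q) \<in> set [22]"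
    by (rule sylow_number_cases[where ds = "[2, 4, 11, 22, 44]"]) (simp_all add: n upt_rec_numeral)
  then obtain Q where Q: "sylow_subgroup G 3 1 44 Q" "card (conjugates Q) = 22" by auto
  interpret P: sylow_subgroup G 11 1 12 P by (rule P)
  interpret Q: sylow_subgroup G 3 1 44 Q by (rule Q)
  show False
    using
    P.card_p_elements_add[OF Q(1)] P.card_p_elements_prime Q.card_p_elements_prime P(2) Q(2) n
    by simp
qed

text \<open>Either the Sylow subgroups meet trivially and their elements can be counted, or some
  intersection D of order p has a normaliser of order at least p^3. In the second case D has at most
  m/p conjugates, which is too few or leads to a small permutation representation.\<close>

lemma prime_square_sylow:
  assumes S: "sylow_subgroup G p 2 m P" "card (conjugates P) > 1"
  obtains "card (sylow_subgroup.p_elements G P) = card (conjugates P) * (p ^ 2 - 1)"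
  | D where "subgroup D G" "D \<noteq> {\<one>}" "D \<noteq> carrier G" "card (conjugates D) \<ge> 5"
  "card (conjugates D) dvd m"
    "card (conjugates D) * p \<le> m"
proof -
  interpret S: sylow_subgroup G p 2 m P by (rule S)
  have p1: "p > 1" using S.p prime_gt_1_nat by blast
  show thesis
  proof (cases "\<exists>H K. H \<in> conjugates P \<and> K \<in> conjugates P \<and> H \<noteq> K \<and> H \<inter> K \<noteq> {\<one>}")
    case False
    then show ?thesis using that(1) S.card_p_elements_trivial_Int by blast
  next
    case True
    then obtain H K where HK: "H \<in> conjugates P" "K \<in> conjugates P" "K \<noteq> H" "H \<inter> K \<noteq> {\<one>}" by blast
    interpret H: sylow_subgroup G p 2 m H by (rule S.conj_sylow[OF HK(1)])
    interpret K: sylow_subgroup G p 2 m K by (rule S.conj_sylow[OF HK(2)])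
    have KH: "K \<in> conjugates H" using H.sylow_conjugate[OF K.P K.cardP] .
    note D = H.Int_normalizer_prime_square[OF refl KH HK(3,4)]
    have Dne: "H \<inter> K \<noteq> carrier G" using order_not_prime_power[OF S.p, of 1] D(1)
      by (auto simp: order_def)
    have "card (conjugates (H \<inter> K)) * p ^ 3 \<le> p ^ 2 * m"
      using card_conjugates[OF D(2)] D(4) S.ord by (metis mult_le_mono2)
    then have "p ^ 2 * (card (conjugates (H \<inter> K)) * p) \<le> p ^ 2 * m"
      by (simp add: power3_eq_cube power2_eq_square ac_simps)
    then have "card (conjugates (H \<inter> K)) * p \<le> m" using p1 by simp
    moreover have "card (conjugates (H \<inter> K)) dvd m"
      using card_conjugates_dvd_index[OF fin D(2) H.P D(3)] S.ord H.cardP by simp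
    ultimately show ?thesis using that(2)[OF D(2) HK(4) Dne conjugates_ge_5[OF D(2) HK(4) Dne]]
    by blast
  qed
qed

text \<open>With trivial intersections there are 24 + 80 nontrivial elements; otherwise D has at
  most 10/3 conjugates, against the bound 5.\<close>

lemma order_not_90: "order G \<noteq> 90"
proof
  assume n: "order G = 90"
  have "\<exists>P. sylow_subgroup G 5 1 18 P \<and> P \<noteq> {\<one>} \<and> P \<noteq> carrier G \<and> card (conjugates P) \<in> set [6]"
    by (rule sylow_number_cases[where ds = "[2, 3, 6, 9, 18]"]) (simp_all add: n upt_rec_numeral)
  then obtain P where P: "sylow_subgroup G 5 1 18 P" "card (conjugates P) = 6" by auto
  have "\<exists>Q. sylow_subgroup G 3 2 10 Q \<and> Q \<noteq> {\<one>} \<and> Q \<noteq> carrier G \<and> card (conjugates Q) \<in> set [10]"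
    by (rule sylow_number_cases[where ds = "[2, 5, 10]"]) (simp_all add: n upt_rec_numeral)
  then obtain Q where Q: "sylow_subgroup G 3 2 10 Q" "card (conjugates Q) = 10" by auto
  interpret P: sylow_subgroup G 5 1 18 P by (rule P)
  interpret Q: sylow_subgroup G 3 2 10 Q by (rule Q)
  have "card (conjugates Q) > 1" using Q(2) by simp
  from prime_square_sylow[OF Q(1) this] show False
  proof cases
    case 1
    then show ?thesis using P.card_p_elements_add[OF Q(1)] P.card_p_elements_prime P(2) Q(2) n
      by simp
  next
    case (2 D)
    then show ?thesis by linarith
  qed
qed

text \<open>Trivially meeting Sylow 3-subgroups give 128 elements besides at least 16 nontrivial
  2-elements. Otherwise D has at least 5 and at most 16/3 conjugates, but 5 does not divide
  16.\<close>

lemma order_not_144: "order G \<noteq> 144"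
proof
  assume n: "order G = 144"
  have "\<exists>P. sylow_subgroup G 2 4 9 P \<and> P \<noteq> {\<one>} \<and> P \<noteq> carrier G \<and> card (conjugates P) \<in> set [9]"
    by (rule sylow_number_cases[where ds = "[3, 9]"]) (simp_all add: n upt_rec_numeral)
  then obtain P where P: "sylow_subgroup G 2 4 9 P" "card (conjugates P) = 9" by auto
  have "\<exists>Q. sylow_subgroup G 3 2 16 Q \<and> Q \<noteq> {\<one>} \<and> Q \<noteq> carrier G \<and> card (conjugates Q) \<in> set [16]"
    by (rule sylow_number_cases[where ds = "[2, 4, 8, 16]"]) (simp_all add: n upt_rec_numeral)
  then obtain Q where Q: "sylow_subgroup G 3 2 16 Q" "card (conjugates Q) = 16" by auto
  interpret P: sylow_subgroup G 2 4 9 P by (rule P)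
  interpret Q: sylow_subgroup G 3 2 16 Q by (rule Q)
  have "card (conjugates Q) > 1" using Q(2) by simp
  from prime_square_sylow[OF Q(1) this] show False
  proof cases
    case 1
    then show ?thesis using P.card_p_elements_add[OF Q(1)] P.card_p_elements_ge P(2) Q(2) n by simp
  next
    case (2 D)
    then have "card (conjugates D) = 5" by simp
    then show ?thesis using 2(5) by simp
  qed
qed

text \<open>With fifteen Sylow 2-subgroups, trivial intersections would give 45 + 24 elements. So
  two of them share an involution, and the number of conjugates of the subgroup it generates lies
  between 5 and 7 and divides 15.\<close>

lemma order_60_index_5:
  assumes n: "order G = 60"
  obtains H where "subgroup H G" "H \<noteq> {\<one>}" "H \<noteq> carrier G" "card (conjugates H) = 5"
proof -
  have "\<exists>P. sylow_subgroup G 5 1 12 P \<and> P \<noteq> {\<one>} \<and> P \<noteq> carrier G \<and> card (conjugates P) \<in> set [6]"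
    by (rule sylow_number_cases[where ds = "[2, 3, 4, 6, 12]"]) (simp_all add: n upt_rec_numeral)
  then obtain P where P: "sylow_subgroup G 5 1 12 P" "card (conjugates P) = 6" by auto
  have "\<exists>Q. sylow_subgroup G 2 2 15 Q \<and> Q \<noteq> {\<one>} \<and> Q \<noteq> carrier G \<and> card (conjugates Q) \<in> set [5, 15]"
    by (rule sylow_number_cases[where ds = "[3, 5, 15]"]) (simp_all add: n upt_rec_numeral)
  then obtain Q where Q: "sylow_subgroup G 2 2 15 Q" "Q \<noteq> {\<one>}" "Q \<noteq> carrier G"
    "card (conjugates Q) = 5 \<or> card (conjugates Q) = 15" by auto
  interpret P: sylow_subgroup G 5 1 12 P by (rule P)
  interpret Q: sylow_subgroup G 2 2 15 Q by (rule Q)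
  show ?thesis
  proof (cases "card (conjugates Q) = 5")
    case True
    then show ?thesis using that[OF Q.P Q(2,3)] by blast
  next
    case False
    then have c: "card (conjugates Q) = 15" using Q(4) by simp
    then have "card (conjugates Q) > 1" by simp
    from prime_square_sylow[OF Q(1) this] show ?thesis
    proof cases
      case 1
      then show ?thesis using P.card_p_elements_add[OF Q(1)] P.card_p_elements_prime P(2) c n
        by simp
    next
      case (2 D)
      then have "card (conjugates D) = 5 \<or> card (conjugates D) = 6 \<or> card (conjugates D) = 7"
        by linarith
      then have "card (conjugates D) = 5" using 2(5) by auto
      then show ?thesis using that 2(1-3) by blast
    qed
  qed
qed

theorem order_60_iso:
  assumes n: "order G = 60" shows "G \<cong> alt_group 5"
proof -
  obtain H where H: "subgroup H G" "H \<noteq> {\<one>}" "H \<noteq> carrier G" "card (conjugates H) = 5"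
    using order_60_index_5[OF n] .
  obtain \<psi> where \<psi>: "\<psi> \<in> hom G (alt_group 5)" "inj_on \<psi> (carrier G)"
    using alternating_rep[OF H(1-3)] H(4) by metis
  have c: "card (carrier (alt_group 5)) = 60" using alt_group_card_carrier[of 5]
    by (simp add: fact_numeral)
  have "\<psi> ` carrier G \<subseteq> carrier (alt_group 5)" using \<psi>(1) by (auto simp: hom_def)
  moreover have "card (\<psi> ` carrier G) = 60" using card_image[OF \<psi>(2)] n by (simp add: order_def)
  moreover have "finite (carrier (alt_group 5))" using c by (metis card.infinite zero_neq_numeral)
  ultimately have "\<psi> ` carrier G = carrier (alt_group 5)" using c by (metis card_subset_eq)
  then have "\<psi> \<in> iso G (alt_group 5)" using \<psi> by (simp add: iso_def bij_betw_def)
  then show ?thesis by (auto simp: is_iso_def)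
qed

end

text \<open>A suitable subgroup of order 2 has 9, 15 or 45 conjugates, five being impossible as 360
  does not divide 5!. The normaliser orders 20, 12 and 4 give the exponents 40, 42 and 44, all above
  39.\<close>

lemma (in exceptional_simple_group) order_not_180: "order G \<noteq> 180"
proof
  assume n: "order G = 180"
  then have o: "order G = 2 ^ 2 * 45" "\<not> 2 dvd (45::nat)" "(2::nat) \<noteq> 0" by simp_all
  obtain H M where H: "subgroup H G" "card (conjugates H) dvd 45" "card (conjugates H) \<ge> 5"
    "2 * order G dvd fact (card (conjugates H))" "M \<le> level 2"
    "M * 2\<^sup>2 + card (normalizer G H) = order G"
    using prime_subgroup[OF two_is_prime_nat o] by metis
  have "card (conjugates H) \<noteq> 5" using H(4) n by (auto simp: fact_numeral)
  moreover have "card (conjugates H) \<in> set [3, 5, 9, 15, 45]"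
    using H(3) by (intro divisor_cases[OF H(2)]) (simp_all add: upt_rec_numeral)
  ultimately have "card (conjugates H) \<in> {9, 15, 45}" using H(3) by auto
  then have "card (normalizer G H) \<in> {20, 12, 4}" using card_conjugates[OF H(1)] n by auto
  then show False using H(5,6) n by (auto simp: level_def)
qed

section \<open>Excluding order 120\<close>

context nonsolvable_simple_group
begin

text \<open>A group of order 120 would act on its six Sylow 5-subgroups with an element that squares a
  generator of one of them, that is, with a 4-cycle, which is odd.\<close>

lemma order_not_120: "order G \<noteq> 120"
proof
  assume n: "order G = 120"
  have "\<exists>P. sylow_subgroup G 5 1 24 P \<and> P \<noteq> {\<one>} \<and> P \<noteq> carrier G \<and> card (conjugates P) \<in> set [6]"
    by (rule sylow_number_cases[where
        ds = "[2, 3, 4, 6, 8, 12, 24]"]) (simp_all add: n upt_rec_numeral)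
  then obtain P where S: "sylow_subgroup G 5 1 24 P" and P1: "P \<noteq> {\<one>}" "P \<noteq> carrier G"
    and c6: "card (conjugates P) = 6" by auto
  interpret P: sylow_subgroup G 5 1 24 P by (rule S)
  interpret PS: subgroup P G by (rule P.P)
  let ?N = "normalizer G P"
  have N: "subgroup ?N G" by (rule normalizer_imp_subgroup[OF P.PG])
  interpret NS: subgroup ?N G by (rule N)
  have cN: "card ?N = 20" using card_conjugates[OF P.P] c6 n by simp
  have cP: "card P = 5" using P.cardP by simp
  have fP: "finite P" using P.PG fin finite_subset by blast
  \<comment> \<open>The normaliser of P has order 20; the required element is found in its Sylow
    2-subgroup.\<close>
  obtain T where T: "subgroup T (G\<lparr>carrier := ?N\<rparr>)" "card T = 4"
    using sylow_thm[OF two_is_prime_nat subgroup_imp_group[OF N], of 2 5] cN fin NS.subset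
    by (auto simp: order_def finite_subset)
  have TG: "subgroup T G" by (rule incl_subgroup[OF N T(1)])
  interpret TS: subgroup T G by (rule TG)
  have TN: "T \<subseteq> ?N" using subgroup.subset[OF T(1)] by simp
  have Tfix: "g <# P #> inv g = P" if "g \<in> T" for g
    using TN that mem_normalizer_conj[OF P.PG] by blast
  let ?E = "conjugates P - {P}"
  have sub: "K \<subseteq> carrier G" if "K \<in> conjugates P" for K
    using subgroup_conjugates[OF P.P that] subgroup.subset by blast
  have conj_inj: "K = L"
    if "g \<in> carrier G" "K \<subseteq> carrier G" "L \<subseteq> carrier G" "g <# K #> inv g = g <# L #> inv g" for g K L
    using subgroup_conjugation_is_inj[OF that] .
  interpret A: group_action "G\<lparr>carrier := T\<rparr>" ?E "\<lambda>g. \<lambda>K\<in>?E. g <# K #> inv g"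
  proof (rule conj_action[OF TG])
    show "K \<subseteq> carrier G" if "K \<in> ?E" for K using that sub by blast
    show "g <# K #> inv g \<in> ?E" if "g \<in> T" "K \<in> ?E" for g K
      using that conj_conjugates[OF P.PG] conj_inj[of g K P] Tfix[of g] sub P.PG TS.mem_carrier
      by auto
  qed
  have cE: "card ?E = 5" using c6 conjugates_self[OF P.PG] P.finite_conjugates by simp
  \<comment> \<open>A 2-group acting on the five other Sylow 5-subgroups has a fixed point
    Q.\<close>
  let ?S = "{K \<in> ?E. \<forall>g\<in>T. (\<lambda>K\<in>?E. g <# K #> inv g) K = K}"
  have "card ?E mod 2 = card ?S mod 2"
    using A.card_fixed_points[OF two_is_prime_nat, of 2] T(2) P.finite_conjugates
    unfolding order_def by simp
  then have "card ?S mod 2 = 1" unfolding cE by simp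
  then have "?S \<noteq> {}" by (metis card.empty mod_0 zero_neq_one)
  then obtain Q where QS: "Q \<in> ?S" by blast
  then have Q: "Q \<in> conjugates P" "Q \<noteq> P" by simp_all
  then have QT: "g <# Q #> inv g = Q" if "g \<in> T" for g using QS that by simp
  interpret Q: sylow_subgroup G 5 1 24 Q by (rule P.conj_sylow[OF Q(1)])
  define F where "F y = y <# Q #> inv y" for y
  have F_mult: "F (g \<otimes> h) = g <# F h #> inv g" if "g \<in> carrier G" "h \<in> carrier G" for g h
    unfolding F_def using conj_mult[OF Q.PG that] .
  \<comment> \<open>A 5-subgroup that normalises Q lies in Q. So P acts regularly on the other five
    Sylow subgroups, and y \<mapsto> y Q y^-1 identifies P with them.\<close>
  have PQ: "P \<inter> normalizer G Q = {\<one>}"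
  proof (rule Int_eq_one_prime[OF P.P normalizer_imp_subgroup[OF Q.PG]])
    show "prime (card P)" using cP by simp
    show "\<not> P \<subseteq> normalizer G Q"
    proof
      assume "P \<subseteq> normalizer G Q"
      then have "P \<subseteq> Q" using Q.p_subgroup_normalizer[OF P.P P.cardP] by simp
      then show False using Q(2) card_subset_eq[of Q P] Q.PG fin finite_subset P.cardP Q.cardP
        by metis
    qed
  qed
  have F_inj: "inj_on F P" unfolding F_def by (rule inj_on_conj[OF P.P Q.PG PQ])
  have F_E: "F ` P = ?E"
  proof (rule card_subset_eq)
    show "F ` P \<subseteq> ?E"
    proof
      fix K assume "K \<in> F ` P"
      then obtain y where y: "y \<in> P" "K = F y" by blast
      have "y <# P #> inv y = P"
        using subset_normalizer[OF P.P] y mem_normalizer_conj[OF P.PG] by blast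
      then have "K \<noteq> P" using conj_inj[of y Q P] y Q(2) Q.PG P.PG unfolding F_def by auto
      moreover have "K \<in> conjugates P" using conj_conjugates[OF P.PG _ Q(1)] y by (simp add: F_def)
      ultimately show "K \<in> ?E" by simp
    qed
    show "card (F ` P) = card ?E" using card_image[OF F_inj] cE cP by simp
  qed (use P.finite_conjugates in simp)
  \<comment> \<open>Since s fixes Q, its action on the five points becomes conjugation by s on
    P.\<close>
  have F_conj: "s <# F y #> inv s = F (s \<otimes> y \<otimes> inv s)" if "s \<in> T" "y \<in> P" for s y
  proof -
    have "F (s \<otimes> y \<otimes> inv s) = s <# F (y \<otimes> inv s) #> inv s" using F_mult[of s "y \<otimes> inv s"] that
      by (simp add: m_assoc)
    moreover have "F (y \<otimes> inv s) = y <# F (inv s) #> inv y" using F_mult that by simp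
    moreover have "F (inv s) = Q" using QT[of "inv s"] that by (simp add: F_def)
    ultimately show ?thesis by (simp add: F_def)
  qed
  obtain x where x: "x \<in> P" "x \<noteq> \<one>" using P1(1) PS.one_closed by blast
  have xG: "x \<in> carrier G" using x by simp
  have "ord x dvd 5" using pow_card_subgroup[OF P.P x(1)] cP pow_eq_id[OF xG] by simp
  moreover have "ord x \<noteq> 1" using x xG ord_eq_1 by blast
  moreover have "prime (5::nat)" by simp
  ultimately have ox: "ord x = 5" by (metis prime_nat_iff)
  have powP: "x [^] k \<in> P" for k :: nat
    using x by (induction k) (auto intro: PS.m_closed)
  have pow_eq: "x [^] j = x [^] k \<longleftrightarrow> j mod 5 = k mod 5" for j k :: nat
  proof -
    have "x [^] j = x [^] k \<longleftrightarrow> int k mod 5 = int j mod 5"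
      using int_pow_eq[OF xG, of "int j" "int k"] ox
      by (simp add: int_pow_int mod_eq_dvd_iff[symmetric])
    also have "\<dots> \<longleftrightarrow> j mod 5 = k mod 5" using zmod_int[of k 5] zmod_int[of j 5] by auto
    finally show ?thesis .
  qed
  have P_eq: "P = (\<lambda>k. x [^] k) ` {..<5::nat}"
  proof (rule card_subset_eq[symmetric])
    show "finite P" by (rule fP)
    show "(\<lambda>k. x [^] k) ` {..<5::nat} \<subseteq> P" using powP by blast
    have "inj_on (\<lambda>k. x [^] k) {..<5::nat}" using pow_eq by (auto intro!: inj_onI)
    then show "card ((\<lambda>k. x [^] k) ` {..<5::nat}) = card P" using cP by (simp add: card_image)
  qed
  have conj_pow: "s \<otimes> x [^] k \<otimes> inv s = (s \<otimes> x \<otimes> inv s) [^] k" if "s \<in> carrier G" for s and k :: nat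
  proof (induction k)
    case (Suc k)
    have "s \<otimes> x [^] Suc k \<otimes> inv s = (s \<otimes> x [^] k \<otimes> inv s) \<otimes> (s \<otimes> x \<otimes> inv s)"
      using that xG by (simp add: m_assoc) (simp add: m_assoc[symmetric])
    then show ?case using Suc by simp
  qed (use that in simp)
  have Tconj: "s \<otimes> y \<otimes> inv s \<in> P" if "s \<in> T" "y \<in> P" for s y
    using Tfix[OF that(1)] that by (auto simp: l_coset_def r_coset_def)
  \<comment> \<open>The map sending s to the conjugate of x is injective on T and lands in the four
    nontrivial elements of P, so some s takes x to its square.\<close>
  define t where "t s = s \<otimes> x \<otimes> inv s" for s
  have t_inj: "inj_on t T"
  proof (rule inj_onI)
    fix u v assume uv: "u \<in> T" "v \<in> T" "t u = t v"
    define s where "s = inv v \<otimes> u"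
    have s: "s \<in> T" "s \<in> carrier G" using uv by (simp_all add: s_def)
    have "s \<otimes> x \<otimes> inv s = inv v \<otimes> t u \<otimes> v" using uv(1,2) xG
      by (simp add: s_def t_def inv_mult_group m_assoc)
    also have "\<dots> = x" unfolding uv(3) using uv(1,2) xG
      by (simp add: t_def m_assoc) (simp add: m_assoc[symmetric])
    finally have sx: "s \<otimes> x \<otimes> inv s = x" .
    \<comment> \<open>An s that commutes with x fixes P and all the other Sylow 5-subgroups, so it
      is trivial by faithfulness.\<close>
    have "s <# K #> inv s = K" if "K \<in> conjugates P" for K
    proof (cases "K = P")
      case True
      then show ?thesis using Tfix[OF s(1)] by simp
    next
      case False
      then have "K \<in> F ` P" unfolding F_E using that by simp
      then obtain y where y: "y \<in> P" "K = F y" by (rule imageE)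
      then obtain k where "y = x [^] (k::nat)" using P_eq by auto
      then have "s \<otimes> y \<otimes> inv s = y" using conj_pow[OF s(2)] sx by simp
      then show ?thesis using F_conj[OF s(1) y(1)] y(2) by simp
    qed
    then have "s = \<one>" using normal_core_trivial[OF P.P P1 s(2)] by blast
    then show "u = v" using uv by (metis TS.mem_carrier s_def inv_closed inv_equality inv_inv)
  qed
  have "t ` T = P - {\<one>}"
  proof (rule card_subset_eq)
    show "t ` T \<subseteq> P - {\<one>}"
    proof
      fix z assume "z \<in> t ` T"
      then obtain s where s: "s \<in> T" "z = s \<otimes> x \<otimes> inv s" by (auto simp: t_def)
      have "z \<noteq> \<one>"
      proof
        assume "z = \<one>"
        then have "s \<otimes> x = s" using s xG
          by (metis TS.mem_carrier inv_closed inv_equality inv_inv m_closed)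
        then show False using s x xG by simp
      qed
      then show "z \<in> P - {\<one>}" using Tconj[OF s(1) x(1)] s(2) by simp
    qed
    show "card (t ` T) = card (P - {\<one>})" using card_image[OF t_inj] T(2) cP by simp
  qed (use fP in simp)
  moreover have "x [^] (2::nat) \<in> P - {\<one>}" using powP[of 2] pow_eq[of 2 0] by simp
  ultimately have "x [^] (2::nat) \<in> t ` T" by simp
  then obtain s where s: "s \<in> T" "s \<otimes> x \<otimes> inv s = x [^] (2::nat)" unfolding t_def
    by (elim imageE) simp
  have sG: "s \<in> carrier G" using s by simp
  \<comment> \<open>Here \<open>R 0\<close> is Q. The element s fixes P and \<open>R 0\<close> and
    doubles the index modulo 5 on the other four.\<close>
  define R where "R k = F (x [^] k)" for k :: nat
  have R: "s <# R k #> inv s = R (2 * k)" for k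
  proof -
    have "s \<otimes> x [^] k \<otimes> inv s = x [^] (2 * k)" using conj_pow[OF sG, of k] s(2) xG
      by (simp add: nat_pow_pow)
    then show ?thesis using F_conj[OF s(1) powP] by (simp add: R_def)
  qed
  have R_eq: "R j = R k \<longleftrightarrow> j mod 5 = k mod 5" for j k
    using pow_eq F_inj powP unfolding R_def by (metis inj_onD)
  have R_E: "conjugates P = {P, R 0, R 1, R 2, R 3, R 4}"
  proof -
    have "?E = F ` ((\<lambda>k. x [^] k) ` {..<5::nat})" by (simp only: F_E[symmetric] P_eq[symmetric])
    also have "\<dots> = R ` {..<5}" by (simp add: image_image R_def)
    also have "{..<5::nat} = {0, 1, 2, 3, 4}" by auto
    finally have "?E = {R 0, R 1, R 2, R 3, R 4}" by (simp only: image_insert image_empty)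
    moreover have "conjugates P = insert P ?E" using conjugates_self[OF P.PG] by blast
    ultimately show ?thesis by (simp only:)
  qed
  obtain e \<psi> where e: "bij_betw e {1..card (conjugates P)} (conjugates P)"
    and \<psi>: "\<psi> \<in> hom G (alt_group (card (conjugates P)))"
    and e\<psi>: "\<And>g i. g \<in> carrier G \<Longrightarrow> i \<in> {1..card (conjugates P)} \<Longrightarrow> e (\<psi> g i) = g <# e i #> inv g"
    using alternating_rep[OF P.P P1] by metis
  let ?I = "{1..card (conjugates P)}"
  have perm: "\<psi> s permutes ?I" "evenperm (\<psi> s)"
    using \<psi> sG by (auto simp: hom_def Pi_def alt_group_carrier)
  define f where "f = the_inv_into ?I e"
  have ef: "e (f K) = K" "f K \<in> ?I" if "K \<in> conjugates P" for K
    using e that unfolding f_def bij_betw_def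
    by (metis f_the_inv_into_f, metis order_refl the_inv_into_into)
  have f_inj: "f K = f L \<longleftrightarrow> K = L" if "K \<in> conjugates P" "L \<in> conjugates P" for K L
    using ef[OF that(1)] ef[OF that(2)] by metis
  have RE: "R k \<in> conjugates P" for k using R_eq[of k "k mod 5"] R_E
    by (metis F_E Diff_iff R_def image_eqI powP)
  have f\<psi>: "\<psi> s (f K) = f (s <# K #> inv s)" if "K \<in> conjugates P" for K
  proof -
    have K': "s <# K #> inv s \<in> conjugates P" using conj_conjugates[OF P.PG sG that] .
    have "\<psi> s (f K) \<in> ?I" using permutes_in_image[OF perm(1)] ef(2)[OF that] by blast
    moreover have "e (\<psi> s (f K)) = e (f (s <# K #> inv s))"
      using e\<psi>[OF sG ef(2)[OF that]] ef(1)[OF that] ef(1)[OF K'] by simp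
    ultimately show ?thesis using e ef(2)[OF K'] unfolding bij_betw_def by (meson inj_onD)
  qed
  \<comment> \<open>The order 1, 2, 4, 3 is that of repeated doubling modulo 5, so s acts as the
    cycle (a b c d), a product of three transpositions.\<close>
  let ?a = "f (R 1)" and ?b = "f (R 2)" and ?c = "f (R 4)" and ?d = "f (R 3)"
  have dist: "?a \<noteq> ?b" "?a \<noteq> ?c" "?a \<noteq> ?d" "?b \<noteq> ?c" "?b \<noteq> ?d" "?c \<noteq> ?d"
    using f_inj[OF RE RE] R_eq by auto
  have cyc: "\<psi> s ?a = ?b" "\<psi> s ?b = ?c" "\<psi> s ?c = ?d" "\<psi> s ?d = ?a"
  proof -
    have "R (2 * 4) = R 3" "R (2 * 3) = R 1" by (simp_all add: R_eq)
    then show "\<psi> s ?a = ?b" "\<psi> s ?b = ?c" "\<psi> s ?c = ?d" "\<psi> s ?d = ?a"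
      using f\<psi>[OF RE] R by simp_all
  qed
  have "\<psi> s = transpose ?a ?b \<circ> (transpose ?b ?c \<circ> transpose ?c ?d)"
  proof
    fix i
    show "\<psi> s i = (transpose ?a ?b \<circ> (transpose ?b ?c \<circ> transpose ?c ?d)) i"
    proof (cases "i \<in> {?a, ?b, ?c, ?d}")
      case True
      then show ?thesis using cyc dist by (auto simp: transpose_def)
    next
      case False
      have "\<psi> s i = i"
      proof (cases "i \<in> ?I")
        case True
        then have "e i \<in> conjugates P" "f (e i) = i"
          using e unfolding f_def bij_betw_def by (auto simp: the_inv_into_f_f)
        moreover from this have "e i = P \<or> e i = R 0" using False R_E ef(1)
        by (metis insertE empty_iff insertCI)
        moreover have "s <# R 0 #> inv s = R 0" using R[of 0] by simp
        ultimately show ?thesis using f\<psi>[of "e i"] Tfix[OF s(1)] by auto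
      next
        case False
        then show ?thesis using perm(1) by (simp add: permutes_not_in)
      qed
      then show ?thesis using False by (auto simp: transpose_def)
    qed
  qed
  moreover have "evenperm (transpose ?a ?b \<circ> (transpose ?b ?c \<circ> transpose ?c ?d)) \<longleftrightarrow> False"
    using dist by (simp add: evenperm_comp permutation_compose permutation_swap_id evenperm_swap)
  ultimately show False using perm(2) by simp
qed

end

section \<open>Excluding order 168\<close>

lemma (in group) pow_gcd_eq_one:
  assumes "x \<in> carrier G" "x [^] (j::nat) = \<one>" "x [^] (k::nat) = \<one>"
  shows "x [^] gcd j k = \<one>"
  using assms pow_eq_id by simp

lemma (in sylow_subgroup) p_elements_pow:
  assumes "x \<in> p_elements" shows "x [^] (p ^ a) = \<one>"
proof -
  obtain K where K: "K \<in> conjugates P" "x \<in> K" using assms by (auto simp: p_elements_def)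
  show ?thesis using pow_card_subgroup[OF subgroup_conjugates[OF P K(1)] K(2)]
      sylow_subgroup.cardP[OF conj_sylow[OF K(1)]] by simp
qed

text \<open>Take a Sylow 7-subgroup P and a Sylow 3-subgroup S of its normaliser, which has order
  21. If there are only seven Sylow 3-subgroups, P permutes them regularly, so all of them lie in
  the normaliser of P. Conjugating, S normalises every Sylow 7-subgroup, which contradicts
  faithfulness.\<close>

lemma (in nonsolvable_simple_group) order_168_Sylow_3:
  assumes n: "order G = 168" and R: "sylow_subgroup G 3 1 56 R" and cR: "card (conjugates R) = 7"
  shows False
proof -
  interpret R: sylow_subgroup G 3 1 56 R by (rule R)
  have "\<exists>P. sylow_subgroup G 7 1 24 P \<and> P \<noteq> {\<one>} \<and> P \<noteq> carrier G \<and> card (conjugates P) \<in> set [8]"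
    by (rule sylow_number_cases[where
        ds = "[2, 3, 4, 6, 8, 12, 24]"]) (simp_all add: n upt_rec_numeral)
  then obtain P
    where P: "sylow_subgroup G 7 1 24 P" "P \<noteq> {\<one>}" "P \<noteq> carrier G" "card (conjugates P) = 8" by auto
  interpret P: sylow_subgroup G 7 1 24 P by (rule P(1))
  interpret PS: subgroup P G by (rule P.P)
  have N: "subgroup (normalizer G P) G" by (rule normalizer_imp_subgroup[OF P.PG])
  interpret NS: subgroup "normalizer G P" G by (rule N)
  have cN: "card (normalizer G P) = 21" using card_conjugates[OF P.P] P(4) n by simp
  have "finite (normalizer G P)" using NS.subset fin finite_subset by blast
  moreover have "prime (3::nat)" by simp
  ultimately obtain S where S: "subgroup S (G\<lparr>carrier := normalizer G P\<rparr>)" "card S = 3"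
    using sylow_thm[OF _ subgroup_imp_group[OF N], of 3 1 7] cN by (auto simp: order_def)
  have SG: "subgroup S G" by (rule incl_subgroup[OF N S(1)])
  have SN: "S \<subseteq> normalizer G P" using subgroup.subset[OF S(1)] by simp
  have S_conj: "S \<in> conjugates R" using R.sylow_conjugate[OF SG] S(2) by simp
  interpret S: sylow_subgroup G 3 1 56 S by (rule R.conj_sylow[OF S_conj])
  have "conjugates S = conjugates R"
  proof
    show "conjugates S \<subseteq> conjugates R"
      using conj_conjugates[OF R.PG _ S_conj] by (auto simp: conjugates_def)
    show "conjugates R \<subseteq> conjugates S"
      using S.sylow_conjugate R.conj_sylow sylow_subgroup.P sylow_subgroup.cardP by blast
  qed
  then have cS: "card (conjugates S) = 7" using cR by simp
  then have cNS: "card (normalizer G S) = 24" using card_conjugates[OF S.P] n by simp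
  \<comment> \<open>Seven conjugates mean that the normaliser of S has order 24, prime to 7.\<close>
  have PNS: "P \<inter> normalizer G S = {\<one>}"
  proof (rule Int_eq_one[OF P.P normalizer_imp_subgroup[OF S.PG]])
    have "coprime 7 (24::nat)" by (simp add: coprime_iff_gcd_eq_1 gcd_non_0_nat)
    then show "coprime (card P) (card (normalizer G S))" using P.cardP cNS by simp
  qed
  define F where "F y = y <# S #> inv y" for y
  have F_inj: "inj_on F P" unfolding F_def by (rule inj_on_conj[OF P.P S.PG PNS])
  have F_img: "F ` P = conjugates S"
  proof (rule card_subset_eq)
    show "F ` P \<subseteq> conjugates S" by (auto simp: F_def conjugates_def)
    show "card (F ` P) = card (conjugates S)" using card_image[OF F_inj] cS P.cardP by simp
  qed (rule S.finite_conjugates)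
  have in_N: "K \<subseteq> normalizer G P" if "K \<in> conjugates S" for K
  proof -
    have "K \<in> F ` P" using that F_img by simp
    then obtain y where y: "y \<in> P" "K = y <# S #> inv y" unfolding F_def by (rule imageE)
    have "y \<in> normalizer G P" using subset_normalizer[OF P.P] y(1) by blast
    then show ?thesis using y(2) SN by (auto simp: l_coset_def r_coset_def)
  qed
  have "r <# L #> inv r = L" if r: "r \<in> S" and L: "L \<in> conjugates P" for r L
  proof -
    obtain g where g: "g \<in> carrier G" "L = g <# P #> inv g" using L by (auto simp: conjugates_def)
    have rG: "r \<in> carrier G" using r S.PG by blast
    let ?r = "inv g \<otimes> r \<otimes> g"
    have "inv g <# S #> inv (inv g) \<in> conjugates S"
      unfolding conjugates_def by (rule imageI) (simp add: g(1))
    moreover have "?r \<in> inv g <# S #> inv (inv g)"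
      using r g(1) by (auto simp: l_coset_def r_coset_def)
    ultimately have "?r \<in> normalizer G P" using in_N by blast
    then have "?r <# P #> inv ?r = P" using mem_normalizer_conj[OF P.PG] by blast
    moreover have "r \<otimes> g = g \<otimes> ?r" using g(1) rG by (simp add: m_assoc[symmetric])
    then have "r <# L #> inv r = g <# (?r <# P #> inv ?r) #> inv g"
      unfolding g(2) using conj_mult[OF P.PG rG g(1)] conj_mult[OF P.PG g(1), of ?r] g(1) rG by simp
    ultimately show ?thesis using g(2) by simp
  qed
  then have "r = \<one>" if "r \<in> S" for r
    using normal_core_trivial[OF P.P P(2,3), of r] S.PG that by blast
  then have "S \<subseteq> {\<one>}" by blast
  then have "card S \<le> card {\<one>}" by (intro card_mono) auto
  then show False using S(2) by simp
qed

text \<open>If all \<open>P\<^sub>G(H)\<close> exceed \<open>2\<^sup>-\<^sup>4\<^sup>0\<close>, then an involution commutes with an element of order 3. So every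
  element of order 3 is the fourth power of an element of order 6,
  and the elements of order 3, 6 and
  7 leave no room for a second Sylow 2-subgroup.\<close>

lemma (in exceptional_simple_group) order_not_168: "order G \<noteq> 168"
proof
  assume n: "order G = 168"
  have o: "order G = 2 ^ 3 * 21" "\<not> 2 dvd (21::nat)" "(3::nat) \<noteq> 0" using n by simp_all
  obtain H M
  where H: "subgroup H G" "card H = 2" "card (conjugates H) dvd 21" "card (conjugates H) \<ge> 5"
    and M: "M \<le> level 2" "M * 2\<^sup>2 + card (normalizer G H) = order G"
    using prime_subgroup[OF two_is_prime_nat o] by metis
  have "card (conjugates H) \<in> set [3, 7, 21]"
    using H(4) by (intro divisor_cases[OF H(3)]) (simp_all add: upt_rec_numeral)
  \<comment> \<open>With 21 conjugates the normaliser has order 8, so M = 40, one above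
    \<open>level 2\<close>.\<close>
  moreover have "card (conjugates H) \<noteq> 21"
    using card_conjugates[OF H(1)] M n by (auto simp: level_def)
  ultimately have "card (conjugates H) = 7" using H(4) by auto
  then have cN: "card (normalizer G H) = 24" using card_conjugates[OF H(1)] n by simp
  interpret HS: subgroup H G by (rule H(1))
  have N: "subgroup (normalizer G H) G" by (rule normalizer_imp_subgroup[OF HS.subset])
  interpret NS: subgroup "normalizer G H" G by (rule N)
  have "finite (normalizer G H)" using NS.subset fin finite_subset by blast
  moreover have p3: "prime (3::nat)" by simp
  ultimately obtain R where R: "subgroup R (G\<lparr>carrier := normalizer G H\<rparr>)" "card R = 3"
    using sylow_thm[OF _ subgroup_imp_group[OF N], of 3 1 8] cN by (auto simp: order_def)
  have RG: "subgroup R G" by (rule incl_subgroup[OF N R(1)])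
  have RN: "R \<subseteq> normalizer G H" using subgroup.subset[OF R(1)] by simp
  interpret R: sylow_subgroup G 3 1 56 R
    using RG R(2) n fin by (simp add: sylow_subgroup_def sylow_subgroup_axioms_def is_group)
  have "H \<noteq> {\<one>}" using H(2) by auto
  then obtain t where t: "t \<in> H" "t \<noteq> \<one>" using HS.one_closed by blast
  have "finite H" using HS.subset fin finite_subset by blast
  then have Ht: "H = {\<one>, t}"
    using card_subset_eq[of H "{\<one>, t}"] t H(2) HS.one_closed by simp
  have tG: "t \<in> carrier G" using t by simp
  \<comment> \<open>R normalises H = {1, t}, and conjugation must fix the only nontrivial element
    t.\<close>
  have comm: "r \<otimes> t = t \<otimes> r" if "r \<in> R" for r
  proof -
    have r: "r \<in> carrier G" "r <# H = H #> r" using RN that mem_normalizer_iff[OF H(1)] by auto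
    have "r \<otimes> t \<in> H #> r" using r t by (auto simp: l_coset_def)
    then have "r \<otimes> t = r \<or> r \<otimes> t = t \<otimes> r" using r(1) by (auto simp: r_coset_def Ht)
    then show ?thesis using r(1) tG t(2) by auto
  qed
  have t2: "t [^] (2::nat) = \<one>" using pow_card_subgroup[OF H(1) t(1)] H(2) by simp
  have R1: "R \<noteq> {\<one>}" "R \<noteq> carrier G" using R(2) n by (auto simp: order_def)
  have "card (conjugates R) \<in> set [2, 4, 7, 8, 14, 28, 56]"
    using conjugates_ge_5[OF R.P R1]
    by (intro divisor_cases[OF R.card_conjugates_dvd]) (simp_all add: upt_rec_numeral)
  then have "card (conjugates R) = 7 \<or> card (conjugates R) = 28"
    using R.card_conjugates_mod conjugates_ge_5[OF R.P R1] by auto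
  then have cR: "card (conjugates R) = 28" using order_168_Sylow_3[OF n R.sylow_subgroup_axioms]
    by blast
  have c3: "card R.p_elements = 56" using R.card_p_elements_prime cR by simp
  have "\<exists>P. sylow_subgroup G 7 1 24 P \<and> P \<noteq> {\<one>} \<and> P \<noteq> carrier G \<and> card (conjugates P) \<in> set [8]"
    by (rule sylow_number_cases[where
        ds = "[2, 3, 4, 6, 8, 12, 24]"]) (simp_all add: n upt_rec_numeral)
  then obtain P where P: "sylow_subgroup G 7 1 24 P" "card (conjugates P) = 8" by auto
  interpret P: sylow_subgroup G 7 1 24 P by (rule P(1))
  have c7: "card P.p_elements = 48" using P.card_p_elements_prime P(2) by simp
  have "\<exists>Q. sylow_subgroup G 2 3 21 Q \<and> Q \<noteq> {\<one>} \<and> Q \<noteq> carrier G \<and> card (conjugates Q) \<in> set [7, 21]"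
    by (rule sylow_number_cases[where ds = "[3, 7, 21]"]) (simp_all add: n upt_rec_numeral)
  then obtain Q where Q: "sylow_subgroup G 2 3 21 Q" "card (conjugates Q) \<in> set [7, 21]" by blast
  interpret Q: sylow_subgroup G 2 3 21 Q by (rule Q(1))
  have c2: "card Q.p_elements \<ge> 8" using Q.card_p_elements_ge Q(2) by auto
  \<comment> \<open>A description of the required elements by powers only. Their orders divide 12
    but neither 3 nor 4, which keeps them apart from all 3-, 7- and 2-elements.\<close>
  define W where "W = {w \<in> carrier G. w [^] (4::nat) \<in> R.p_elements \<and> w [^] (3::nat) \<noteq> \<one>}"
  have fW: "finite W" using fin by (simp add: W_def)
  have R3: "z [^] (3::nat) = \<one>" "z \<in> carrier G" "z \<noteq> \<one>" if "z \<in> R.p_elements" for z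
    using R.p_elements_pow[OF that] R.p_elements_subset that by auto
  have "R.p_elements \<subseteq> (\<lambda>w. w [^] (4::nat)) ` W"
  proof
    fix z assume z: "z \<in> R.p_elements"
    then obtain g where g: "g \<in> carrier G" "z \<in> g <# R #> inv g"
      by (auto simp: R.p_elements_def conjugates_def)
    then obtain r where r: "r \<in> R" "z = g \<otimes> r \<otimes> inv g" by (auto simp: l_coset_def r_coset_def)
    have rG: "r \<in> carrier G" using r R.PG by blast
    define u where "u = g \<otimes> t \<otimes> inv g"
    have uG: "u \<in> carrier G" using g tG by (simp add: u_def)
    have mult: "(g \<otimes> a \<otimes> inv g) \<otimes> (g \<otimes> b \<otimes> inv g) = g \<otimes> (a \<otimes> b) \<otimes> inv g"
      if "a \<in> carrier G" "b \<in> carrier G" for a b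
    proof -
      have "(g \<otimes> a \<otimes> inv g) \<otimes> (g \<otimes> b \<otimes> inv g) = g \<otimes> a \<otimes> (inv g \<otimes> g) \<otimes> b \<otimes> inv g"
        using that g(1) by (simp only: m_assoc m_closed inv_closed)
      then show ?thesis using that g(1) by (simp add: m_assoc)
    qed
    have zu: "z \<otimes> u = u \<otimes> z" using mult[OF rG tG] mult[OF tG rG] comm[OF r(1)]
      by (simp add: r(2) u_def)
    have "u \<otimes> u = \<one>" using mult[OF tG tG] t2 tG g(1) by (simp add: u_def numeral_2_eq_2)
    then have u2: "u [^] (2::nat) = \<one>" using uG by (simp add: numeral_2_eq_2)
    have u1: "u \<noteq> \<one>"
    proof
      assume "u = \<one>"
      then have "g \<otimes> t = g" using g(1) tG unfolding u_def
        by (metis inv_closed inv_equality inv_inv m_closed)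
      then show False using g(1) tG t(2) by simp
    qed
    have u4: "u [^] (4::nat) = \<one>" using u2 uG nat_pow_pow[of u 2 2] by simp
    have u3: "u [^] (3::nat) = u" using u2 uG by (simp add: numeral_3_eq_3 numeral_2_eq_2)
    have z4: "z [^] (4::nat) = z" using R3[OF z] nat_pow_mult[of z 3 1] by simp
    \<comment> \<open>For commuting z of order 3 and u of order 2, the fourth power of z u recovers
      z and the third power recovers u.\<close>
    have "(z \<otimes> u) [^] (4::nat) = z" using pow_mult_distrib[OF zu R3(2)[OF z] uG] u4 z4 R3(2)[OF z]
      by simp
    moreover have "(z \<otimes> u) [^] (3::nat) = u"
    using pow_mult_distrib[OF zu R3(2)[OF z] uG] u3 R3(1)[OF z] uG by simp
    ultimately show "z \<in> (\<lambda>w. w [^] (4::nat)) ` W"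
      using z u1 uG R3(2)[OF z] by (intro image_eqI[of _ _ "z \<otimes> u"]) (auto simp: W_def)
  qed
  then have "card R.p_elements \<le> card W" using surj_card_le[OF fW] by blast
  then have cW: "card W \<ge> 56" using c3 by simp
  have W12: "w [^] (12::nat) = \<one>" "w \<in> carrier G" "w [^] (3::nat) \<noteq> \<one>" "w [^] (4::nat) \<noteq> \<one>"
    if "w \<in> W" for w
  proof -
    have w: "w \<in> carrier G" "w [^] (4::nat) \<in> R.p_elements" "w [^] (3::nat) \<noteq> \<one>" using that
      by (auto simp: W_def)
    show "w [^] (12::nat) = \<one>" using R3(1)[OF w(2)] nat_pow_pow[OF w(1), of 4 3] by simp
    show "w \<in> carrier G" "w [^] (3::nat) \<noteq> \<one>" "w [^] (4::nat) \<noteq> \<one>" using w R3(3)[OF w(2)] by auto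
  qed
  have d1: "W \<inter> R.p_elements = {}" using W12(3) R3(1) by blast
  have d2: "W \<inter> P.p_elements = {}"
  proof -
    have False if w: "w \<in> W" "w \<in> P.p_elements" for w
    proof -
      have "w [^] (7::nat) = \<one>" using P.p_elements_pow[OF w(2)] by simp
      then have "w [^] gcd 7 (12::nat) = \<one>"
        using pow_gcd_eq_one[OF W12(2)[OF w(1)]] W12(1)[OF w(1)] by blast
      then have "w = \<one>" using W12(2)[OF w(1)] by (simp add: gcd_non_0_nat)
      then show False using W12(3)[OF w(1)] by simp
    qed
    then show ?thesis by blast
  qed
  have d3: "W \<inter> Q.p_elements = {}"
  proof -
    have False if w: "w \<in> W" "w \<in> Q.p_elements" for w
    proof -
      have "w [^] (8::nat) = \<one>" using Q.p_elements_pow[OF w(2)] by simp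
      then have "w [^] gcd 8 (12::nat) = \<one>"
        using pow_gcd_eq_one[OF W12(2)[OF w(1)]] W12(1)[OF w(1)] by blast
      then show False using W12(4)[OF w(1)] by (simp add: gcd_non_0_nat)
    qed
    then show ?thesis by blast
  qed
  have d4: "R.p_elements \<inter> P.p_elements = {}" using R.p_elements_disjoint[OF P(1)] by simp
  have d5: "R.p_elements \<inter> Q.p_elements = {}" using R.p_elements_disjoint[OF Q(1)] by simp
  have d6: "P.p_elements \<inter> Q.p_elements = {}" using P.p_elements_disjoint[OF Q(1)] by simp
  have "card (R.p_elements \<union> (P.p_elements \<union> Q.p_elements)) =
      card R.p_elements + (card P.p_elements + card Q.p_elements)"
    using R.finite_p_elements P.finite_p_elements Q.finite_p_elements d4 d5 d6
    by (simp add: card_Un_disjoint Int_Un_distrib)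
  then have "card (W \<union> (R.p_elements \<union> (P.p_elements \<union> Q.p_elements))) =
      card W + (card R.p_elements + (card P.p_elements + card Q.p_elements))"
    using fW R.finite_p_elements P.finite_p_elements Q.finite_p_elements d1 d2 d3
    by (simp add: card_Un_disjoint Int_Un_distrib)
  \<comment> \<open>At least 56 + 56 + 48 + 8 = 168 elements besides the identity.\<close>
  moreover have "card (W \<union> (R.p_elements \<union> (P.p_elements \<union> Q.p_elements))) < card (carrier G)"
  proof (rule psubset_card_mono[OF fin])
    have "\<one> \<notin> W" by (simp add: W_def)
    then show "W \<union> (R.p_elements \<union> (P.p_elements \<union> Q.p_elements)) \<subset> carrier G"
      using R.p_elements_subset P.p_elements_subset Q.p_elements_subset W12(2) by blast
  qed
  ultimately show False using n cW c3 c7 c2 by (simp add: order_def)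
qed

theorem (in exceptional_simple_group) iso_alt_group_5: "G \<cong> alt_group 5"
  using order_cases order_not_30 order_not_56 order_not_90 order_not_105 order_not_120 order_not_132
    order_not_144 order_not_168 order_not_180 order_60_iso by blast

section \<open>Reduction to simple sections\<close>

lemma (in group) solvable_trivial: "carrier G = {\<one>} \<Longrightarrow> solvable G"
  using solvable_seq.unity[of G] by (simp add: solvable_def)

text \<open>Let N be a proper normal subgroup of greatest order. It is solvable by the minimality
  assumption on G, so the quotient is not. A normal subgroup of the quotient pulls back to a normal
  subgroup of G containing N.\<close>

lemma (in group) simple_nonsolvable_quotient:
  assumes fin: "finite (carrier G)" and ns: "\<not> solvable G"
    and min: "\<And>N. subgroup N G \<Longrightarrow> N \<noteq> carrier G \<Longrightarrow> solvable (G\<lparr>carrier := N\<rparr>)"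
  obtains N where "N \<lhd> G" "nonsolvable_simple_group (G Mod N)"
proof -
  let ?S = "{N. N \<lhd> G \<and> N \<noteq> carrier G}"
  have "carrier G \<noteq> {\<one>}" using solvable_trivial ns by blast
  then have "{\<one>} \<in> ?S" using one_is_normal by auto
  moreover have "card N < Suc (card (carrier G))" if "N \<in> ?S" for N
  proof -
    have "N \<subseteq> carrier G" using that normal_imp_subgroup subgroup.subset by blast
    then show ?thesis using card_mono[OF fin] by (simp add: le_imp_less_Suc)
  qed
  ultimately obtain N where N: "N \<in> ?S" and max: "\<And>K. K \<in> ?S \<Longrightarrow> card K \<le> card N"
    using ex_has_greatest_nat[of "\<lambda>N. N \<in> ?S" "{\<one>}" card "Suc (card (carrier G))"] by blast
  then have NG: "N \<lhd> G" "N \<noteq> carrier G" by auto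
  interpret N: normal N G by (rule NG(1))
  interpret Q: group "G Mod N" by (rule N.factorgroup_is_group)
  interpret h: group_hom G "G Mod N" "\<lambda>a. N #> a" by (rule N.group_hom_Mod)
  interpret i: group_hom "G\<lparr>carrier := N\<rparr>" G "\<lambda>x. x"
    using subgroup_imp_group[OF N.subgroup_axioms]
    by (auto simp: group_hom_def group_hom_axioms_def is_group hom_def)
  have one: "\<one>\<^bsub>G Mod N\<^esub> = N" by (simp add: FactGroup_def)
  have ker: "N #> x = N \<longleftrightarrow> x \<in> N" if "x \<in> carrier G" for x
    using that N.rcos_const rcos_self[OF that N.subgroup_axioms] by auto
  have nsQ: "\<not> solvable (G Mod N)"
  proof
    assume "solvable (G Mod N)"
    moreover have "kernel G (G Mod N) (\<lambda>a. N #> a) \<subseteq> (\<lambda>x. x) ` carrier (G\<lparr>carrier := N\<rparr>)"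
      using ker by (auto simp: kernel_def one)
    ultimately have "solvable G"
      using solvable_condition[OF i.group_hom_axioms h.group_hom_axioms N.surj_Mod]
        min[OF N.subgroup_axioms NG(2)] by blast
    then show False using ns by blast
  qed
  have finQ: "finite (carrier (G Mod N))"
    using fin N.surj_Mod by (metis finite_imageI)
  have "nonsolvable_simple_group (G Mod N)"
  proof (unfold_locales)
    have "carrier (G Mod N) \<noteq> {\<one>\<^bsub>G Mod N\<^esub>}" using Q.solvable_trivial nsQ by blast
    moreover have "card (carrier (G Mod N)) > 0" using finQ Q.one_closed
    by (metis card_gt_0_iff empty_iff)
    ultimately show "1 < order (G Mod N)"
      using Q.one_closed
      by (metis card_1_singletonE less_one linorder_neqE_nat not_less_zero order_def singletonD)
    show "finite (carrier (G Mod N))" "\<not> solvable (G Mod N)" by (fact finQ nsQ)+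
    fix K assume K: "K \<lhd> G Mod N"
    interpret K: normal K "G Mod N" by (rule K)
    let ?K = "{x \<in> carrier G. N #> x \<in> K}"
    have "?K \<lhd> G"
      unfolding normal_inv_iff
    proof (intro conjI ballI)
      show "subgroup ?K G" by (rule h.subgroup_preimage[OF K.subgroup_axioms])
      fix x y assume x: "x \<in> carrier G" and y: "y \<in> ?K"
      have "N #> (x \<otimes> y \<otimes> inv x) = (N #> x) \<otimes>\<^bsub>G Mod N\<^esub> (N #> y) \<otimes>\<^bsub>G Mod N\<^esub> inv\<^bsub>G Mod N\<^esub> (N #> x)"
        using x y by simp
      then show "x \<otimes> y \<otimes> inv x \<in> ?K" using x y K.inv_op_closed2 h.hom_closed[OF x] by simp
    qed
    \<comment> \<open>Greatest order is enough here: a preimage that contains N and has at most |N|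
      elements equals N.\<close>
    then consider "?K = carrier G" | "card ?K \<le> card N" using max by blast
    then show "K = carrier (G Mod N) \<or> K = {\<one>\<^bsub>G Mod N\<^esub>}"
    proof cases
      case 1
      then have "carrier (G Mod N) \<subseteq> K" unfolding N.surj_Mod[symmetric] by auto
      then show ?thesis using K.subset by blast
    next
      case 2
      have "N \<subseteq> ?K"
      proof
        fix x assume x: "x \<in> N"
        then have "N #> x = \<one>\<^bsub>G Mod N\<^esub>" using ker N.subset one by auto
        then show "x \<in> ?K" using x K.one_closed by simp
      qed
      moreover have "finite ?K" using fin by simp
      ultimately have eq: "?K = N" using 2 card_seteq by metis
      have "k = \<one>\<^bsub>G Mod N\<^esub>" if k: "k \<in> K" for k
      proof -
        obtain x where x: "x \<in> carrier G" "k = N #> x" using k K.subset N.surj_Mod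
        by (metis imageE subsetD)
        then have "x \<in> N" using k eq by blast
        then show ?thesis using ker x one by simp
      qed
      then show ?thesis using K.one_closed by blast
    qed
  qed
  then show ?thesis using that NG(1) by blast
qed

text \<open>A nonsolvable subgroup U of least order has only solvable proper subgroups.\<close>

lemma (in group) simple_nonsolvable_section:
  assumes fin: "finite (carrier G)" and ns: "\<not> solvable G"
  obtains U N
  where "subgroup U G" "N \<lhd> (G\<lparr>carrier := U\<rparr>)" "nonsolvable_simple_group ((G\<lparr>carrier := U\<rparr>) Mod N)"
proof -
  define U where "U = (ARG_MIN card U. subgroup U G \<and> \<not> solvable (G\<lparr>carrier := U\<rparr>))"
  have "subgroup (carrier G) G \<and> \<not> solvable (G\<lparr>carrier := carrier G\<rparr>)" using ns subgroup_self
    by simp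
  then have U: "subgroup U G \<and> \<not> solvable (G\<lparr>carrier := U\<rparr>)"
    and min: "\<And>V. subgroup V G \<and> \<not> solvable (G\<lparr>carrier := V\<rparr>) \<Longrightarrow> card U \<le> card V"
    using arg_min_nat_lemma[of "\<lambda>U. subgroup U G \<and> \<not> solvable (G\<lparr>carrier := U\<rparr>)" _ card]
    unfolding U_def by blast+
  interpret U: group "G\<lparr>carrier := U\<rparr>" using subgroup_imp_group U by blast
  have fU: "finite U" using U fin subgroup.subset finite_subset by metis
  have "solvable (G\<lparr>carrier := V\<rparr>)" if V: "subgroup V (G\<lparr>carrier := U\<rparr>)" "V \<noteq> U" for V
  proof (rule ccontr)
    assume "\<not> solvable (G\<lparr>carrier := V\<rparr>)"
    then have "card U \<le> card V" using min[of V] incl_subgroup V(1) U by blast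
    moreover have "V \<subseteq> U" using subgroup.subset[OF V(1)] by simp
    ultimately show False using V(2) fU card_seteq by metis
  qed
  then obtain N where "N \<lhd> (G\<lparr>carrier := U\<rparr>)" "nonsolvable_simple_group ((G\<lparr>carrier := U\<rparr>) Mod N)"
    using U.simple_nonsolvable_quotient fU U by auto
  then show ?thesis using that U by blast
qed

theorem (in group) solvable_or_section_alt_group_5:
  assumes fin: "finite (carrier G)" and tp: "tp G > (1/2) ^ 40" and ns: "\<not> solvable G"
  shows "has_section G (alt_group 5)"
proof -
  obtain U N where U: "subgroup U G" and N: "N \<lhd> (G\<lparr>carrier := U\<rparr>)"
    and simple: "nonsolvable_simple_group ((G\<lparr>carrier := U\<rparr>) Mod N)"
    using simple_nonsolvable_section[OF fin ns] .
  let ?Q = "(G\<lparr>carrier := U\<rparr>) Mod N"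
  interpret Q: nonsolvable_simple_group ?Q by (rule simple)
  have "tp ?Q > (1/2) ^ 40" using tp tp_section[OF fin U N] by simp
  then have "transversal_prob ?Q H > (1/2) ^ 40" if "subgroup H ?Q" for H
    using Q.tp_le[OF Q.fin that] by simp
  then interpret Q: exceptional_simple_group ?Q by unfold_locales
  show ?thesis unfolding has_section_def using U N Q.iso_alt_group_5 by blast
qed

section \<open>The bound is attained\<close>

lemma match_prob_ge:
  assumes "(real k * b) ^ k \<le> fact k" "k > 0" shows "b ^ k \<le> match_prob k"
  using assms by (simp add: match_prob_def pos_le_divide_eq power_mult_distrib mult.commute)

text \<open>The constant lies just below 1/e, which fits k! > (k/e)^k, while (4/11)^27 is still
  above 2^-40.\<close>

lemma match_prob_ge_4_11:
  assumes "1 \<le> k" "k \<le> 28" shows "(4 / 11) ^ k \<le> match_prob k"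
proof (rule match_prob_ge)
  have "k = 1 \<or> k = 2 \<or> k = 3 \<or> k = 4 \<or> k = 5 \<or> k = 6 \<or> k = 7 \<or> k = 8 \<or> k = 9 \<or> k = 10 \<or> k = 11 \<or>
    k = 12 \<or> k = 13 \<or> k = 14 \<or> k = 15 \<or> k = 16 \<or> k = 17 \<or> k = 18 \<or> k = 19 \<or> k = 20 \<or> k = 21 \<or>
    k = 22 \<or> k = 23 \<or> k = 24 \<or> k = 25 \<or> k = 26 \<or> k = 27 \<or> k = 28"
    using assms by arith
  then show "(real k * (4 / 11)) ^ k \<le> fact k"
    by (elim disjE) (simp_all add: fact_numeral power_divide divide_le_eq)
qed (use assms in simp)

context group
begin

text \<open>H itself is a double coset with factor 1. The numbers k of the others add up to the
  index minus 1, so the bounds b^k multiply to the stated power. Each k divides |H| and is less than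
  the index.\<close>

lemma transversal_prob_ge:
  assumes H: "subgroup H G" and fin: "finite (carrier G)"
    and b: "0 \<le> b" "\<And>k. 1 \<le> k \<Longrightarrow> k \<le> card H \<Longrightarrow> k < card (rcosets H) \<Longrightarrow> b ^ k \<le> match_prob k"
  shows "b ^ (card (rcosets H) - 1) \<le> transversal_prob G H"
proof -
  let ?k = "\<lambda>D. card D div card H"
  note D = finite_dcosets[OF H fin]
  have HD: "H \<in> dcosets G H" using one_dcoset[OF H] by (auto simp: dcosets_def)
  have kH: "?k H = 1" using card_H_pos[OF H fin] by simp
  have n: "card (rcosets H) = 1 + (\<Sum>D\<in>dcosets G H - {H}. ?k D)"
    unfolding card_rcosets_eq_sum[OF H fin] using sum.remove[OF D HD, of ?k] kH by simp
  have "b ^ (card (rcosets H) - 1) = (\<Prod>D\<in>dcosets G H - {H}. b ^ ?k D)"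
    unfolding n by (simp add: power_sum)
  also have "\<dots> \<le> (\<Prod>D\<in>dcosets G H - {H}. match_prob (?k D))"
  proof (rule prod_mono, intro conjI)
    fix E assume E: "E \<in> dcosets G H - {H}"
    then obtain x where x: "x \<in> carrier G" "E = dcoset G H x" by (auto simp: dcosets_def)
    have "?k E = card ((\<lambda>y. H #> y) ` E)"
      using card_dcoset(2)[OF H fin x(1)] card_H_pos[OF H fin] x(2) by simp
    then have "?k E dvd card H" using card_dcoset(4)[OF H fin x(1)] x(2) by (metis dvd_triv_left)
    then have "?k E \<le> card H" using card_H_pos[OF H fin] by (rule dvd_imp_le)
    moreover have "?k E \<le> (\<Sum>D\<in>dcosets G H - {H}. ?k D)"
      using D E by (intro member_le_sum) auto
    ultimately show "b ^ ?k E \<le> match_prob (?k E)"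
      using b(2)[of "?k E"] card_dcoset_div(2)[OF H fin, of E] E n by auto
  qed (use b(1) in simp)
  also have "\<dots> = transversal_prob G H"
    unfolding transversal_prob_eq_prod[OF H fin]
    using prod.remove[OF D HD, of "\<lambda>D. match_prob (?k D)"] kH by simp
  finally show ?thesis .
qed

text \<open>Only subgroups of order 2 come close to the bound; for them the normaliser enters. The
  other orders are settled by a base b for \<open>transversal_prob_ge\<close> that suits the
  index.\<close>

lemma tp_order_168:
  assumes fin: "finite (carrier G)" and n: "order G = 168"
    and inv: "\<And>H. subgroup H G \<Longrightarrow> card H = 2 \<Longrightarrow> card (normalizer G H) \<ge> 8"
  shows "(1/2) ^ 40 \<le> tp G"
proof (rule tp_geI[OF fin])
  fix H assume H: "subgroup H G"
  let ?h = "card H" and ?n = "card (rcosets H)"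
  have nh: "?n * ?h = 168" using lagrange[OF H] n by simp
  have h0: "?h > 0" by (rule card_H_pos[OF H fin])
  consider "?h = 1" | "?h = 2" | "?h = 3" | "?h = 4" | "?h = 5" | "?h \<ge> 6" using h0 by linarith
  then show "(1/2) ^ 40 \<le> transversal_prob G H"
  proof cases
    case 1
    have "k = 1" if "1 \<le> k" "k \<le> ?h" for k using that 1 by simp
    then have "1 ^ (?n - 1) \<le> transversal_prob G H"
      by (intro transversal_prob_ge[OF H fin]) force+
    moreover have "(1/2) ^ 40 \<le> (1::real)" by (simp add: power_le_one)
    ultimately show ?thesis by simp
  next
    case 2
    obtain m
    where m: "transversal_prob G H = match_prob 2 ^ m" "m * 2\<^sup>2 + card (normalizer G H) = order G"
      using transversal_prob_prime[OF H fin] 2 by (metis two_is_prime_nat)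
    \<comment> \<open>From 4 m <= 168 - 8.\<close>
    then have "m \<le> 40" using inv[OF H 2] n by simp
    then have "(1/2) ^ 40 \<le> (1/2 :: real) ^ m" by (intro power_decreasing) auto
    moreover have "match_prob 2 = 1/2" by (simp add: match_prob_def)
    ultimately show ?thesis using m(1) by (simp only:)
  next
    case 3
    \<comment> \<open>The base must be at most the cube root of 3!/3^3, about 0.6057, and at least
      the 55th root of 2^-40, about 0.6041.\<close>
    have "(121/200) ^ k \<le> match_prob k" if "1 \<le> k" "k \<le> ?h" for k
    proof -
      have "k = 1 \<or> k = 2 \<or> k = 3" using that 3 by arith
      then show ?thesis by (intro match_prob_ge) (auto simp: fact_numeral power_divide)
    qed
    then have "(121/200) ^ (?n - 1) \<le> transversal_prob G H"
      by (intro transversal_prob_ge[OF H fin]) auto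
    moreover have "?n - 1 = 55" using nh 3 by simp
    moreover have "(1/2) ^ 40 \<le> (121/200 :: real) ^ 55" by (simp add: power_divide)
    ultimately show ?thesis by simp
  next
    case 4
    \<comment> \<open>The fourth root of 4!/4^4 is about 0.553, and the exponent 41 asks for a base
      of about 0.509.\<close>
    have "(11/20) ^ k \<le> match_prob k" if "1 \<le> k" "k \<le> ?h" for k
    proof -
      have "k = 1 \<or> k = 2 \<or> k = 3 \<or> k = 4" using that 4 by arith
      then show ?thesis by (intro match_prob_ge) (auto simp: fact_numeral power_divide)
    qed
    then have "(11/20) ^ (?n - 1) \<le> transversal_prob G H"
      by (intro transversal_prob_ge[OF H fin]) auto
    moreover have "?n - 1 = 41" using nh 4 by simp
    moreover have "(1/2) ^ 40 \<le> (11/20 :: real) ^ 41" by (simp add: power_divide)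
    ultimately show ?thesis by simp
  next
    case 5
    then show ?thesis using nh by presburger
  next
    case 6
    \<comment> \<open>An index of at most 28 bounds both the exponent, by 27, and the sizes k that
      occur.\<close>
    have "?n * 6 \<le> 168" using nh 6 by (metis mult_le_mono2)
    then have n28: "?n \<le> 28" by simp
    have "(4/11) ^ (?n - 1) \<le> transversal_prob G H"
      by (rule transversal_prob_ge[OF H fin]) (use n28 match_prob_ge_4_11 in auto)
    moreover have "(1/2) ^ 40 \<le> (4/11 :: real) ^ 27" by (simp add: power_divide)
    moreover have "(4/11 :: real) ^ 27 \<le> (4/11) ^ (?n - 1)" using n28
    by (intro power_decreasing) auto
    ultimately show ?thesis by linarith
  qed
qed

lemma not_has_section_order:
  assumes fin: "finite (carrier G)" and K: "\<not> card (carrier K) dvd order G"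
  shows "\<not> has_section G K"
proof
  assume "has_section G K"
  then obtain U N where U: "subgroup U G" and N: "N \<lhd> (G\<lparr>carrier := U\<rparr>)"
    and iso: "(G\<lparr>carrier := U\<rparr>) Mod N \<cong> K" by (auto simp: has_section_def)
  interpret U: group "G\<lparr>carrier := U\<rparr>" by (rule subgroup_imp_group[OF U])
  have "card (carrier K) = card (rcosets\<^bsub>G\<lparr>carrier := U\<rparr>\<^esub> N)"
    using iso_same_card[OF iso] by (simp add: FactGroup_def)
  then have "card (carrier K) dvd card U"
    using U.lagrange[OF normal_imp_subgroup[OF N]]
    by (metis
    dvd_triv_left
    order_def partial_object.select_convs(1)
    partial_object.surjective partial_object.update_convs(1))
  moreover have "card U dvd order G" using lagrange[OF U] by (metis dvd_triv_right)
  ultimately show False using K dvd_trans by blast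
qed

end

text \<open>Truth values encode the field with two elements, with inequality as addition; matrices are
  triples of rows. The group is \<open>GL(3,2)\<close>, which is isomorphic to \<open>PSL(2,7)\<close>.\<close>

type_synonym vec3 = "bool \<times> bool \<times> bool"
type_synonym mat3 = "vec3 \<times> vec3 \<times> vec3"

fun dot :: "vec3 \<Rightarrow> vec3 \<Rightarrow> bool"
  where "dot (a, b, c) (x, y, z) \<longleftrightarrow> ((a \<and> x) \<noteq> (b \<and> y)) \<noteq> (c \<and> z)"

fun vec_mult :: "vec3 \<Rightarrow> mat3 \<Rightarrow> vec3"
  where "vec_mult v ((a, b, c), (d, e, f), (g, h, i)) =
  (dot v (a, d, g), dot v (b, e, h), dot v (c, f, i))"

fun mat_mult :: "mat3 \<Rightarrow> mat3 \<Rightarrow> mat3"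
  where "mat_mult (u, v, w) M = (vec_mult u M, vec_mult v M, vec_mult w M)"

definition mat_one :: mat3
  where "mat_one = ((True, False, False), (False, True, False), (False, False, True))"

fun cross :: "vec3 \<Rightarrow> vec3 \<Rightarrow> vec3"
  where "cross (a, b, c) (x, y, z) = ((b \<and> z) \<noteq> (c \<and> y), (c \<and> x) \<noteq> (a \<and> z), (a \<and> y) \<noteq> (b \<and> x))"

fun mat_det :: "mat3 \<Rightarrow> bool"
  where "mat_det (u, v, w) = dot u (cross v w)"

fun transp :: "mat3 \<Rightarrow> mat3"
  where "transp ((a, b, c), (d, e, f), (g, h, i)) = ((a, d, g), (b, e, h), (c, f, i))"

text \<open>The columns are the cross products of pairs of rows, so multiplying by the rows gives
  the determinant on the diagonal and zero elsewhere.\<close>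

fun adjugate :: "mat3 \<Rightarrow> mat3"
  where "adjugate (u, v, w) = transp (cross v w, cross w u, cross u v)"

definition vecs :: "vec3 list"
  where "vecs = List.product [False, True] (List.product [False, True] [False, True])"

definition mats :: "mat3 list"
  where "mats = List.product vecs (List.product vecs vecs)"

lemma set_vecs: "set vecs = UNIV"
  by (auto simp: vecs_def)

lemma set_mats: "set mats = UNIV"
  by (auto simp: mats_def set_vecs)

lemma distinct_mats: "distinct mats"
proof -
  have "distinct vecs" by (simp add: vecs_def)
  then show ?thesis by (simp add: mats_def distinct_product)
qed

lemma xor_distrib:
  "((p \<noteq> q) \<and> r) = ((p \<and> r) \<noteq> (q \<and> r))" "(r \<and> (p \<noteq> q)) = ((r \<and> p) \<noteq> (r \<and> q))"
  by auto

lemma xor_ac: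
  "((p \<noteq> q) \<noteq> r) = (p \<noteq> (q \<noteq> r))" "(p \<noteq> (q \<noteq> r)) = (q \<noteq> (p \<noteq> r))" "(p \<noteq> q) = (q \<noteq> p)"
  for p q r :: bool
  by auto

lemma vec_mult_assoc: "vec_mult (vec_mult v A) B = vec_mult v (mat_mult A B)"
proof -
  obtain v1 v2 v3 where v: "v = (v1, v2, v3)" by (metis prod_cases3)
  obtain a b c d e f g h i where A: "A = ((a, b, c), (d, e, f), (g, h, i))" by (metis prod_cases3)
  obtain a' b' c' d' e' f' g' h' i' where B: "B = ((a', b', c'), (d', e', f'), (g', h', i'))"
  by (metis prod_cases3)
  show ?thesis
    unfolding v A B vec_mult.simps mat_mult.simps dot.simps prod.inject
    by (simp only: xor_distrib xor_ac conj_assoc)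
qed

lemma mat_mult_assoc: "mat_mult (mat_mult A B) C = mat_mult A (mat_mult B C)"
  by (cases A) (simp add: vec_mult_assoc)

lemma vec_mult_one: "vec_mult v mat_one = v"
  by (cases v) (simp add: mat_one_def)

lemma mat_mult_one: "mat_mult A mat_one = A" "mat_mult mat_one A = A"
  by (cases A; simp add: vec_mult_one) (cases A; simp add: mat_one_def split: prod.splits; auto)

lemma adjugate_mult:
  assumes "mat_det A" shows "mat_mult A (adjugate A) = mat_one \<and> mat_mult (adjugate A) A = mat_one"
proof -
  have "\<forall>A\<in>set mats. if mat_det A then mat_mult A (adjugate A) = mat_one \<and>
      mat_mult (adjugate A) A = mat_one else True"
    by code_simp
  from bspec[OF this, of A] show ?thesis using assms by (simp only: set_mats UNIV_I if_True)
qed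

fun vec_add :: "vec3 \<Rightarrow> vec3 \<Rightarrow> vec3"
  where "vec_add (a, b, c) (x, y, z) = (a \<noteq> x, b \<noteq> y, c \<noteq> z)"

text \<open>Over the field with two elements, dependent rows include a zero row, two equal rows, or
  sum to zero. Each case names its coefficient vector.\<close>

lemma singular_kernel:
  assumes "\<not> mat_det A" shows "\<exists>v. v \<noteq> (False, False, False) \<and> vec_mult v A = (False, False, False)"
proof -
  obtain u v w where A: "A = (u, v, w)" by (metis prod_cases3)
  let ?z = "(False, False, False)"
  have "\<forall>(u, v, w)\<in>set mats. if mat_det (u, v, w) then True else
      if u = (False, False, False) then True else if v = (False, False, False) then True else
      if w = (False, False, False) then True else if u = v then True else if v = w then True else
      if u = w then True else vec_add u v = w"
    by code_simp
  from bspec[OF this, of A, unfolded set_mats A prod.case, OF UNIV_I]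
  have "u = ?z \<or> v = ?z \<or> w = ?z \<or> u = v \<or> v = w \<or> u = w \<or> vec_add u v = w"
    using assms unfolding A by (auto split: if_splits simp del: mat_det.simps)
  moreover obtain a b c d e f g h i where "u = (a, b, c)" "v = (d, e, f)" "w = (g, h, i)"
  by (metis prod_cases3)
  ultimately have "vec_mult (True, False, False) A = ?z \<or> vec_mult (False, True, False) A = ?z \<or>
      vec_mult (False, False, True) A = ?z \<or> vec_mult (True, True, False) A = ?z \<or>
      vec_mult (False, True, True) A = ?z \<or> vec_mult (True, False, True) A = ?z \<or>
      vec_mult (True, True, True) A = ?z"
    unfolding A by (elim disjE) simp_all
  then show ?thesis by (elim disjE) (rule exI, rule conjI[rotated], assumption, simp)+
qed

definition mat_monoid :: "mat3 monoid"
  where "mat_monoid = \<lparr>carrier = UNIV, monoid.mult = mat_mult, one = mat_one\<rparr>"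

lemma monoid_mat_monoid: "Group.monoid mat_monoid"
  by unfold_locales (auto simp: mat_monoid_def mat_mult_assoc mat_mult_one)

text \<open>An invertible matrix cannot annihilate a nonzero row vector; conversely the adjugate is
  an inverse when the determinant is 1.\<close>

lemma Units_mat_monoid: "Units mat_monoid = {A. mat_det A}"
proof (intro equalityI subsetI CollectI)
  fix A assume "A \<in> Units mat_monoid"
  then obtain B where B: "mat_mult A B = mat_one" by (auto simp: Units_def mat_monoid_def)
  show "mat_det A"
  proof (rule ccontr)
    assume "\<not> mat_det A"
    then obtain v where v: "v \<noteq> (False, False, False)" "vec_mult v A = (False, False, False)"
      using singular_kernel by blast
    have "v = vec_mult (vec_mult v A) B" by (simp add: vec_mult_assoc B vec_mult_one)
    also have "\<dots> = (False, False, False)" unfolding v(2) by (cases B) (auto split: prod.splits)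
    finally show False using v(1) by simp
  qed
next
  fix A assume "A \<in> {A. mat_det A}"
  then show "A \<in> Units mat_monoid" using adjugate_mult[of A]
    by (auto simp: Units_def mat_monoid_def simp del: split_paired_Ex)
qed

lemma card_Units: "card {A. mat_det A} = 168"
proof -
  have "{A. mat_det A} = set (filter mat_det mats)" by (auto simp: set_mats)
  also have "card \<dots> = length (filter mat_det mats)"
    by (rule distinct_card) (simp add: distinct_mats)
  also have "\<dots> = 168" by code_simp
  finally show ?thesis .
qed

text \<open>The matrix 1 + v^T w for v = (a, b, c): w is added to those rows of the identity where v
  has a one. It is a transvection in the usual sense for nonzero orthogonal v and w.\<close>

fun transvection :: "vec3 \<Rightarrow> vec3 \<Rightarrow> mat3"
  where "transvection (a, b, c) w =
    (if a then vec_add (True, False, False) w else (True, False, False),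
     if b then vec_add (False, True, False) w else (False, True, False),
     if c then vec_add (False, False, True) w else (False, False, True))"

text \<open>If \<open>A - 1\<close> is the rank one matrix \<open>u\<^sup>T w\<close>, then \<open>A\<close> commutes with \<open>1 + u\<^sup>T y\<close> for \<open>y\<close> orthogonal
  to \<open>u\<close> and with \<open>1 + x\<^sup>T w\<close> for \<open>x\<close> orthogonal to \<open>w\<close>.\<close>

fun commuting :: "mat3 \<Rightarrow> mat3 list"
  where "commuting (p, q, r) =
    (let p' = vec_add (True, False, False) p; q' = vec_add (False, True, False) q;
         r' = vec_add (False, False, True) r; z = (False, False, False);
         u = (p' \<noteq> z, q' \<noteq> z, r' \<noteq> z); w = (if p' \<noteq> z then p' else if q' \<noteq> z then q' else r')
     in map (\<lambda>(x, y). mat_mult (transvection u y) (transvection x w))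
       (List.product (filter (\<lambda>x. \<not> dot x w) vecs) (filter (\<lambda>y. \<not> dot u y) vecs)))"

text \<open>In characteristic two A - 1 has square zero, so in dimension three it has rank one. Of
  the sixteen products in \<open>commuting A\<close>, eight are distinct.\<close>

lemma involution_centralizer:
  assumes "mat_mult A A = mat_one" "A \<noteq> mat_one"
  shows "card {B. mat_det B \<and> mat_mult A B = mat_mult B A} \<ge> 8"
proof -
  have "\<forall>A\<in>set mats. if mat_mult A A = mat_one then (if A = mat_one then True else
      list_all (\<lambda>B. mat_det B \<and> mat_mult A B = mat_mult B A) (commuting A) \<and>
      length (remdups (commuting A)) = 8) else True"
    by code_simp
  from bspec[OF this, of A, unfolded set_mats, OF UNIV_I]
  have "list_all (\<lambda>B. mat_det B \<and> mat_mult A B = mat_mult B A) (commuting A) \<and>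
    length (remdups (commuting A)) = 8"
    using assms by (simp only: if_True if_False simp_thms)
  then have *: "\<forall>B\<in>set (commuting A). mat_det B \<and> mat_mult A B = mat_mult B A"
    "length (remdups (commuting A)) = 8" unfolding list_all_iff by blast+
  have "8 = card (set (commuting A))" using *(2) by (simp add: length_remdups_card_conv)
  also have "\<dots> \<le> card {B. mat_det B \<and> mat_mult A B = mat_mult B A}"
    using *(1) by (intro card_mono) auto
  finally show ?thesis .
qed

section \<open>PSL(2,7) as a group of natural numbers\<close>

definition psl_2_7 :: "nat monoid"
  where "psl_2_7 = image_group (to_nat :: mat3 \<Rightarrow> nat) (units_of mat_monoid)"

abbreviation "gl_3_2 \<equiv> units_of mat_monoid"

lemma group_gl: "Group.group gl_3_2"
  by (rule monoid.units_group[OF monoid_mat_monoid])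

lemma gl_simps: "carrier gl_3_2 = {A. mat_det A}" "x \<otimes>\<^bsub>gl_3_2\<^esub> y = mat_mult x y"
  "\<one>\<^bsub>gl_3_2\<^esub> = mat_one"
  by (simp add: units_of_carrier Units_mat_monoid)
    (simp_all add: units_of_mult units_of_one mat_monoid_def)

lemma iso_psl: "to_nat \<in> iso gl_3_2 psl_2_7"
  unfolding iso_def hom_def psl_2_7_def
  by (auto simp: image_group_def bij_betw_def inv_into_f_f inj_on_def)

lemma group_psl: "Group.group psl_2_7"
  using group.iso_imp_img_group[OF group_gl iso_psl] by (simp add: psl_2_7_def image_group_def)

lemma order_psl: "order psl_2_7 = 168" "finite (carrier psl_2_7)"
proof -
  have "card (carrier psl_2_7) = 168"
    using iso_same_card[of gl_3_2 psl_2_7] iso_psl card_Units by (auto simp: is_iso_def gl_simps)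
  then show "order psl_2_7 = 168" "finite (carrier psl_2_7)"
    by (simp add: order_def) (metis \<open>card (carrier psl_2_7) = 168\<close> card.infinite zero_neq_numeral)
qed

text \<open>S consists of the six elementary transvections 1 + E_ij. Each is the commutator of 1 +
  E_ik and 1 + E_kj, where k is the third index, so S survives in every term of the derived series.
  The commutators are written without inverses because all members of S are involutions.\<close>

lemma not_solvable_gl: "\<not> solvable gl_3_2"
proof
  interpret G: Group.group gl_3_2 by (rule group_gl)
  let ?e = "(True, False, False)" and ?f = "(False, True, False)" and ?g = "(False, False, True)"
  define S
  where "S = {transvection ?e ?f, transvection ?e ?g, transvection ?f ?e, transvection ?f ?g,
    transvection ?g ?e, transvection ?g ?f}"
  have SG: "S \<subseteq> carrier gl_3_2" by (auto simp: S_def gl_simps)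
  have inv: "inv\<^bsub>gl_3_2\<^esub> s = s" if "s \<in> S" for s
    using that SG by (intro G.inv_equality) (auto simp: S_def gl_simps mat_one_def)
  have comm: "\<exists>x\<in>S. \<exists>y\<in>S. s = mat_mult (mat_mult (mat_mult x y) x) y" if "s \<in> S" for s
    using that unfolding S_def by auto
  have step: "S \<subseteq> derived gl_3_2 H" if H: "S \<subseteq> H" for H
  proof
    fix s assume "s \<in> S"
    then obtain x y where xy: "x \<in> S" "y \<in> S" "s = mat_mult (mat_mult (mat_mult x y) x) y"
      using comm by blast
    then have "s = x \<otimes>\<^bsub>gl_3_2\<^esub> y \<otimes>\<^bsub>gl_3_2\<^esub> inv\<^bsub>gl_3_2\<^esub> x \<otimes>\<^bsub>gl_3_2\<^esub> inv\<^bsub>gl_3_2\<^esub> y"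
      by (simp add: inv gl_simps)
    then have "s \<in> derived_set gl_3_2 H" using xy H by blast
    then show "s \<in> derived gl_3_2 H" unfolding derived_def by (rule generate.incl)
  qed
  have sub: "S \<subseteq> (derived gl_3_2 ^^ n) (carrier gl_3_2)" for n
    by (induction n) (use SG step in auto)
  assume "solvable gl_3_2"
  then obtain n where n: "(derived gl_3_2 ^^ n) (carrier gl_3_2) = {\<one>\<^bsub>gl_3_2\<^esub>}"
    using G.solvable_iff_trivial_derived_seq by blast
  have "S \<subseteq> {mat_one}" using sub[of n] unfolding n gl_simps(3) .
  then show False by (simp add: S_def mat_one_def)
qed

lemma not_solvable_psl: "\<not> solvable psl_2_7"
proof -
  interpret h: group_hom gl_3_2 psl_2_7 to_nat
    using group_gl group_psl iso_psl by (simp add: group_hom_def group_hom_axioms_def iso_def)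
  show ?thesis using h.inj_hom_imp_solvable not_solvable_gl by (auto simp: inj_on_def)
qed

text \<open>A subgroup {1, t} is normalised by the centraliser of t, and the isomorphism carries the
  centraliser of an involution of GL(3,2) there.\<close>

lemma normalizer_psl:
  assumes H: "subgroup H psl_2_7" and c: "card H = 2"
  shows "8 \<le> card (normalizer psl_2_7 H)"
proof -
  interpret K: Group.group psl_2_7 by (rule group_psl)
  interpret H: subgroup H psl_2_7 by (rule H)
  interpret h: group_hom gl_3_2 psl_2_7 to_nat
    using group_gl group_psl iso_psl by (simp add: group_hom_def group_hom_axioms_def iso_def)
  have surj: "to_nat ` carrier gl_3_2 = carrier psl_2_7" using iso_psl
    by (simp add: iso_def bij_betw_def)
  have "H \<noteq> {\<one>\<^bsub>psl_2_7\<^esub>}" using c by auto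
  then obtain t where t: "t \<in> H" "t \<noteq> \<one>\<^bsub>psl_2_7\<^esub>" using H.one_closed by blast
  have "finite H" using c by (metis card.infinite zero_neq_numeral)
  then have Ht: "H = {\<one>\<^bsub>psl_2_7\<^esub>, t}"
    using card_subset_eq[of H "{\<one>\<^bsub>psl_2_7\<^esub>, t}"] t c H.one_closed by simp
  have "t \<in> to_nat ` carrier gl_3_2" unfolding surj by (rule H.mem_carrier[OF t(1)])
  then obtain A where A: "A \<in> carrier gl_3_2" "t = to_nat A" by blast
  have "t [^]\<^bsub>psl_2_7\<^esub> (2::nat) = \<one>\<^bsub>psl_2_7\<^esub>" using K.pow_card_subgroup[OF H t(1)] c by simp
  then have "t \<otimes>\<^bsub>psl_2_7\<^esub> t = \<one>\<^bsub>psl_2_7\<^esub>" using H.mem_carrier[OF t(1)] by (simp add: numeral_2_eq_2)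
  then have "to_nat (A \<otimes>\<^bsub>gl_3_2\<^esub> A) = to_nat \<one>\<^bsub>gl_3_2\<^esub>" using A h.hom_mult h.hom_one by simp
  then have A2: "mat_mult A A = mat_one" by (simp add: gl_simps)
  have A1: "A \<noteq> mat_one" using t(2) A(2) h.hom_one by (auto simp: gl_simps)
  let ?C = "{B. mat_det B \<and> mat_mult A B = mat_mult B A}"
  have sub: "to_nat ` ?C \<subseteq> normalizer psl_2_7 H"
  proof
    fix x assume "x \<in> to_nat ` ?C"
    then obtain B where B: "mat_det B" "mat_mult A B = mat_mult B A" "x = to_nat B" by blast
    then have BG: "B \<in> carrier gl_3_2" by (simp add: gl_simps)
    have x: "x \<in> carrier psl_2_7" using BG B(3) h.hom_closed by blast
    have "A \<otimes>\<^bsub>gl_3_2\<^esub> B = B \<otimes>\<^bsub>gl_3_2\<^esub> A" using B(2) by (simp add: gl_simps)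
    then have "t \<otimes>\<^bsub>psl_2_7\<^esub> x = x \<otimes>\<^bsub>psl_2_7\<^esub> t" using A BG B(3) h.hom_mult by metis
    then have "x <#\<^bsub>psl_2_7\<^esub> H = H #>\<^bsub>psl_2_7\<^esub> x"
      unfolding l_coset_def r_coset_def
      by (simp only: Ht UN_insert UN_empty K.l_one[OF x] K.r_one[OF x])
    then show "x \<in> normalizer psl_2_7 H" using K.mem_normalizer_iff[OF H] x by blast
  qed
  have finN: "finite (normalizer psl_2_7 H)"
  proof (rule finite_subset[OF _ order_psl(2)])
    show "normalizer psl_2_7 H \<subseteq> carrier psl_2_7" using K.mem_normalizer_iff[OF H] by blast
  qed
  have "8 \<le> card ?C" by (rule involution_centralizer[OF A2 A1])
  also have "\<dots> = card (to_nat ` ?C)"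
    by (rule card_image[OF inj_on_subset[OF inj_to_nat subset_UNIV], symmetric])
  also have "\<dots> \<le> card (normalizer psl_2_7 H)" by (rule card_mono[OF finN sub])
  finally show ?thesis .
qed

lemma psl_2_7_attains_bound:
  "Group.group psl_2_7" "finite (carrier psl_2_7)" "(1/2) ^ 40 \<le> tp psl_2_7" "\<not> solvable psl_2_7"
  "\<not> has_section psl_2_7 (alt_group 5)"
proof -
  interpret K: Group.group psl_2_7 by (rule group_psl)
  show "Group.group psl_2_7" "finite (carrier psl_2_7)" "\<not> solvable psl_2_7"
    by (fact group_psl order_psl(2) not_solvable_psl)+
  show "(1/2) ^ 40 \<le> tp psl_2_7"
    by (rule K.tp_order_168[OF order_psl(2,1) normalizer_psl])
  have "card (carrier (alt_group 5)) = 60" using alt_group_card_carrier[of 5]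
    by (simp add: fact_numeral)
  then show "\<not> has_section psl_2_7 (alt_group 5)"
    by (intro K.not_has_section_order[OF order_psl(2)]) (simp add: order_psl(1))
qed

theorem proposition4p3:
  fixes G :: "('a, 'm) monoid_scheme"
  shows "(group G \<and> finite (carrier G) \<and> tp G > (1 / 2) ^ 40
            \<longrightarrow> solvable G \<or> has_section G (alt_group 5))
       \<and> (\<forall>c::real. c < (1 / 2) ^ 40 \<longrightarrow>
            \<not> (\<forall>K :: nat monoid. group K \<and> finite (carrier K) \<and> tp K > c
                  \<longrightarrow> solvable K \<or> has_section K (alt_group 5)))"
proof (intro conjI impI allI notI)
  assume "group G \<and> finite (carrier G) \<and> tp G > (1 / 2) ^ 40"
  then show "solvable G \<or> has_section G (alt_group 5)"
    using group.solvable_or_section_alt_group_5 by blast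
next
  fix c :: real
  assume "c < (1 / 2) ^ 40"
    and K: "\<forall>K :: nat monoid. group K \<and> finite (carrier K) \<and> tp K > c
      \<longrightarrow> solvable K \<or> has_section K (alt_group 5)"
  then have "tp psl_2_7 > c" using psl_2_7_attains_bound(3) by linarith
  then show False using K psl_2_7_attains_bound by blast
qed

end
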